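(* Let $W_\Gamma$ be a $2$-dimensional right-angled Coxeter group. Every one-ended Coxeter subgroup of $W_\Gamma$ is a reflection subgroup of $W_\Gamma$. Consequently, every such Coxeter subgroup is quasiconvex in $W_\Gamma$.
   Context: For a finite simplicial graph $\Gamma$, $W_\Gamma=\langle V(\Gamma)\mid s^2=1 \ (s\in V(\Gamma)),\ st=ts \text{ if } s,t \text{ are adjacent}\rangle$ is the associated right-angled Coxeter group; it is called $2$-dimensional if $\Gamma$ is triangle-free. A Coxeter subgroup of $W_\Gamma$ is a subgroup that is isomorphic, as an abstract group, to some finitely generated Coxeter group. A reflection in $W_\Gamma$ is an element of the form $wsw^{-1}$ with $s\in V(\Gamma)$, $w\in W_\Gamma$; a reflection subgroup is a subgroup generated by reflections. A subgroup $G<W_\Gamma$ is quasiconvex if there is $M\ge0$ such that every geodesic with endpoints in $G$ in the Cayley graph of $W_\Gamma$ with respect to $V(\Gamma)$ lies in the $M$-neighborhood of $G$. *)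

theory Defs
  imports "HOL-Algebra.Generated_Groups" "HOL-Library.Extended_Nat"
begin

section \<open>Groups given by generators and relations\<close>

text \<open>A letter \<open>(x, True)\<close> stands for the generator \<open>x\<close>, and \<open>(x, False)\<close> for its formal
  inverse. A pair \<open>(u, v)\<close> of words is read as the relation \<open>u = v\<close>.\<close>

type_synonym 'a word = "('a \<times> bool) list"

definition words_over :: "'a set \<Rightarrow> 'a word set" where
  "words_over X = lists (X \<times> UNIV)"

inductive word_eq :: "'a set \<Rightarrow> ('a word \<times> 'a word) set \<Rightarrow> 'a word \<Rightarrow> 'a word \<Rightarrow> bool"
  for X R where
  refl: "u \<in> words_over X \<Longrightarrow> word_eq X R u u"
| sym: "word_eq X R u v \<Longrightarrow> word_eq X R v u"
| trans: "word_eq X R u v \<Longrightarrow> word_eq X R v w \<Longrightarrow> word_eq X R u w"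
| append: "word_eq X R u u' \<Longrightarrow> word_eq X R v v' \<Longrightarrow> word_eq X R (u @ v) (u' @ v')"
| cancel: "x \<in> X \<Longrightarrow> word_eq X R [(x, b), (x, \<not> b)] []"
| relation: "(u, v) \<in> R \<Longrightarrow> u \<in> words_over X \<Longrightarrow> v \<in> words_over X \<Longrightarrow> word_eq X R u v"

definition word_class :: "'a set \<Rightarrow> ('a word \<times> 'a word) set \<Rightarrow> 'a word \<Rightarrow> 'a word set" where
  "word_class X R u = {v. word_eq X R u v}"

definition presented_group ::
  "'a set \<Rightarrow> ('a word \<times> 'a word) set \<Rightarrow> 'a word set monoid" where
  "presented_group X R =
     \<lparr>carrier = word_class X R ` words_over X,
      mult = (\<lambda>A B. {w. \<exists>a\<in>A. \<exists>b\<in>B. word_eq X R (a @ b) w}),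
      one = word_class X R []\<rparr>"

lemma word_eq_words_over:
  "word_eq X R u v \<Longrightarrow> u \<in> words_over X \<and> v \<in> words_over X"
  by (induction rule: word_eq.induct) (auto simp: words_over_def)

lemma word_class_eq_iff:
  "u \<in> words_over X \<Longrightarrow> word_class X R u = word_class X R v \<longleftrightarrow> word_eq X R u v"
  unfolding word_class_def by (blast intro: word_eq.refl word_eq.sym word_eq.trans)

lemma mult_word_class:
  assumes "u \<in> words_over X" "v \<in> words_over X"
  shows "word_class X R u \<otimes>\<^bsub>presented_group X R\<^esub> word_class X R v = word_class X R (u @ v)"
  using assms unfolding presented_group_def word_class_def
  by (auto intro: word_eq.refl word_eq.trans word_eq.append)

lemma group_presented_group: "group (presented_group X R)"
proof (rule groupI)
  let ?G = "presented_group X R"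
  have carr: "carrier ?G = word_class X R ` words_over X"
    and one: "\<one>\<^bsub>?G\<^esub> = word_class X R []"
    by (simp_all add: presented_group_def)
  have app: "u @ v \<in> words_over X" if "u \<in> words_over X" "v \<in> words_over X" for u v :: "'a word"
    using that by (simp add: words_over_def)
  have nil: "[] \<in> words_over X"
    by (simp add: words_over_def)
  show "\<one>\<^bsub>?G\<^esub> \<in> carrier ?G"
    using nil by (simp add: carr one)
  show "x \<otimes>\<^bsub>?G\<^esub> y \<in> carrier ?G" if "x \<in> carrier ?G" "y \<in> carrier ?G" for x y
    using that app by (auto simp: carr mult_word_class)
  show "x \<otimes>\<^bsub>?G\<^esub> y \<otimes>\<^bsub>?G\<^esub> z = x \<otimes>\<^bsub>?G\<^esub> (y \<otimes>\<^bsub>?G\<^esub> z)"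
    if "x \<in> carrier ?G" "y \<in> carrier ?G" "z \<in> carrier ?G" for x y z
    using that app by (auto simp: carr mult_word_class)
  show "\<one>\<^bsub>?G\<^esub> \<otimes>\<^bsub>?G\<^esub> x = x" if "x \<in> carrier ?G" for x
    using that nil by (auto simp: carr one mult_word_class)
  have inv_word: "\<exists>v\<in>words_over X. word_eq X R (v @ u) []" if "u \<in> words_over X" for u
    using that
  proof (induction u)
    case Nil
    then show ?case using nil by (auto intro: word_eq.refl)
  next
    case (Cons l u)
    obtain x b where l: "l = (x, b)" by (cases l)
    have x: "x \<in> X" and u: "u \<in> words_over X"
      using Cons.prems by (auto simp: words_over_def l)
    obtain v where v: "v \<in> words_over X" "word_eq X R (v @ u) []"
      using Cons.IH u by blast
    have "word_eq X R [(x, \<not> b), (x, b)] []"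
      using word_eq.cancel[OF x, of R "\<not> b"] by simp
    then have "word_eq X R (v @ ([(x, \<not> b), (x, b)] @ u)) (v @ ([] @ u))"
      using u v(1) by (intro word_eq.append word_eq.refl)
    then have "word_eq X R ((v @ [(x, \<not> b)]) @ l # u) []"
      using v(2) by (auto simp: l intro: word_eq.trans)
    moreover have "v @ [(x, \<not> b)] \<in> words_over X"
      using v(1) x by (simp add: words_over_def)
    ultimately show ?case by blast
  qed
  show "\<exists>y\<in>carrier ?G. y \<otimes>\<^bsub>?G\<^esub> x = \<one>\<^bsub>?G\<^esub>" if x: "x \<in> carrier ?G" for x
  proof -
    obtain u where u: "u \<in> words_over X" "x = word_class X R u"
      using x by (auto simp: carr)
    obtain v where v: "v \<in> words_over X" "word_eq X R (v @ u) []"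
      using inv_word u(1) by blast
    have "word_class X R v \<otimes>\<^bsub>?G\<^esub> x = \<one>\<^bsub>?G\<^esub>"
      using u v app by (simp add: mult_word_class one word_class_eq_iff)
    then show ?thesis using v(1) by (auto simp: carr)
  qed
qed


section \<open>Coxeter groups\<close>

text \<open>The entry \<open>m s t = \<infinity>\<close> means that no relation is imposed on \<open>s\<close> and \<open>t\<close>.\<close>

definition coxeter_matrix :: "'s set \<Rightarrow> ('s \<Rightarrow> 's \<Rightarrow> enat) \<Rightarrow> bool" where
  "coxeter_matrix S m \<longleftrightarrow>
     (\<forall>s\<in>S. m s s = 1) \<and> (\<forall>s\<in>S. \<forall>t\<in>S. m s t = m t s) \<and> (\<forall>s\<in>S. \<forall>t\<in>S. s \<noteq> t \<longrightarrow> 2 \<le> m s t)"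

definition coxeter_group :: "'s set \<Rightarrow> ('s \<Rightarrow> 's \<Rightarrow> enat) \<Rightarrow> 's word set monoid" where
  "coxeter_group S m =
     presented_group S
       {(concat (replicate n [(s, True), (t, True)]), []) | s t n.
          s \<in> S \<and> t \<in> S \<and> m s t = enat n}"

text \<open>Generators are taken from \<^typ>\<open>nat\<close>; since only finite generating sets are considered,
  every finitely generated Coxeter group is isomorphic to one of this form.\<close>

definition coxeter_subgroup :: "'g set \<Rightarrow> 'g monoid \<Rightarrow> bool" where
  "coxeter_subgroup H W \<longleftrightarrow>
     subgroup H W \<and>
     (\<exists>(S :: nat set) m. finite S \<and> coxeter_matrix S m \<and> W\<lparr>carrier := H\<rparr> \<cong> coxeter_group S m)"


section \<open>Right-angled Coxeter groups\<close>

definition finite_simplicial_graph :: "'v set \<Rightarrow> 'v set set \<Rightarrow> bool" where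
  "finite_simplicial_graph V E \<longleftrightarrow> finite V \<and> (\<forall>e\<in>E. e \<subseteq> V \<and> card e = 2)"

definition triangle_free :: "'v set set \<Rightarrow> bool" where
  "triangle_free E \<longleftrightarrow> \<not> (\<exists>a b c. {a, b} \<in> E \<and> {b, c} \<in> E \<and> {a, c} \<in> E)"

definition racg_relations :: "'v set \<Rightarrow> 'v set set \<Rightarrow> ('v word \<times> 'v word) set" where
  "racg_relations V E =
     {([(s, True), (s, True)], []) | s. s \<in> V} \<union>
     {([(s, True), (t, True)], [(t, True), (s, True)]) | s t. {s, t} \<in> E}"

definition racg :: "'v set \<Rightarrow> 'v set set \<Rightarrow> 'v word set monoid" where
  "racg V E = presented_group V (racg_relations V E)"

definition racg_gens :: "'v set \<Rightarrow> 'v set set \<Rightarrow> 'v word set set" where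
  "racg_gens V E = (\<lambda>s. word_class V (racg_relations V E) [(s, True)]) ` V"

definition reflections :: "'v set \<Rightarrow> 'v set set \<Rightarrow> 'v word set set" where
  "reflections V E =
     {w \<otimes>\<^bsub>racg V E\<^esub> s \<otimes>\<^bsub>racg V E\<^esub> inv\<^bsub>racg V E\<^esub> w | w s.
        w \<in> carrier (racg V E) \<and> s \<in> racg_gens V E}"

definition reflection_subgroup :: "'v word set set \<Rightarrow> 'v set \<Rightarrow> 'v set set \<Rightarrow> bool" where
  "reflection_subgroup H V E \<longleftrightarrow> (\<exists>T \<subseteq> reflections V E. H = generate (racg V E) T)"


section \<open>Cayley graphs, ends and quasiconvexity\<close>

definition cayley_adj :: "('g, 'r) monoid_scheme \<Rightarrow> 'g set \<Rightarrow> 'g \<Rightarrow> 'g \<Rightarrow> bool" where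
  "cayley_adj G A g h \<longleftrightarrow>
     g \<in> carrier G \<and> h \<in> carrier G \<and> (\<exists>a\<in>A. h = g \<otimes>\<^bsub>G\<^esub> a \<or> g = h \<otimes>\<^bsub>G\<^esub> a)"

text \<open>The vertex sets of the connected components of the Cayley graph with \<open>K\<close> removed.\<close>

definition components_outside :: "('g, 'r) monoid_scheme \<Rightarrow> 'g set \<Rightarrow> 'g set \<Rightarrow> 'g set set" where
  "components_outside G A K =
     (\<lambda>x. {y. (\<lambda>u v. cayley_adj G A u v \<and> u \<notin> K \<and> v \<notin> K)\<^sup>*\<^sup>* x y}) ` (carrier G - K)"

text \<open>For a finitely generated group the number of ends does not depend on the finite
  generating set.\<close>

definition one_ended :: "('g, 'r) monoid_scheme \<Rightarrow> bool" where
  "one_ended G \<longleftrightarrow>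
     (\<exists>A. finite A \<and> A \<subseteq> carrier G \<and> generate G A = carrier G \<and>
        (\<forall>K. finite K \<longrightarrow> (\<exists>!C. C \<in> components_outside G A K \<and> infinite C)))"

text \<open>The word metric, for a generating set \<open>A\<close>. If no path exists, the value is unspecified.\<close>

definition cayley_dist :: "('g, 'r) monoid_scheme \<Rightarrow> 'g set \<Rightarrow> 'g \<Rightarrow> 'g \<Rightarrow> nat" where
  "cayley_dist G A g h = (LEAST n. (cayley_adj G A ^^ n) g h)"

definition cayley_geodesic :: "('g, 'r) monoid_scheme \<Rightarrow> 'g set \<Rightarrow> 'g list \<Rightarrow> bool" where
  "cayley_geodesic G A p \<longleftrightarrow>
     set p \<subseteq> carrier G \<and> successively (cayley_adj G A) p \<and>
     length p = Suc (cayley_dist G A (hd p) (last p))"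

definition quasiconvex :: "('g, 'r) monoid_scheme \<Rightarrow> 'g set \<Rightarrow> 'g set \<Rightarrow> bool" where
  "quasiconvex G A H \<longleftrightarrow>
     (\<exists>M. \<forall>p. cayley_geodesic G A p \<and> hd p \<in> H \<and> last p \<in> H \<longrightarrow>
        (\<forall>x\<in>set p. \<exists>h\<in>H. cayley_dist G A x h \<le> M))"

end

theory Submission
  imports Defs
begin

text \<open>
  Write \<open>W\<close> for the right-angled Coxeter group. Every reflection \<open>r\<close> of \<open>W\<close> cuts the Cayley graph into
  two halves; let \<open>N g\<close> be the set of reflections that separate \<open>\<one>\<close> from \<open>g\<close>. The geometry of \<open>W\<close>
  is contained in the cocycle rule that \<open>N (g \<otimes> h)\<close> is the symmetric difference of \<open>N g\<close> and the
  \<open>g\<close>-conjugate of \<open>N h\<close>: it gives word length as \<open>card (N g)\<close>, the exchange property, and reduced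
  words. The cocycle itself comes from the presentation, which makes \<open>W\<close> act on pairs of an element
  and a sign. What is special to the right-angled case is that two generators lying in a common
  \<open>N g\<close> commute. It follows that two reflections whose walls cross commute
  (\<open>crossing_walls_commute\<close>), and that a word is reduced unless two equal letters in it are separated
  only by letters commuting with them (\<open>reduced_iff\<close>).

  Let \<open>H\<close> be a one-ended Coxeter subgroup with Coxeter generators \<open>B\<close>. Taking a shortest word in a
  conjugacy class shows that torsion elements of \<open>W\<close> are conjugate to \<open>\<one>\<close>, to a generator, or to a
  product \<open>a \<otimes> b\<close> of two commuting generators (\<open>torsion_conj_clique\<close>). An element of the third kind
  has finite centralizer, since a longer element centralizing \<open>a \<otimes> b\<close> would produce a generator that
  commutes with both \<open>a\<close> and \<open>b\<close>, hence a triangle in the graph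
  (\<open>finite_centralizer_rotation\<close>). On the other
  hand no \<open>a \<in> B\<close> has finite centralizer in \<open>H\<close>: otherwise \<open>H\<close> would split as an amalgam over the
  finite group \<open>C\<close> generated by the other members of \<open>B\<close> that commute with \<open>a\<close>. Instead of building
  the tree of this splitting, the presentation of \<open>H\<close> is used to write down one of its half-spaces,
  a subset of \<open>H\<close> whose only boundary is the finite set \<open>C \<union> C a\<close> (\<open>coxeter_generators\<close>).
  In a one-ended group such a set is finite or has finite complement, and counting cosets of \<open>C\<close> in
  it modulo two gives a contradiction (\<open>one_ended_not_splits\<close>). Therefore all nontrivial members of
  \<open>B\<close> are reflections of \<open>W\<close>.

  For quasiconvexity, call a reflection \<open>r \<in> H\<close> fundamental if it is the only reflection of \<open>H\<close> that
  separates \<open>\<one>\<close> from \<open>r\<close>. As \<open>H\<close> is generated by finitely many reflections, it is generated by a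
  finite set \<open>R\<close> of fundamental ones, and every element of \<open>W\<close> is \<open>h \<otimes> x\<close> with \<open>h \<in> H\<close> and \<open>x\<close>
  separated from \<open>\<one>\<close> by no reflection of \<open>H\<close>. Suppose \<open>h \<otimes> x\<close> lies on a geodesic between points of \<open>H\<close>. A wall
  between \<open>\<one>\<close> and \<open>x\<close> also separates \<open>\<one>\<close> from some \<open>g \<in> H\<close>. It therefore crosses all walls
  of \<open>H\<close> that lie between \<open>\<one>\<close> and the place where a path of translated \<open>R\<close>-edges from \<open>\<one>\<close> to \<open>g\<close>
  meets it, commutes with them, and so is equal to its own translate in one of the finitely many sets
  \<open>N r\<close>, \<open>r \<in> R\<close> (\<open>wall_bound\<close>). This bounds the distance from \<open>h \<otimes> x\<close> to \<open>h\<close>.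
\<close>

section \<open>Presentations\<close>

lemma words_over_simps [simp]:
  "[] \<in> words_over X"
  "l # u \<in> words_over X \<longleftrightarrow> fst l \<in> X \<and> u \<in> words_over X"
  "u @ v \<in> words_over X \<longleftrightarrow> u \<in> words_over X \<and> v \<in> words_over X"
  by (cases l; auto simp: words_over_def)+

lemma fold_closed:
  assumes "\<And>x b o'. x \<in> X \<Longrightarrow> o' \<in> A \<Longrightarrow> F (x, b) o' \<in> A"
  shows "u \<in> words_over X \<Longrightarrow> o' \<in> A \<Longrightarrow> fold F u o' \<in> A"
  by (induction u arbitrary: o') (auto simp: assms)

text \<open>The universal property of a presentation, for permutation actions: letters may be sent to any maps
  of \<open>A\<close> that respect cancellation and the relations. Words act from left to right, so this is a right
  action.\<close>

lemma presented_group_action: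
  fixes F :: "'a \<times> bool \<Rightarrow> 'o \<Rightarrow> 'o"
  assumes closed: "\<And>x b o'. x \<in> X \<Longrightarrow> o' \<in> A \<Longrightarrow> F (x, b) o' \<in> A"
    and cancel: "\<And>x b o'. x \<in> X \<Longrightarrow> o' \<in> A \<Longrightarrow> F (x, \<not> b) (F (x, b) o') = o'"
    and rel: "\<And>u v o'. (u, v) \<in> R \<Longrightarrow> u \<in> words_over X \<Longrightarrow> v \<in> words_over X \<Longrightarrow>
      o' \<in> A \<Longrightarrow> fold F u o' = fold F v o'"
  obtains \<alpha> where
    "\<And>o'. o' \<in> A \<Longrightarrow> \<alpha> \<one>\<^bsub>presented_group X R\<^esub> o' = o'"
    "\<And>g h o'. g \<in> carrier (presented_group X R) \<Longrightarrow> h \<in> carrier (presented_group X R) \<Longrightarrow>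
      o' \<in> A \<Longrightarrow> \<alpha> (g \<otimes>\<^bsub>presented_group X R\<^esub> h) o' = \<alpha> h (\<alpha> g o')"
    "\<And>x b o'. x \<in> X \<Longrightarrow> o' \<in> A \<Longrightarrow> \<alpha> (word_class X R [(x, b)]) o' = F (x, b) o'"
    "\<And>g o'. g \<in> carrier (presented_group X R) \<Longrightarrow> o' \<in> A \<Longrightarrow> \<alpha> g o' \<in> A"
proof -
  have invariant: "word_eq X R u v \<Longrightarrow> o' \<in> A \<Longrightarrow> fold F u o' = fold F v o'" for u v o'
  proof (induction arbitrary: o' rule: word_eq.induct)
    case (append u u' v v')
    have "fold F u' o' \<in> A"
      using append.hyps append.prems word_eq_words_over fold_closed closed by metis
    then show ?case using append by simp
  next
    case (cancel x b)
    then show ?case using assms(2) by simp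
  qed (auto simp: rel)
  define \<alpha> where "\<alpha> g = fold F (SOME w. w \<in> g)" for g
  have \<alpha>: "\<alpha> (word_class X R u) o' = fold F u o'" if "u \<in> words_over X" "o' \<in> A" for u o'
  proof -
    have "u \<in> word_class X R u"
      using that by (simp add: word_class_def word_eq.refl)
    then have "(SOME w. w \<in> word_class X R u) \<in> word_class X R u"
      by (rule someI)
    then show ?thesis
      using invariant[OF _ that(2)] by (simp add: \<alpha>_def word_class_def)
  qed
  have carr: "carrier (presented_group X R) = word_class X R ` words_over X"
    and one: "\<one>\<^bsub>presented_group X R\<^esub> = word_class X R []"
    by (simp_all add: presented_group_def)
  show thesis
  proof (rule that)
    show "\<alpha> \<one>\<^bsub>presented_group X R\<^esub> o' = o'" if "o' \<in> A" for o'
      using \<alpha>[of "[]"] that by (simp add: one)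
    show "\<alpha> (word_class X R [(x, b)]) o' = F (x, b) o'" if "x \<in> X" "o' \<in> A" for x b o'
      using \<alpha>[of "[(x, b)]"] that by simp
    show "\<alpha> g o' \<in> A" if "g \<in> carrier (presented_group X R)" "o' \<in> A" for g o'
      using that \<alpha> fold_closed[of X A F] closed by (auto simp: carr)
    show "\<alpha> (g \<otimes>\<^bsub>presented_group X R\<^esub> h) o' = \<alpha> h (\<alpha> g o')"
      if "g \<in> carrier (presented_group X R)" "h \<in> carrier (presented_group X R)" "o' \<in> A"
      for g h o'
      using that \<alpha> fold_closed[of X A F] closed by (auto simp: carr mult_word_class)
  qed
qed

lemma generate_presented_group:
  "generate (presented_group X R) ((\<lambda>x. word_class X R [(x, True)]) ` X) =
    carrier (presented_group X R)" (is "generate ?P ?T = _")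
proof -
  interpret group ?P by (rule group_presented_group)
  have carr: "carrier ?P = word_class X R ` words_over X"
    and one: "\<one>\<^bsub>?P\<^esub> = word_class X R []"
    by (simp_all add: presented_group_def)
  have T: "?T \<subseteq> carrier ?P" by (auto simp: carr)
  have letter: "word_class X R [(x, b)] \<in> generate ?P ?T" if "x \<in> X" for x b
  proof (cases b)
    case True
    then show ?thesis using that by (auto intro: generate.incl)
  next
    case False
    have "word_class X R [(x, False)] \<otimes>\<^bsub>?P\<^esub> word_class X R [(x, True)] = \<one>\<^bsub>?P\<^esub>"
      using that word_eq.cancel[of x X R False]
      by (simp add: mult_word_class one word_class_eq_iff)
    then have "word_class X R [(x, False)] = inv\<^bsub>?P\<^esub> (word_class X R [(x, True)])"
      using that by (intro inv_equality[symmetric]) (auto simp: carr)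
    then show ?thesis using that False by (auto intro: generate.inv)
  qed
  have "word_class X R u \<in> generate ?P ?T" if "u \<in> words_over X" for u
    using that
  proof (induction u)
    case Nil
    then show ?case using generate.one[of ?P ?T] by (simp add: one)
  next
    case (Cons l u)
    obtain x b where l: "l = (x, b)" by (cases l)
    have "word_class X R [(x, b)] \<otimes>\<^bsub>?P\<^esub> word_class X R u \<in> generate ?P ?T"
      using Cons l letter by (intro generate.eng) auto
    then show ?case using Cons.prems l by (simp add: mult_word_class)
  qed
  then show ?thesis
    using generate_incl[OF T] by (auto simp: carr)
qed

section \<open>Groups with a reflection cocycle\<close>

context group
begin

lemma inv_cancel [simp]:
  "g \<in> carrier G \<Longrightarrow> h \<in> carrier G \<Longrightarrow> inv g \<otimes> (g \<otimes> h) = h"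
  "g \<in> carrier G \<Longrightarrow> h \<in> carrier G \<Longrightarrow> g \<otimes> (inv g \<otimes> h) = h"
  by (simp_all flip: m_assoc)

lemmas group_word_simps = m_assoc inv_mult_group

lemma involutions_commute:
  assumes "b \<in> carrier G" "c \<in> carrier G" "b \<otimes> b = \<one>" "c \<otimes> c = \<one>"
    and "(b \<otimes> c) \<otimes> (b \<otimes> c) = \<one>"
  shows "b \<otimes> c = c \<otimes> b"
proof -
  have "inv (b \<otimes> c) = b \<otimes> c" "inv b = b" "inv c = c" using assms by (auto intro: inv_equality)
  then show ?thesis using inv_mult_group[OF assms(1,2)] by simp
qed

definition word_prod :: "'a list \<Rightarrow> 'a" where
  "word_prod w = foldr (\<otimes>) w \<one>"

lemma word_prod_simps [simp]:
  "word_prod [] = \<one>" "word_prod (a # w) = a \<otimes> word_prod w"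
  by (simp_all add: word_prod_def)

lemma word_prod_closed [simp]: "set w \<subseteq> carrier G \<Longrightarrow> word_prod w \<in> carrier G"
  by (induction w) auto

lemma word_prod_append [simp]:
  "set u \<subseteq> carrier G \<Longrightarrow> set v \<subseteq> carrier G \<Longrightarrow>
    word_prod (u @ v) = word_prod u \<otimes> word_prod v"
  by (induction u) (auto simp: m_assoc)

lemma word_prod_commute:
  assumes "p \<in> carrier G" "set w \<subseteq> carrier G" "\<And>a. a \<in> set w \<Longrightarrow> p \<otimes> a = a \<otimes> p"
  shows "p \<otimes> word_prod w = word_prod w \<otimes> p"
  using assms(2,3)
proof (induction w)
  case Nil
  then show ?case using assms(1) by simp
next
  case (Cons a w)
  have a: "a \<in> carrier G" "p \<otimes> a = a \<otimes> p" and w: "set w \<subseteq> carrier G" using Cons.prems by auto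
  have "p \<otimes> (a \<otimes> word_prod w) = a \<otimes> (p \<otimes> word_prod w)"
    using a w assms(1) by (metis m_assoc word_prod_closed)
  also have "\<dots> = a \<otimes> (word_prod w \<otimes> p)" using Cons by simp
  finally show ?case using a w assms(1) by (simp add: m_assoc)
qed

lemma generate_involutions_word:
  assumes "B \<subseteq> carrier G" "\<And>b. b \<in> B \<Longrightarrow> b \<otimes> b = \<one>" "g \<in> generate G B"
  shows "\<exists>w\<in>lists B. word_prod w = g"
  using assms(3)
proof (induction rule: generate.induct)
  case one
  then show ?case by (intro bexI[of _ "[]"]) auto
next
  case (incl h)
  then show ?case using assms(1) by (intro bexI[of _ "[h]"]) auto
next
  case (inv h)
  then have "inv h = h" "h \<in> carrier G" using assms(1,2) by (auto intro: inv_equality)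
  then show ?case using inv by (intro bexI[of _ "[h]"]) auto
next
  case (eng h1 h2)
  then obtain u v where "u \<in> lists B" "word_prod u = h1" "v \<in> lists B" "word_prod v = h2"
    by auto
  moreover have "set u \<subseteq> carrier G" "set v \<subseteq> carrier G" using calculation assms(1) by auto
  ultimately show ?case by (intro bexI[of _ "u @ v"]) auto
qed

end

text \<open>Besides the Coxeter group itself, this describes every reflection subgroup \<open>H\<close>, with \<open>N h \<inter> H\<close>
  in place of \<open>N h\<close>; hence \<open>N\<close> is a parameter and not defined from word length.\<close>

locale reflection_system = group G for G (structure) +
  fixes A :: "'a set" and N :: "'a \<Rightarrow> 'a set"
  assumes gens_subset: "A \<subseteq> carrier G"
    and gens_generate: "generate G A = carrier G"
    and gen_square: "a \<in> A \<Longrightarrow> a \<otimes> a = \<one>"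
    and N_subset: "g \<in> carrier G \<Longrightarrow> N g \<subseteq> carrier G"
    and N_gen: "a \<in> A \<Longrightarrow> N a = {a}"
    and N_mult: "g \<in> carrier G \<Longrightarrow> h \<in> carrier G \<Longrightarrow> p \<in> carrier G \<Longrightarrow>
      p \<in> N (g \<otimes> h) \<longleftrightarrow> (p \<in> N g) \<noteq> (inv g \<otimes> p \<otimes> g \<in> N h)"
begin

lemma gen_closed [simp]: "a \<in> A \<Longrightarrow> a \<in> carrier G"
  using gens_subset by auto

lemma words_closed [simp]:
  "w \<in> lists A \<Longrightarrow> set w \<subseteq> carrier G" "\<forall>x\<in>set w. x \<in> A \<Longrightarrow> set w \<subseteq> carrier G"
  by auto

lemma N_closed: "p \<in> N g \<Longrightarrow> g \<in> carrier G \<Longrightarrow> p \<in> carrier G"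
  using N_subset by auto

lemma gen_inv [simp]: "a \<in> A \<Longrightarrow> inv a = a"
  by (simp add: gen_square inv_equality)

lemma gen_cancel [simp]: "a \<in> A \<Longrightarrow> g \<in> carrier G \<Longrightarrow> a \<otimes> (a \<otimes> g) = g"
  using inv_cancel(1)[of a g] by simp

lemma inv_word_prod: "w \<in> lists A \<Longrightarrow> inv (word_prod w) = word_prod (rev w)"
  by (induction w) (auto simp: inv_mult_group)

lemma N_one [simp]: "N \<one> = {}"
proof -
  have "p \<notin> N \<one>" if "p \<in> carrier G" for p
    using N_mult[of \<one> \<one> p] that by simp
  then show ?thesis using N_closed by blast
qed

lemma N_inv:
  assumes "g \<in> carrier G" "p \<in> carrier G"
  shows "p \<in> N (inv g) \<longleftrightarrow> g \<otimes> p \<otimes> inv g \<in> N g"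
  using N_mult[of "inv g" g p] assms by simp

lemma N_gen_mult:
  assumes "a \<in> A" "g \<in> carrier G" "p \<in> carrier G"
  shows "p \<in> N (a \<otimes> g) \<longleftrightarrow> (p = a) \<noteq> (a \<otimes> p \<otimes> a \<in> N g)"
  using N_mult[of a g p] assms by (simp add: N_gen)

lemma conj_eq_iff:
  assumes "g \<in> carrier G" "p \<in> carrier G" "q \<in> carrier G"
  shows "inv g \<otimes> p \<otimes> g = q \<longleftrightarrow> p = g \<otimes> q \<otimes> inv g"
  using assms by (auto simp: group_word_simps)

lemma N_mult_gen:
  assumes "a \<in> A" "g \<in> carrier G" "p \<in> carrier G"
  shows "p \<in> N (g \<otimes> a) \<longleftrightarrow> (p \<in> N g) \<noteq> (p = g \<otimes> a \<otimes> inv g)"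
  using N_mult[of g a p] assms by (simp add: N_gen conj_eq_iff)

lemma ex_word:
  assumes "g \<in> carrier G"
  shows "\<exists>w\<in>lists A. word_prod w = g"
  using generate_involutions_word[OF gens_subset gen_square, of g] assms by (simp add: gens_generate)

definition len :: "'a \<Rightarrow> nat" where
  "len g = card (N g)"

text \<open>Left multiplication by a generator permutes the separating walls and adds one new wall; this makes
  \<open>card (N g)\<close> behave as word length does.\<close>

lemma N_gen_mult_eq:
  assumes "a \<in> A" "g \<in> carrier G" "a \<notin> N g"
  shows "N (a \<otimes> g) = insert a ((\<lambda>p. a \<otimes> p \<otimes> a) ` N g)"
proof -
  have *: "a \<otimes> (a \<otimes> p \<otimes> a) \<otimes> a = p" if "p \<in> carrier G" for p
    using that assms by (simp add: m_assoc gen_square)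
  have "p \<in> N (a \<otimes> g) \<longleftrightarrow> p = a \<or> p \<in> (\<lambda>p. a \<otimes> p \<otimes> a) ` N g" if p: "p \<in> carrier G" for p
  proof -
    have "a \<otimes> p \<otimes> a \<in> N g \<longleftrightarrow> p \<in> (\<lambda>p. a \<otimes> p \<otimes> a) ` N g"
      using *[OF p] * N_closed assms p by (metis (no_types, lifting) imageE image_eqI)
    moreover have "a \<otimes> a \<otimes> a = a" using assms gen_square by simp
    ultimately show ?thesis using N_gen_mult[OF assms(1,2) p] assms(3) by auto
  qed
  moreover have "N (a \<otimes> g) \<subseteq> carrier G" "insert a ((\<lambda>p. a \<otimes> p \<otimes> a) ` N g) \<subseteq> carrier G"
    using N_subset assms by (auto simp: N_closed)
  ultimately show ?thesis by blast
qed

lemma finite_N [simp]: "g \<in> carrier G \<Longrightarrow> finite (N g)"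
proof -
  have step: "finite (N (a \<otimes> g))" if "a \<in> A" "g \<in> carrier G" "finite (N g)" for a g
  proof -
    have "N (a \<otimes> g) \<subseteq> insert a ((\<lambda>p. a \<otimes> p \<otimes> a) ` N g)"
    proof
      fix p assume p: "p \<in> N (a \<otimes> g)"
      then have "p \<in> carrier G" by (rule N_closed) (simp add: that)
      moreover have "a \<otimes> (a \<otimes> p \<otimes> a) \<otimes> a = p"
        using that calculation by (simp add: m_assoc gen_square)
      ultimately show "p \<in> insert a ((\<lambda>p. a \<otimes> p \<otimes> a) ` N g)"
        using p N_gen_mult[OF that(1,2)] by (metis image_eqI insertCI)
    qed
    then show ?thesis using that(3) by (meson finite_imageI finite_insert finite_subset)
  qed
  have "w \<in> lists A \<Longrightarrow> finite (N (word_prod w))" for w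
    by (induction w) (auto intro!: step)
  then show "g \<in> carrier G \<Longrightarrow> finite (N g)" using ex_word by metis
qed

lemma len_one [simp]: "len \<one> = 0"
  by (simp add: len_def)

lemma len_gen_mult:
  assumes "a \<in> A" "g \<in> carrier G"
  shows "a \<notin> N g \<Longrightarrow> len (a \<otimes> g) = Suc (len g)"
    and "a \<in> N g \<Longrightarrow> len g = Suc (len (a \<otimes> g))"
proof -
  have up: "len (a \<otimes> h) = Suc (len h)" if h: "h \<in> carrier G" "a \<notin> N h" for h
  proof -
    have inj: "inj_on (\<lambda>p. a \<otimes> p \<otimes> a) (N h)"
      using N_subset[OF h(1)] assms(1) by (intro inj_onI) (auto simp: subset_iff)
    have "a \<notin> (\<lambda>p. a \<otimes> p \<otimes> a) ` N h"
    proof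
      assume "a \<in> (\<lambda>p. a \<otimes> p \<otimes> a) ` N h"
      then obtain p where p: "p \<in> N h" "a = a \<otimes> p \<otimes> a" by auto
      have "p \<in> carrier G" using p h N_closed by blast
      then have "a \<otimes> (a \<otimes> p \<otimes> a) \<otimes> a = p"
        using assms(1) by (simp add: gen_square m_assoc)
      then have "a \<otimes> a \<otimes> a = p" using p(2) by simp
      then have "p = a"
        using assms(1) by (simp add: gen_square)
      then show False using p h by simp
    qed
    then show ?thesis
      using h assms by (simp add: len_def N_gen_mult_eq card_image[OF inj])
  qed
  then show "a \<notin> N g \<Longrightarrow> len (a \<otimes> g) = Suc (len g)" using assms by simp
  assume "a \<in> N g"
  then have "a \<notin> N (a \<otimes> g)"
    using N_gen_mult[of a g a] assms by (simp add: gen_square)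
  then show "len g = Suc (len (a \<otimes> g))"
    using up[of "a \<otimes> g"] assms by simp
qed

lemma len_inv: "g \<in> carrier G \<Longrightarrow> len (inv g) = len g"
proof -
  have le: "len (inv g) \<le> len g" if g: "g \<in> carrier G" for g
  proof -
    have "N (inv g) \<subseteq> (\<lambda>p. inv g \<otimes> p \<otimes> g) ` N g"
    proof
      fix p assume p: "p \<in> N (inv g)"
      then have pc: "p \<in> carrier G" using N_closed g by blast
      then have "g \<otimes> p \<otimes> inv g \<in> N g" using p N_inv g by blast
      moreover have "p = inv g \<otimes> (g \<otimes> p \<otimes> inv g) \<otimes> g"
        using g pc by (simp add: group_word_simps)
      ultimately show "p \<in> (\<lambda>p. inv g \<otimes> p \<otimes> g) ` N g" by blast
    qed
    then show ?thesis using g unfolding len_def by (simp add: surj_card_le)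
  qed
  assume "g \<in> carrier G"
  then show ?thesis using le[of g] le[of "inv g"] by simp
qed

lemma len_word_prod_le: "w \<in> lists A \<Longrightarrow> len (word_prod w) \<le> length w"
proof (induction w)
  case (Cons a w)
  then have "len (a \<otimes> word_prod w) \<le> Suc (len (word_prod w))"
    using len_gen_mult[of a "word_prod w"] by (cases "a \<in> N (word_prod w)") auto
  then show ?case using Cons by auto
qed simp

text \<open>The wall \<open>p\<close> is dual to one of the letters of \<open>w\<close>, and multiplying by \<open>p\<close> deletes that letter.\<close>

lemma exchange:
  assumes "w \<in> lists A" "p \<in> N (word_prod w)"
  shows "\<exists>w'\<in>lists A. length w = Suc (length w') \<and> p \<otimes> word_prod w = word_prod w'"
  using assms
proof (induction w arbitrary: p)
  case (Cons a w)
  have a: "a \<in> A" and w: "w \<in> lists A" "word_prod w \<in> carrier G"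
    using Cons.hyps by auto
  have p: "p \<in> carrier G" using Cons.prems a w N_closed by (metis gen_closed m_closed word_prod_simps(2))
  show ?case
  proof (cases "p = a")
    case True
    then show ?thesis using a w by (intro bexI[of _ w]) auto
  next
    case False
    then have "a \<otimes> p \<otimes> a \<in> N (word_prod w)" using Cons.prems N_gen_mult[OF a w(2) p] by simp
    then obtain w' where w': "w' \<in> lists A" "length w = Suc (length w')"
      "a \<otimes> p \<otimes> a \<otimes> word_prod w = word_prod w'"
      using Cons.IH w by blast
    have "p \<otimes> (a \<otimes> word_prod w) = a \<otimes> (a \<otimes> p \<otimes> a \<otimes> word_prod w)"
      using a w p by (simp add: m_assoc)
    then show ?thesis using a w' by (intro bexI[of _ "a # w'"]) auto
  qed
qed simp

definition reduced :: "'a list \<Rightarrow> bool" where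
  "reduced w \<longleftrightarrow> w \<in> lists A \<and> len (word_prod w) = length w"

text \<open>If some suffix had too few separating walls, the exchange property would shorten the word.\<close>

lemma shortest_word_reduced:
  assumes "w \<in> lists A"
    and "\<And>v. v \<in> lists A \<Longrightarrow> word_prod v = word_prod w \<Longrightarrow> length w \<le> length v"
  shows "reduced w"
  using assms
proof (induction w)
  case (Cons a w)
  have a: "a \<in> A" and w: "w \<in> lists A" "word_prod w \<in> carrier G"
    using Cons.hyps by auto
  have "length w \<le> length v" if "v \<in> lists A" "word_prod v = word_prod w" for v
    using Cons.prems(1)[of "a # v"] that a by auto
  then have IH: "len (word_prod w) = length w" using Cons.IH w by (simp add: reduced_def)
  have "a \<notin> N (word_prod w)"
  proof
    assume "a \<in> N (word_prod w)"
    then obtain w' where "w' \<in> lists A" "length w = Suc (length w')" "a \<otimes> word_prod w = word_prod w'"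
      using exchange w by blast
    then show False using Cons.prems(1)[of w'] by simp
  qed
  then show ?case using len_gen_mult(1)[OF a w(2)] IH a w by (simp add: reduced_def)
qed (simp add: reduced_def)

lemma ex_reduced_word:
  assumes "g \<in> carrier G"
  obtains w where "reduced w" "word_prod w = g" "length w = len g"
proof -
  obtain w where w: "w \<in> lists A \<and> word_prod w = g"
    "\<And>v. v \<in> lists A \<and> word_prod v = g \<Longrightarrow> length w \<le> length v"
    using ex_has_least_nat[of "\<lambda>w. w \<in> lists A \<and> word_prod w = g" _ length] ex_word[OF assms] by metis
  then have "reduced w" using shortest_word_reduced by simp
  then show thesis using that w(1) by (auto simp: reduced_def)
qed

lemma reducedD: "reduced w \<Longrightarrow> w \<in> lists A" "reduced w \<Longrightarrow> len (word_prod w) = length w"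
  by (auto simp: reduced_def)

lemma reduced_length_le:
  "reduced w \<Longrightarrow> v \<in> lists A \<Longrightarrow> word_prod v = word_prod w \<Longrightarrow> length w \<le> length v"
  using len_word_prod_le[of v] by (simp add: reduced_def)

lemma len_mult_le:
  assumes "g \<in> carrier G" "h \<in> carrier G"
  shows "len (g \<otimes> h) \<le> len g + len h"
proof -
  obtain u v where "reduced u" "word_prod u = g" "length u = len g"
    "reduced v" "word_prod v = h" "length v = len h"
    using assms ex_reduced_word by metis
  then show ?thesis using len_word_prod_le[of "u @ v"] by (simp add: reduced_def)
qed

lemma reduced_append:
  assumes "reduced (u @ v)"
  shows "reduced u" "reduced v"
proof -
  have uv: "u \<in> lists A" "v \<in> lists A" using assms by (auto simp: reduced_def)
  then have "length u + length v \<le> len (word_prod u) + len (word_prod v)"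
    using assms len_mult_le[of "word_prod u" "word_prod v"] by (simp add: reduced_def)
  then show "reduced u" "reduced v"
    using uv len_word_prod_le[of u] len_word_prod_le[of v] by (auto simp: reduced_def)
qed

lemma N_prefix:
  assumes "reduced (u @ v)"
  shows "N (word_prod u) \<subseteq> N (word_prod (u @ v))"
  using assms
proof (induction v rule: rev_induct)
  case (snoc a v)
  let ?g = "word_prod (u @ v)"
  have r: "reduced (u @ v)" using snoc.prems reduced_append[of "u @ v" "[a]"] by simp
  have a: "a \<in> A" and g: "?g \<in> carrier G" and uv: "u \<in> lists A" "v \<in> lists A"
    using snoc.prems reducedD(1)[OF r] by (auto simp: reduced_def)
  have eq: "word_prod (u @ v @ [a]) = ?g \<otimes> a"
    using a uv by (simp add: m_assoc)
  have *: "?g \<otimes> a \<otimes> inv ?g \<notin> N ?g"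
  proof
    assume "?g \<otimes> a \<otimes> inv ?g \<in> N ?g"
    then obtain w' where w': "w' \<in> lists A" "length (u @ v) = Suc (length w')"
      "?g \<otimes> a \<otimes> inv ?g \<otimes> ?g = word_prod w'"
      using exchange[OF reducedD(1)[OF r]] by blast
    have "?g \<otimes> a \<otimes> inv ?g \<otimes> ?g = ?g \<otimes> a"
      using a g by (simp add: m_assoc del: word_prod_append)
    then show False
      using reduced_length_le[OF snoc.prems w'(1)] eq w'(2,3) by (simp del: word_prod_append)
  qed
  have "N ?g \<subseteq> N (?g \<otimes> a)"
    using N_mult_gen[OF a g] * N_closed[OF _ g] by blast
  then show ?case using snoc.IH[OF r] eq by simp
qed simp

text \<open>The letter at which the path spelled by \<open>w\<close> first crosses the wall \<open>p\<close>.\<close>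

lemma N_word_cases:
  assumes "w \<in> lists A" "p \<in> N (word_prod w)"
  obtains u a v where "w = u @ a # v" "p \<notin> N (word_prod u)"
    "p \<in> N (word_prod u \<otimes> a)" "p = word_prod u \<otimes> a \<otimes> inv (word_prod u)"
proof -
  have "\<exists>u a v. w = u @ a # v \<and> p \<notin> N (word_prod u) \<and>
    p \<in> N (word_prod u \<otimes> a) \<and> p = word_prod u \<otimes> a \<otimes> inv (word_prod u)"
    using assms
  proof (induction w rule: rev_induct)
    case (snoc a w)
    have a: "a \<in> A" and w: "w \<in> lists A" "word_prod w \<in> carrier G" using snoc.prems by auto
    then have eq: "word_prod (w @ [a]) = word_prod w \<otimes> a" by simp
    show ?case
    proof (cases "p \<in> N (word_prod w)")
      case True
      then show ?thesis using snoc.IH w by fastforce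
    next
      case False
      then show ?thesis
        using snoc.prems(2) eq N_mult_gen[OF a w(2)] N_closed a w(2)
        by (metis append_Nil2 gen_closed m_closed)
    qed
  qed simp
  then show thesis using that by blast
qed

lemma reflection_square: "z \<in> carrier G \<Longrightarrow> a \<in> A \<Longrightarrow> z \<otimes> a \<otimes> inv z \<otimes> (z \<otimes> a \<otimes> inv z) = \<one>"
  by (simp add: group_word_simps)

lemma N_length_less:
  assumes "g \<in> carrier G" "p \<in> N g"
  shows "len (p \<otimes> g) < len g"
proof -
  obtain w where w: "reduced w" "word_prod w = g" "length w = len g"
    using ex_reduced_word assms by blast
  then obtain w' where "w' \<in> lists A" "length w = Suc (length w')" "p \<otimes> g = word_prod w'"
    using exchange[of w p] assms(2) by (auto simp: reduced_def)
  then show ?thesis using w len_word_prod_le[of w'] by simp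
qed

text \<open>If \<open>w\<close> spells \<open>a1 \<dots> an\<close>, the wall crossed by its last letter multiplied by the prefix
  \<open>a1 \<dots> a(n-1)\<close> gives back the whole product; iterating writes it as a product of crossed walls.\<close>

lemma reduced_in_generate_N:
  assumes "reduced w"
  shows "word_prod w \<in> generate G (N (word_prod w))"
  using assms
proof (induction w rule: rev_induct)
  case Nil
  then show ?case using generate.one[of G "{}"] by simp
next
  case (snoc a w)
  have r: "reduced w" using snoc.prems reduced_append by blast
  have a: "a \<in> A" and g: "word_prod w \<in> carrier G" "w \<in> lists A"
    using snoc.prems reducedD(1)[OF r] by (auto simp: reduced_def)
  let ?g = "word_prod w" let ?q = "?g \<otimes> a \<otimes> inv ?g"
  have eq: "word_prod (w @ [a]) = ?g \<otimes> a" and qg: "?q \<otimes> ?g = ?g \<otimes> a"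
    using a g by (simp_all add: m_assoc)
  have "?q \<notin> N ?g"
    using N_length_less[of ?g ?q] g qg eq snoc.prems r by (auto simp: reduced_def)
  then have "?q \<in> N (?g \<otimes> a)" using N_mult_gen[OF a g(1)] a g by auto
  moreover have "N ?g \<subseteq> N (?g \<otimes> a)" using N_prefix[OF snoc.prems] eq by simp
  then have "?g \<in> generate G (N (?g \<otimes> a))" using snoc.IH[OF r] mono_generate by blast
  ultimately have "?q \<otimes> ?g \<in> generate G (N (?g \<otimes> a))"
    by (rule generate.eng[OF generate.incl])
  then show ?case using eq qg by simp
qed

lemma N_subset_N_mult:
  assumes "g \<in> carrier G" "h \<in> carrier G" "len (g \<otimes> h) = len g + len h"
  shows "N g \<subseteq> N (g \<otimes> h)"
proof -
  obtain u v where uv: "reduced u" "word_prod u = g" "length u = len g"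
    "reduced v" "word_prod v = h" "length v = len h"
    using assms ex_reduced_word by metis
  then have "reduced (u @ v)" "word_prod (u @ v) = g \<otimes> h"
    using assms(3) by (auto simp: reduced_def)
  then show ?thesis using N_prefix[of u v] uv by simp
qed

lemma N_reflection_iff:
  assumes "z \<in> carrier G" "a \<in> A" "q \<in> carrier G" and r: "r = z \<otimes> a \<otimes> inv z"
  shows "q \<in> N r \<longleftrightarrow> ((q \<in> N z) \<noteq> (q = r)) \<noteq> (r \<otimes> q \<otimes> r \<in> N z)"
proof -
  have "z \<otimes> (inv (z \<otimes> a) \<otimes> q \<otimes> (z \<otimes> a)) \<otimes> inv z = r \<otimes> q \<otimes> r"
    using assms by (simp add: group_word_simps)
  then have "inv (z \<otimes> a) \<otimes> q \<otimes> (z \<otimes> a) \<in> N (inv z) \<longleftrightarrow> r \<otimes> q \<otimes> r \<in> N z"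
    using assms(1-3) by (subst N_inv) simp_all
  then show ?thesis
    unfolding r using N_mult[of "z \<otimes> a" "inv z" q] N_mult_gen[OF assms(2,1,3)] assms(1-3) r by simp
qed

text \<open>A geodesic from \<open>x\<close> to \<open>y\<close> meets each wall at most once. If \<open>p\<close> does not separate its ends, it is not
  crossed at all, so the edge at which \<open>r\<close> is crossed is on the same side of \<open>p\<close>.\<close>

lemma crossing_point:
  assumes "x \<in> carrier G" "y \<in> carrier G" "r \<in> carrier G" "p \<in> carrier G"
    and "(r \<in> N x) \<noteq> (r \<in> N y)" "(p \<in> N x) = (p \<in> N y)"
  obtains z a where "z \<in> carrier G" "a \<in> A" "r = z \<otimes> a \<otimes> inv z" "(p \<in> N z) = (p \<in> N x)"
proof -
  let ?c = "inv x \<otimes> y"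
  obtain w where w: "reduced w" "word_prod w = ?c"
    using ex_reduced_word assms(1,2) by (metis inv_closed m_closed)
  have y: "x \<otimes> ?c = y" using assms by simp
  have "inv x \<otimes> r \<otimes> x \<in> N ?c"
    using N_mult[of x ?c r] assms y by auto
  then obtain u a v where u: "w = u @ a # v"
    "inv x \<otimes> r \<otimes> x = word_prod u \<otimes> a \<otimes> inv (word_prod u)"
    using N_word_cases w by (metis reducedD(1))
  have a: "a \<in> A" and uc: "word_prod u \<in> carrier G" using u(1) reducedD(1)[OF w(1)] by auto
  have "inv x \<otimes> p \<otimes> x \<notin> N ?c"
    using N_mult[of x ?c p] assms y by auto
  then have "inv x \<otimes> p \<otimes> x \<notin> N (word_prod u)"
    using N_prefix[of u "a # v"] w u(1) by auto
  then have "(p \<in> N (x \<otimes> word_prod u)) = (p \<in> N x)"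
    using N_mult[of x "word_prod u" p] assms uc by simp
  moreover have "r = x \<otimes> word_prod u \<otimes> a \<otimes> inv (x \<otimes> word_prod u)"
  proof -
    have "r = x \<otimes> (inv x \<otimes> r \<otimes> x) \<otimes> inv x" using assms by (simp add: group_word_simps)
    then show ?thesis using u(2) a uc assms by (simp add: group_word_simps)
  qed
  ultimately show thesis using that a uc assms by (metis m_closed)
qed

end

section \<open>Right-angled systems\<close>

text \<open>The hypothesis holds in a right-angled Coxeter group because two generators in a common \<open>N g\<close>
  generate a finite dihedral group.\<close>

locale right_angled_system = reflection_system +
  assumes descents_commute: "g \<in> carrier G \<Longrightarrow> a \<in> A \<Longrightarrow> b \<in> A \<Longrightarrow> a \<in> N g \<Longrightarrow> b \<in> N g \<Longrightarrow>
      a \<otimes> b = b \<otimes> a"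
begin

definition adj :: "'a \<Rightarrow> 'a \<Rightarrow> bool" where
  "adj a b \<longleftrightarrow> a \<noteq> b \<and> a \<otimes> b = b \<otimes> a"

lemma adj_sym: "adj a b \<Longrightarrow> adj b a" and adj_irrefl [simp]: "\<not> adj a a"
  by (auto simp: adj_def)

lemma adj_word_prod:
  assumes "a \<in> A" "v \<in> lists A" "\<forall>x\<in>set v. adj a x"
  shows "a \<otimes> word_prod v = word_prod v \<otimes> a"
  using assms by (intro word_prod_commute) (auto simp: adj_def)

text \<open>Both \<open>s\<close> and the first letter of \<open>v\<close> begin reduced words of the same element, so they commute; that
  letter can then be removed from both sides of the equation.\<close>

lemma reduced_commute_adj:
  assumes "s \<in> A" "r \<in> A" "v \<in> lists A"
    and "s \<otimes> word_prod v = word_prod v \<otimes> r" "len (s \<otimes> word_prod v) = Suc (length v)"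
  shows "\<forall>x\<in>set v. adj s x"
  using assms(3-5)
proof (induction v)
  case (Cons x v)
  let ?g = "s \<otimes> (x \<otimes> word_prod v)"
  have x: "x \<in> A" and v: "v \<in> lists A" "word_prod v \<in> carrier G" using Cons.hyps by auto
  have len_le: "len (word_prod v \<otimes> r) \<le> Suc (length v)"
    using len_word_prod_le[of "v @ [r]"] assms(2) v by simp
  have eq: "?g = x \<otimes> (word_prod v \<otimes> r)"
    using Cons.prems(1) x v assms by (simp add: m_assoc)
  have "s \<in> N ?g"
    using len_gen_mult(2)[of s "x \<otimes> word_prod v"] len_word_prod_le[of "x # v"]
      len_gen_mult(1)[of s ?g] Cons.prems(2) assms(1) x v by auto
  moreover have "x \<in> N ?g"
  proof (rule ccontr)
    assume "x \<notin> N ?g"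
    then have "len (x \<otimes> ?g) = Suc (len ?g)" using len_gen_mult(1) x v assms(1) by simp
    moreover have "x \<otimes> ?g = word_prod v \<otimes> r" using eq x v assms by simp
    ultimately show False using len_le Cons.prems(2) by simp
  qed
  ultimately have comm: "s \<otimes> x = x \<otimes> s"
    using descents_commute[of ?g s x] assms(1) x v by simp
  have "s \<noteq> x"
  proof
    assume "s = x"
    then have "?g = word_prod v" using x v by simp
    then show False using Cons.prems(2) len_word_prod_le[OF v(1)] by simp
  qed
  have g: "?g = x \<otimes> (s \<otimes> word_prod v)"
    using comm x v assms(1) by (metis gen_closed m_assoc)
  then have "s \<otimes> word_prod v = word_prod v \<otimes> r"
    using eq x v assms by (metis gen_cancel gen_closed m_closed)
  moreover have "len (s \<otimes> word_prod v) = Suc (length v)"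
    using len_word_prod_le[of "s # v"] len_gen_mult[of x "s \<otimes> word_prod v"] g
      Cons.prems(2) x v assms(1) by (cases "x \<in> N (s \<otimes> word_prod v)") auto
  ultimately show ?case using Cons.IH \<open>s \<noteq> x\<close> comm by (simp add: adj_def)
qed simp

text \<open>In particular (\<open>a = b\<close>) the centralizer of a generator is generated by it and the generators
  adjacent to it.\<close>

lemma conjugator_of_generators:
  assumes "a \<in> A" "b \<in> A" "c \<in> carrier G" "a \<otimes> c = c \<otimes> b"
  obtains v where "v \<in> lists A" "\<forall>x\<in>set v. adj a x" "c = word_prod v \<or> c = a \<otimes> word_prod v"
proof (cases "a \<in> N c")
  case False
  obtain v where v: "reduced v" "word_prod v = c" "length v = len c"
    using ex_reduced_word assms(3) by blast
  then show thesis
    using that[of v] reduced_commute_adj[OF assms(1,2), of v] assms len_gen_mult(1)[OF assms(1,3)] False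
    by (auto simp: reduced_def)
next
  case True
  let ?d = "a \<otimes> c"
  obtain v where v: "reduced v" "word_prod v = ?d" "length v = len ?d"
    using ex_reduced_word assms(1,3) by (metis gen_closed m_closed)
  have "?d \<otimes> b = c"
    unfolding assms(4) using assms(1-3) by (simp add: m_assoc gen_square)
  then have "a \<otimes> ?d = ?d \<otimes> b"
    using assms(1,3) by simp
  moreover have "a \<otimes> ?d = c" using assms(1,3) by simp
  then have "len (a \<otimes> ?d) = Suc (length v)"
    using len_gen_mult(2)[OF assms(1,3) True] v(3) by simp
  ultimately have "\<forall>x\<in>set v. adj a x"
    using reduced_commute_adj[OF assms(1,2), of v] v by (simp add: reduced_def)
  moreover have "c = a \<otimes> word_prod v" using v(2) \<open>a \<otimes> ?d = c\<close> by simp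
  ultimately show thesis using that v(1) by (auto simp: reduced_def)
qed

text \<open>The edges \<open>y, y a\<close> and \<open>y', y' a'\<close> cross the same wall \<open>r\<close>, so they differ by an element
  \<open>c = inv y \<otimes> y'\<close> built from generators adjacent to \<open>a\<close>, up to the letter \<open>a\<close> itself. A wall \<open>p\<close>
  between them is a translate of a wall crossed by \<open>c\<close>, and these commute with \<open>a\<close>.\<close>

lemma wall_of_two_edges_commutes:
  assumes "y \<in> carrier G" "y' \<in> carrier G" "a \<in> A" "a' \<in> A" "p \<in> carrier G"
    and r: "r = y \<otimes> a \<otimes> inv y" "r = y' \<otimes> a' \<otimes> inv y'"
    and sep: "(p \<in> N y) \<noteq> (p \<in> N y')"
  shows "p \<otimes> r = r \<otimes> p"
proof -
  let ?c = "inv y \<otimes> y'" let ?q = "inv y \<otimes> p \<otimes> y"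
  have c: "?c \<in> carrier G" and q: "?q \<in> carrier G" using assms by auto
  have "a \<otimes> ?c = inv y \<otimes> (y \<otimes> a \<otimes> inv y) \<otimes> y'" using assms(1-5) by (simp add: group_word_simps)
  also have "\<dots> = inv y \<otimes> (y' \<otimes> a' \<otimes> inv y') \<otimes> y'" using r by simp
  also have "\<dots> = ?c \<otimes> a'" using assms(1-5) by (simp add: group_word_simps)
  finally obtain v where v: "v \<in> lists A" "\<forall>x\<in>set v. adj a x" "?c = word_prod v \<or> ?c = a \<otimes> word_prod v"
    using conjugator_of_generators[OF assms(3,4) c] by blast
  have link: "q \<otimes> a = a \<otimes> q" if qN: "q \<in> N (word_prod v)" for q
  proof -
    obtain u x w where u: "v = u @ x # w" "q = word_prod u \<otimes> x \<otimes> inv (word_prod u)"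
      using N_word_cases[OF v(1) qN] by metis
    have ul: "u @ x # rev u \<in> lists A" using u(1) v(1) by auto
    have "q = word_prod (u @ x # rev u)"
      using u ul by (auto simp: inv_word_prod m_assoc)
    then show ?thesis
      using adj_word_prod[OF assms(3) ul] v(2) u(1) by auto
  qed
  have "y \<otimes> ?c = y'" using assms by simp
  then have "?q \<in> N ?c" using sep N_mult[of y ?c p] assms c by auto
  then have "?q \<otimes> a = a \<otimes> ?q"
  proof (cases "?q \<in> N (word_prod v) \<or> ?q = a")
    case True
    then show ?thesis using link by auto
  next
    case False
    then have "?q \<in> N (a \<otimes> word_prod v)" using \<open>?q \<in> N ?c\<close> v(3) by auto
    then have "a \<otimes> ?q \<otimes> a \<in> N (word_prod v)"
      using N_gen_mult[OF assms(3) _ q, of "word_prod v"] False v(1) by auto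
    then have "a \<otimes> ?q \<otimes> a \<otimes> a = a \<otimes> (a \<otimes> ?q \<otimes> a)" by (rule link)
    then show ?thesis using assms(3) q by (simp add: m_assoc gen_square)
  qed
  then have "y \<otimes> (?q \<otimes> a) \<otimes> inv y = y \<otimes> (a \<otimes> ?q) \<otimes> inv y" by simp
  then show ?thesis using assms(1-5) unfolding r(1) by (simp add: group_word_simps)
qed

text \<open>All four quadrants of \<open>p\<close> and \<open>r\<close> are inhabited. So \<open>r\<close> is crossed by an edge on either side of
  \<open>p\<close>.\<close>

lemma crossing_walls_commute:
  assumes "x1 \<in> carrier G" "x2 \<in> carrier G" "x3 \<in> carrier G" "x4 \<in> carrier G"
    and "p \<in> carrier G" "r \<in> carrier G"
    and "p \<notin> N x1" "p \<notin> N x2" "(r \<in> N x1) \<noteq> (r \<in> N x2)"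
    and "p \<in> N x3" "p \<in> N x4" "(r \<in> N x3) \<noteq> (r \<in> N x4)"
  shows "p \<otimes> r = r \<otimes> p"
proof -
  obtain y a where y: "y \<in> carrier G" "a \<in> A" "r = y \<otimes> a \<otimes> inv y" "p \<notin> N y"
    using crossing_point[of x1 x2 r p] assms by metis
  obtain y' a' where y': "y' \<in> carrier G" "a' \<in> A" "r = y' \<otimes> a' \<otimes> inv y'" "p \<in> N y'"
    using crossing_point[of x3 x4 r p] assms by metis
  show ?thesis
    using wall_of_two_edges_commutes[OF y(1) y'(1) y(2) y'(2) assms(5) y(3) y'(3)] y y' by blast
qed

definition cancellable :: "'a list \<Rightarrow> bool" where
  "cancellable w \<longleftrightarrow> (\<exists>u a v w'. w = u @ a # v @ a # w' \<and> (\<forall>x\<in>set v. adj a x))"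

text \<open>In a nonreduced word with reduced tail, the first letter \<open>s\<close> is cancelled by a later letter \<open>a\<close>.
  Then \<open>reduced_commute_adj\<close> makes all letters in between commute with \<open>s\<close>, which forces \<open>a = s\<close>.
  Together with its converse this solves the word problem.\<close>

lemma not_cancellable_reduced: "w \<in> lists A \<Longrightarrow> \<not> cancellable w \<Longrightarrow> reduced w"
proof (induction w)
  case (Cons s w)
  have s: "s \<in> A" and w: "w \<in> lists A" "word_prod w \<in> carrier G" using Cons.prems(1) by auto
  have nc: "\<not> cancellable w"
  proof
    assume "cancellable w"
    then obtain u a v w' where "w = u @ a # v @ a # w'" "\<forall>x\<in>set v. adj a x"
      by (auto simp: cancellable_def)
    then have "s # w = (s # u) @ a # v @ a # w'" by simp
    then show False using Cons.prems(2) \<open>\<forall>x\<in>set v. adj a x\<close> unfolding cancellable_def by blast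
  qed
  then have r: "reduced w" using Cons.IH nc w by simp
  have "s \<notin> N (word_prod w)"
  proof
    assume "s \<in> N (word_prod w)"
    then obtain u a v where u: "w = u @ a # v" "s \<notin> N (word_prod u)"
      "s = word_prod u \<otimes> a \<otimes> inv (word_prod u)"
      using N_word_cases[OF w(1)] by metis
    have a: "a \<in> A" and ul: "u \<in> lists A" "word_prod u \<in> carrier G" using u(1) w(1) by auto
    have comm: "s \<otimes> word_prod u = word_prod u \<otimes> a"
    proof -
      have "word_prod u \<otimes> a \<otimes> inv (word_prod u) \<otimes> word_prod u = word_prod u \<otimes> a"
        using a ul by (simp add: m_assoc)
      then show ?thesis using u(3) by simp
    qed
    have "reduced u" using r u(1) reduced_append by blast
    then have "len (s \<otimes> word_prod u) = Suc (length u)"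
      using len_gen_mult(1)[OF s ul(2) u(2)] by (simp add: reduced_def)
    then have adj: "\<forall>x\<in>set u. adj s x"
      using reduced_commute_adj[OF s a ul(1) comm] by simp
    then have "word_prod u \<otimes> a = word_prod u \<otimes> s" using comm adj_word_prod[OF s ul(1)] by simp
    then have "a = s" using a s ul(2) by simp
    then have "s # w = [] @ s # u @ s # v" using u(1) by simp
    then show False using Cons.prems(2) adj unfolding cancellable_def by blast
  qed
  then show ?case using len_gen_mult(1)[OF s w(2)] r s w by (simp add: reduced_def)
qed (simp add: reduced_def)

lemma reduced_not_cancellable:
  assumes "reduced w"
  shows "\<not> cancellable w"
proof
  assume "cancellable w"
  then obtain u a v w' where w: "w = u @ a # v @ a # w'" "\<forall>x\<in>set v. adj a x"
    by (auto simp: cancellable_def)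
  have l: "u \<in> lists A" "a \<in> A" "v \<in> lists A" "w' \<in> lists A" using w(1) assms by (auto simp: reduced_def)
  have "a \<otimes> (word_prod v \<otimes> (a \<otimes> word_prod w')) = (a \<otimes> word_prod v) \<otimes> (a \<otimes> word_prod w')"
    using l by (simp add: m_assoc)
  also have "\<dots> = word_prod v \<otimes> word_prod w'"
    using l adj_word_prod[OF l(2,3) w(2)] by (simp add: m_assoc)
  finally have "word_prod (u @ v @ w') = word_prod w" using l w(1) by simp
  then show False using reduced_length_le[OF assms, of "u @ v @ w'"] l w(1) by simp
qed

lemma reduced_iff: "reduced w \<longleftrightarrow> w \<in> lists A \<and> \<not> cancellable w"
  using reduced_not_cancellable not_cancellable_reduced by (auto simp: reduced_def)

definition movable_to_front :: "'a \<Rightarrow> 'a list \<Rightarrow> bool" where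
  "movable_to_front a w \<longleftrightarrow> (\<exists>u v. w = u @ a # v \<and> (\<forall>x\<in>set u. adj a x))"

definition movable_to_back :: "'a \<Rightarrow> 'a list \<Rightarrow> bool" where
  "movable_to_back a w \<longleftrightarrow> (\<exists>u v. w = u @ a # v \<and> (\<forall>x\<in>set v. adj a x))"

lemma cancellable_append:
  assumes "cancellable (u @ v)"
  shows "cancellable u \<or> cancellable v \<or> (\<exists>a. movable_to_back a u \<and> movable_to_front a v)"
proof -
  obtain p a m q where e: "u @ v = p @ a # m @ a # q" and m: "\<forall>x\<in>set m. adj a x"
    using assms by (auto simp: cancellable_def)
  from e consider
      (1) us where "u = p @ us" "us @ v = a # m @ a # q"
    | (2) us where "p = u @ us" "v = us @ a # m @ a # q"
    by (auto simp: append_eq_append_conv2)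
  then show ?thesis
  proof cases
    case 2
    then show ?thesis using m unfolding cancellable_def by blast
  next
    case 1
    show ?thesis
    proof (cases us)
      case Nil
      then have "v = [] @ a # m @ a # q" using 1 by simp
      then show ?thesis using m unfolding cancellable_def by blast
    next
      case (Cons b us')
      then have "b = a" and e': "us' @ v = m @ a # q" using 1 by auto
      from e' consider
          (3) ws where "us' = m @ ws" "ws @ v = a # q"
        | (4) ws where "m = us' @ ws" "v = ws @ a # q"
        by (auto simp: append_eq_append_conv2)
      then show ?thesis
      proof cases
        case 4
        then have "movable_to_back a u" "movable_to_front a v"
          using 1 Cons \<open>b = a\<close> m unfolding movable_to_back_def movable_to_front_def by fastforce+
        then show ?thesis by blast
      next
        case 3
        show ?thesis
        proof (cases ws)
          case Nil
          then have "movable_to_back a u" "movable_to_front a v"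
            using 1 3 Cons \<open>b = a\<close> m unfolding movable_to_back_def movable_to_front_def by fastforce+
          then show ?thesis by blast
        next
          case (Cons c ws')
          then have "u = p @ a # m @ a # ws'" using 1 3 \<open>us = b # us'\<close> \<open>b = a\<close> by simp
          then show ?thesis using m unfolding cancellable_def by blast
        qed
      qed
    qed
  qed
qed

text \<open>A cancelling pair in a power of \<open>w\<close> joins two neighbouring copies of \<open>w\<close>: its letter occurs in every
  copy, and a letter is not adjacent to itself, so the pair cannot jump over a whole copy.\<close>

lemma reduced_power:
  assumes "reduced w" "\<And>a. \<not> (movable_to_front a w \<and> movable_to_back a w)"
  shows "reduced (concat (replicate k w))"
proof (induction k)
  case (Suc k)
  let ?v = "concat (replicate k w)"
  have "\<not> cancellable (w @ ?v)"
  proof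
    assume "cancellable (w @ ?v)"
    then obtain a where a: "movable_to_back a w" "movable_to_front a ?v"
      using cancellable_append Suc assms(1) reduced_iff by blast
    then obtain k' where k: "k = Suc k'" by (cases k) (auto simp: movable_to_front_def)
    obtain u v where v: "?v = u @ a # v" "\<forall>x\<in>set u. adj a x"
      using a(2) by (auto simp: movable_to_front_def)
    have "a \<in> set w" using a(1) by (auto simp: movable_to_back_def)
    have "w @ concat (replicate k' w) = u @ a # v" using v(1) k by simp
    then consider us where "w = u @ us" "us @ concat (replicate k' w) = a # v"
      | us where "u = w @ us"
      by (auto simp: append_eq_append_conv2)
    then show False
    proof cases
      case 1
      have "us \<noteq> []"
        using 1 v(2) \<open>a \<in> set w\<close> by auto
      then obtain us' where "us = a # us'" using 1 by (cases us) auto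
      then have "movable_to_front a w" using 1 v(2) by (auto simp: movable_to_front_def)
      then show False using assms(2) a(1) by blast
    next
      case 2
      then have "a \<in> set u" using \<open>a \<in> set w\<close> by simp
      then show False using v(2) adj_irrefl by blast
    qed
  qed
  then show ?case using Suc assms(1) by (simp add: reduced_iff)
qed (simp add: reduced_def)

lemma word_prod_power:
  "w \<in> lists A \<Longrightarrow> word_prod (concat (replicate k w)) = word_prod w [^] k"
proof (induction k)
  case (Suc k)
  have "set (concat (replicate k w)) \<subseteq> carrier G" using Suc.prems by auto
  then show ?case using Suc by (simp flip: nat_pow_Suc2)
qed simp

lemma torsion_no_common_letter:
  assumes "reduced w" "\<And>a. \<not> (movable_to_front a w \<and> movable_to_back a w)"
    and "word_prod w [^] (k::nat) = \<one>" "k > 0"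
  shows "w = []"
proof -
  have "len (word_prod (concat (replicate k w))) = length (concat (replicate k w))"
    using reduced_power[OF assms(1,2)] by (simp add: reduced_def)
  moreover have "word_prod (concat (replicate k w)) = \<one>"
    using assms(1,3) word_prod_power by (simp add: reduced_def)
  ultimately have "length (concat (replicate k w)) = 0" by simp
  then show ?thesis using assms(4) by simp
qed

end

section \<open>Torsion in dimension two\<close>

locale right_angled_2d = right_angled_system +
  assumes no_triangle: "a \<in> A \<Longrightarrow> b \<in> A \<Longrightarrow> c \<in> A \<Longrightarrow> adj a b \<Longrightarrow> adj b c \<Longrightarrow> \<not> adj a c"
begin

lemma conj_power:
  fixes k :: nat
  assumes "y \<in> carrier G" "h \<in> carrier G"
  shows "(y \<otimes> h \<otimes> inv y) [^] k = y \<otimes> h [^] k \<otimes> inv y"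
  using assms by (induction k) (simp_all add: group_word_simps)

text \<open>Let \<open>w\<close> be a shortest word for a conjugate of \<open>g\<close>. If no letter can be moved both to the front and to
  the back of \<open>w\<close>, then all powers of \<open>w\<close> are reduced and \<open>w\<close> is empty. Otherwise, as conjugation by
  such a letter \<open>x\<close> does not shorten \<open>w\<close>, the two moves concern the same occurrence of \<open>x\<close>, which is thus adjacent
  to all other letters. These are pairwise nonadjacent because there are no triangles,
  and the same argument applied to the word \<open>v\<close> that they form leaves at most one of them.\<close>

lemma torsion_conj_clique:
  fixes k :: nat
  assumes g: "g \<in> carrier G" "g [^] k = \<one>" "k > 0"
  obtains y w where "y \<in> carrier G" "g = y \<otimes> w \<otimes> inv y"
    "w = \<one> \<or> w \<in> A \<or> (\<exists>a\<in>A. \<exists>b\<in>A. adj a b \<and> w = a \<otimes> b)"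
proof -
  define conj where "conj w \<longleftrightarrow> w \<in> lists A \<and> (\<exists>y\<in>carrier G. g = y \<otimes> word_prod w \<otimes> inv y)" for w
  have "\<exists>w. conj w"
    using ex_word[OF g(1)] g(1) unfolding conj_def
    by (metis inv_one one_closed l_one r_one)
  then obtain w where w: "conj w" and min: "\<And>v. conj v \<Longrightarrow> length w \<le> length v"
    using ex_has_least_nat[of conj _ length] by blast
  obtain y where wA: "w \<in> lists A" and y: "y \<in> carrier G" "g = y \<otimes> word_prod w \<otimes> inv y"
    using w by (auto simp: conj_def)
  have wc: "word_prod w \<in> carrier G" using wA by simp
  have min': "length w \<le> length v"
    if "v \<in> lists A" "z \<in> carrier G" "word_prod w = z \<otimes> word_prod v \<otimes> inv z" for v z
  proof (rule min)
    have "g = (y \<otimes> z) \<otimes> word_prod v \<otimes> inv (y \<otimes> z)"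
      unfolding y(2) that(3) using that(1,2) y(1) by (simp add: group_word_simps)
    then show "conj v" using that(1,2) y(1) unfolding conj_def by blast
  qed
  have red: "reduced w"
    using min'[of _ \<one>] wA by (intro shortest_word_reduced) auto
  have "word_prod w = inv y \<otimes> g \<otimes> inv (inv y)"
    unfolding y(2) using y(1) wc by (simp add: group_word_simps)
  then have "word_prod w [^] k = inv y \<otimes> g [^] k \<otimes> inv (inv y)"
    using conj_power[of "inv y" g k] g y(1) by simp
  then have tor: "word_prod w [^] k = \<one>" using g y(1) by simp
  have "word_prod w = \<one> \<or> word_prod w \<in> A \<or> (\<exists>a\<in>A. \<exists>b\<in>A. adj a b \<and> word_prod w = a \<otimes> b)"
  proof (cases "\<exists>a. movable_to_front a w \<and> movable_to_back a w")
    case False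
    then have "w = []" using torsion_no_common_letter[OF red _ tor g(3)] by blast
    then show ?thesis by simp
  next
    case True
    then obtain x c d u b where c: "w = c @ x # d" "\<forall>z\<in>set c. adj x z"
      and u: "w = u @ x # b" "\<forall>z\<in>set b. adj x z"
      unfolding movable_to_front_def movable_to_back_def by blast
    \<comment> \<open>Otherwise two different occurrences of \<open>x\<close> cancel after conjugation by \<open>x\<close>, which shortens \<open>w\<close>.\<close>
    have "c = u \<and> d = b"
    proof -
      consider "length c < length u" | "length u < length c" | "length c = length u" by linarith
      then show ?thesis
      proof cases
        case 1
        then obtain us where "u = c @ us" "us @ x # b = x # d" "us \<noteq> []"
          using c(1) u(1) by (auto simp: append_eq_append_conv2)
        then obtain e where e: "u = c @ x # e" by (cases us) auto
        have l: "x \<in> A" "c \<in> lists A" "e \<in> lists A" "b \<in> lists A" using wA u(1) e by auto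
        have "word_prod w = word_prod c \<otimes> x \<otimes> word_prod e \<otimes> (x \<otimes> word_prod b)"
          using l e u(1) by (simp add: m_assoc)
        also have "\<dots> = x \<otimes> word_prod c \<otimes> word_prod e \<otimes> (word_prod b \<otimes> x)"
          using adj_word_prod[OF l(1)] l c(2) u(2) by metis
        also have "\<dots> = x \<otimes> word_prod (c @ e @ b) \<otimes> inv x"
          using l by (simp add: m_assoc)
        finally have "length w \<le> length (c @ e @ b)"
          using min'[of "c @ e @ b" x] l by simp
        then show ?thesis using u(1) e by simp
      next
        case 2
        then obtain us where "c = u @ us" "us @ x # d = x # b" "us \<noteq> []"
          using c(1) u(1) by (auto simp: append_eq_append_conv2)
        then obtain e where "c = u @ x # e" by (cases us) auto
        then show ?thesis using c(2) by auto
      next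
        case 3
        then show ?thesis using c(1) u(1) by auto
      qed
    qed
    then have w_eq: "w = c @ x # b" and link: "\<forall>z\<in>set (c @ b). adj x z" using c u by auto
    define v where "v = c @ b"
    have l: "x \<in> A" "c \<in> lists A" "b \<in> lists A" "v \<in> lists A" using wA w_eq by (auto simp: v_def)
    have vc: "word_prod v \<in> carrier G" using l by simp
    have adj: "\<forall>z\<in>set v. adj x z" using link by (simp add: v_def)
    have comm: "x \<otimes> word_prod v = word_prod v \<otimes> x" using adj_word_prod l adj by blast
    have "word_prod w = (word_prod c \<otimes> x) \<otimes> word_prod b"
      using l w_eq by (simp add: m_assoc)
    also have "\<dots> = (x \<otimes> word_prod c) \<otimes> word_prod b"
      using adj_word_prod[OF l(1,2)] link by simp
    finally have wv: "word_prod w = x \<otimes> word_prod v"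
      using l by (simp add: m_assoc v_def)
    then have "reduced (x # v)" using red l w_eq by (simp add: reduced_def v_def)
    then have rv: "reduced v" using reduced_append[of "[x]" v] by simp
    have indep: "\<not> adj z z'" if "z \<in> set v" "z' \<in> set v" for z z'
      using no_triangle[of z x z'] adj that l adj_sym by blast
    show ?thesis
    proof (cases "\<exists>a. movable_to_front a v \<and> movable_to_back a v")
      case True
      then obtain z c1 d1 u1 b1 where z: "v = c1 @ z # d1" "\<forall>y\<in>set c1. adj z y"
        "v = u1 @ z # b1" "\<forall>y\<in>set b1. adj z y"
        unfolding movable_to_front_def movable_to_back_def by blast
      have "z \<in> set v" "set c1 \<subseteq> set v" using z(1) by auto
      moreover have "set b1 \<subseteq> set v" using z(3) by auto
      ultimately have "c1 = []" "b1 = []" using z(2,4) indep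
        by (metis in_mono list.set_intros(1) neq_Nil_conv)+
      then have v1: "v = z # d1" and v2: "v = u1 @ [z]" using z by auto
      show ?thesis
      proof (cases u1)
        case Nil
        then show ?thesis using v2 wv adj l by auto
      next
        case (Cons z' e)
        then have e: "v = z # e @ [z]" using v1 v2 by simp
        have le: "z \<in> A" "e \<in> lists A" using e l by auto
        have "x \<otimes> z = z \<otimes> x" using adj e by (auto simp: adj_def)
        \<comment> \<open>Conjugating by the common letter \<open>z\<close> of \<open>v\<close> shortens \<open>w\<close>.\<close>
        then have "word_prod w = z \<otimes> word_prod (x # e) \<otimes> inv z"
          unfolding wv e using le l by (simp flip: m_assoc)
        then have "length w \<le> length (x # e)" using min'[of "x # e" z] le l by simp
        moreover have "length w = Suc (length v)" using w_eq v_def by simp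
        ultimately show ?thesis using e by simp
      qed
    next
      case False
      have "(x \<otimes> word_prod v) [^] (k * 2) = (x [^] (k * 2)) \<otimes> word_prod v [^] (k * 2)"
        using comm l vc by (intro pow_mult_distrib) auto
      moreover have "x [^] (k * 2) = \<one>"
      proof -
        have "x [^] (2::nat) = \<one>" using l by (simp add: numeral_2_eq_2 gen_square)
        then have "(x [^] (2::nat)) [^] k = \<one>" by simp
        then show ?thesis using l by (simp only: nat_pow_pow gen_closed mult.commute[of k])
      qed
      moreover have "(x \<otimes> word_prod v) [^] (k * 2) = \<one>"
        using tor wv l vc by (simp add: nat_pow_pow[symmetric])
      ultimately have "word_prod v [^] (k * 2) = \<one>" using vc by simp
      then have "v = []" using torsion_no_common_letter[OF rv, of "k * 2"] False g(3) by simp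
      then show ?thesis using wv l by simp
    qed
  qed
  then show thesis using that[OF y(1)] y(2) by blast
qed

lemma torsion_square:
  fixes k :: nat
  assumes g: "g \<in> carrier G" "g [^] k = \<one>" "k > 0"
  shows "g \<otimes> g = \<one>"
proof -
  obtain y w where y: "y \<in> carrier G" "g = y \<otimes> w \<otimes> inv y"
    and w: "w = \<one> \<or> w \<in> A \<or> (\<exists>a\<in>A. \<exists>b\<in>A. adj a b \<and> w = a \<otimes> b)"
    using torsion_conj_clique[OF assms] by blast
  have "w \<otimes> w = \<one>" if ab: "a \<in> A" "b \<in> A" "adj a b" "w = a \<otimes> b" for a b
  proof -
    have "w \<otimes> w = a \<otimes> (b \<otimes> a) \<otimes> b" using ab by (simp add: m_assoc)
    also have "\<dots> = a \<otimes> (a \<otimes> b) \<otimes> b" using ab(3) by (simp add: adj_def)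
    finally show ?thesis using ab by (simp add: m_assoc gen_square)
  qed
  then have "w \<otimes> w = \<one>" "w \<in> carrier G" using w gen_square by auto
  moreover have "g \<otimes> g = y \<otimes> (w \<otimes> w) \<otimes> inv y"
    unfolding y(2) using y(1) \<open>w \<in> carrier G\<close> by (simp add: group_word_simps)
  ultimately show ?thesis using y by simp
qed

text \<open>Shorten \<open>c\<close> to an element \<open>d\<close> of least length in its coset of the group generated by \<open>a\<close> and \<open>b\<close>.
  If \<open>d\<close> is not trivial, its first letter lies together with \<open>a\<close> and \<open>b\<close> in \<open>N\<close> of
  \<open>a b d = d a b\<close>, which is a triangle.\<close>

lemma centralizer_rotation:
  assumes a: "a \<in> A" and b: "b \<in> A" and ab: "adj a b"
    and c: "c \<in> carrier G" "c \<otimes> (a \<otimes> b) = a \<otimes> b \<otimes> c"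
  shows "c \<in> {\<one>, a, b, a \<otimes> b}"
proof -
  have comm: "a \<otimes> b = b \<otimes> a" "a \<noteq> b" using ab by (auto simp: adj_def)
  have "a \<otimes> b \<otimes> a = a \<otimes> (a \<otimes> b)" "b \<otimes> a \<otimes> b = b \<otimes> (b \<otimes> a)"
    using a b comm(1) by (metis gen_closed m_assoc)+
  then have aba: "a \<otimes> b \<otimes> a = b" "b \<otimes> a \<otimes> b = a" using a b by simp_all
  define C where "C = {c, a \<otimes> c, b \<otimes> c, a \<otimes> b \<otimes> c}"
  have rot: "d \<otimes> (a \<otimes> b) = a \<otimes> b \<otimes> d" "d \<in> carrier G" if "d \<in> C" for d
  proof -
    have mult: "(x \<otimes> c) \<otimes> r = r \<otimes> (x \<otimes> c)"
      if "x \<in> carrier G" "r \<in> carrier G" "x \<otimes> r = r \<otimes> x" "c \<otimes> r = r \<otimes> c" for x r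
      using that c(1) by (metis m_assoc)
    have "a \<otimes> (a \<otimes> b) = a \<otimes> b \<otimes> a" "b \<otimes> (a \<otimes> b) = a \<otimes> b \<otimes> b"
      using a b comm(1) by (metis gen_closed m_assoc)+
    moreover have "a \<otimes> b \<in> carrier G" using a b by simp
    ultimately have "(a \<otimes> c) \<otimes> (a \<otimes> b) = a \<otimes> b \<otimes> (a \<otimes> c)"
      "(b \<otimes> c) \<otimes> (a \<otimes> b) = a \<otimes> b \<otimes> (b \<otimes> c)"
      "(a \<otimes> b \<otimes> c) \<otimes> (a \<otimes> b) = a \<otimes> b \<otimes> (a \<otimes> b \<otimes> c)"
      using mult[OF _ _ _ c(2)] gen_closed[OF a] gen_closed[OF b] by blast+
    then show "d \<otimes> (a \<otimes> b) = a \<otimes> b \<otimes> d" "d \<in> carrier G"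
      using that c a b unfolding C_def by fastforce+
  qed
  obtain d where d: "d \<in> C" and min: "\<And>d'. d' \<in> C \<Longrightarrow> len d \<le> len d'"
    using ex_has_least_nat[of "\<lambda>d. d \<in> C" c len] by (auto simp: C_def)
  have dc: "d \<in> carrier G" using rot d by blast
  have "a \<otimes> d \<in> C" "b \<otimes> d \<in> C"
  proof -
    have "a \<otimes> (a \<otimes> c) = c" "b \<otimes> (b \<otimes> c) = c" "a \<otimes> (b \<otimes> c) = a \<otimes> b \<otimes> c"
      "b \<otimes> (a \<otimes> c) = a \<otimes> b \<otimes> c" "a \<otimes> (a \<otimes> b \<otimes> c) = b \<otimes> c" "b \<otimes> (a \<otimes> b \<otimes> c) = a \<otimes> c"
      using a b c(1) comm(1) by (simp, simp, metis gen_closed m_assoc, metis gen_closed m_assoc,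
          metis gen_closed m_assoc m_closed gen_cancel, metis gen_closed m_assoc m_closed gen_cancel)
    then show "a \<otimes> d \<in> C" "b \<otimes> d \<in> C" using d by (auto simp: C_def)
  qed
  then have nd: "a \<notin> N d" "b \<notin> N d"
    using min len_gen_mult(2)[OF a dc] len_gen_mult(2)[OF b dc] by fastforce+
  have "d = \<one>"
  proof (rule ccontr)
    assume "d \<noteq> \<one>"
    obtain w where w: "reduced w" "word_prod w = d" "length w = len d" using ex_reduced_word[OF dc] by blast
    then obtain x v where wx: "w = x # v" using \<open>d \<noteq> \<one>\<close> by (cases w) auto
    have x: "x \<in> A" using w(1) wx by (auto simp: reduced_def)
    let ?g = "a \<otimes> b \<otimes> d"
    have len1: "a \<in> N ?g" "b \<in> N ?g" "len ?g = Suc (Suc (len d))"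
    proof -
      have na: "a \<notin> N (b \<otimes> d)" "b \<notin> N (a \<otimes> d)"
        using N_gen_mult[OF b dc, of a] N_gen_mult[OF a dc, of b] aba nd comm a b by auto
      have g: "?g = a \<otimes> (b \<otimes> d)" "?g = b \<otimes> (a \<otimes> d)"
        using a b dc comm by (simp_all flip: m_assoc)
      then show "len ?g = Suc (Suc (len d))"
        using na nd len_gen_mult(1) a b dc by simp
      show "a \<in> N ?g" "b \<in> N ?g"
        using N_gen_mult[OF a _ gen_closed[OF a], of "b \<otimes> d"] N_gen_mult[OF b _ gen_closed[OF b], of "a \<otimes> d"]
          na g a b dc by (auto simp: gen_square)
    qed
    have gw: "?g = word_prod (w @ [a, b])" using rot(1)[OF d] w a b by (simp add: reduced_def m_assoc)
    have red: "reduced (w @ [a, b])" using gw len1(3) w a b by (simp add: reduced_def)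
    have "x \<in> N (word_prod [x])" using x by (simp add: N_gen)
    then have xd: "x \<in> N d" using N_prefix[of "[x]" v] w wx by auto
    then have "x \<in> N ?g" using N_prefix[OF red] w gw by auto
    moreover have "?g \<in> carrier G" using a b dc by simp
    ultimately have "a \<otimes> x = x \<otimes> a" "b \<otimes> x = x \<otimes> b"
      using descents_commute len1 a b x by blast+
    moreover have "a \<noteq> x" "b \<noteq> x" using xd nd by auto
    ultimately have "adj a x" "adj b x" by (simp_all add: adj_def)
    then show False using no_triangle[of a b x] a b x ab by blast
  qed
  then have "\<one> \<in> C" using d by simp
  then consider "c = \<one>" | "a \<otimes> c = \<one>" | "b \<otimes> c = \<one>" | "a \<otimes> b \<otimes> c = \<one>" by (auto simp: C_def)
  then show ?thesis
  proof cases
    case 4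
    then have "inv (a \<otimes> b) = c" using a b c by (metis inv_equality inv_inv m_closed gen_closed)
    then show ?thesis using a b comm by (simp add: inv_mult_group)
  qed (use a b c in \<open>metis gen_cancel r_one gen_closed insertCI\<close>)+
qed

lemma finite_centralizer_rotation:
  assumes "a \<in> A" "b \<in> A" "adj a b" "y \<in> carrier G" "g = y \<otimes> (a \<otimes> b) \<otimes> inv y"
  shows "finite {c \<in> carrier G. c \<otimes> g = g \<otimes> c}"
proof -
  have "c \<in> (\<lambda>d. y \<otimes> d \<otimes> inv y) ` {\<one>, a, b, a \<otimes> b}" if c: "c \<in> carrier G" "c \<otimes> g = g \<otimes> c" for c
  proof -
    let ?d = "inv y \<otimes> c \<otimes> y"
    have "?d \<otimes> (a \<otimes> b) = inv y \<otimes> (c \<otimes> g) \<otimes> y"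
      unfolding assms(5) using assms(1-4) c(1) by (simp add: group_word_simps)
    also have "\<dots> = inv y \<otimes> (g \<otimes> c) \<otimes> y" using c by simp
    also have "\<dots> = a \<otimes> b \<otimes> ?d"
      unfolding assms(5) using assms(1-4) c(1) by (simp add: group_word_simps)
    finally have "?d \<in> {\<one>, a, b, a \<otimes> b}" using centralizer_rotation assms c by simp
    moreover have "c = y \<otimes> ?d \<otimes> inv y" using assms c by (simp add: group_word_simps)
    ultimately show ?thesis by blast
  qed
  then have "{c \<in> carrier G. c \<otimes> g = g \<otimes> c} \<subseteq> (\<lambda>d. y \<otimes> d \<otimes> inv y) ` {\<one>, a, b, a \<otimes> b}" by blast
  then show ?thesis by (rule finite_subset) simp
qed

end

section \<open>Reflection subgroups and quasiconvexity\<close>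

context group
begin

lemma generate_finite_subset:
  assumes "x \<in> generate G R"
  shows "\<exists>F. finite F \<and> F \<subseteq> R \<and> x \<in> generate G F"
  using assms
proof (induction rule: generate.induct)
  case one
  then show ?case using generate.one[of G "{}"] by blast
next
  case (incl h)
  then show ?case using generate.incl[of h "{h}" G] by (intro exI[of _ "{h}"]) auto
next
  case (inv h)
  then show ?case using generate.inv[of h "{h}" G] by (intro exI[of _ "{h}"]) auto
next
  case (eng h1 h2)
  then obtain F1 F2 where F: "finite F1" "F1 \<subseteq> R" "h1 \<in> generate G F1"
    "finite F2" "F2 \<subseteq> R" "h2 \<in> generate G F2" by auto
  then have "h1 \<in> generate G (F1 \<union> F2)" "h2 \<in> generate G (F1 \<union> F2)"
    using mono_generate[of F1 "F1 \<union> F2"] mono_generate[of F2 "F1 \<union> F2"] by auto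
  then show ?case using F generate.eng by (intro exI[of _ "F1 \<union> F2"]) auto
qed

lemma generate_commute:
  assumes "p \<in> carrier G" "B \<subseteq> carrier G" "\<And>b. b \<in> B \<Longrightarrow> p \<otimes> b = b \<otimes> p" "g \<in> generate G B"
  shows "p \<otimes> g = g \<otimes> p"
  using assms(4)
proof (induction rule: generate.induct)
  case one
  then show ?case using assms(1) by simp
next
  case (incl h)
  then show ?case using assms(3) by simp
next
  case (inv h)
  then have h: "h \<in> carrier G" "p \<otimes> h = h \<otimes> p" using assms by auto
  have "p \<otimes> inv h = inv h \<otimes> (h \<otimes> p) \<otimes> inv h" using h(1) assms(1) by (simp add: m_assoc)
  also have "\<dots> = inv h \<otimes> (p \<otimes> h) \<otimes> inv h" using h by simp
  also have "\<dots> = inv h \<otimes> p" using h(1) assms(1) by (simp add: m_assoc)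
  finally show ?case .
next
  case (eng h1 h2)
  then have "h1 \<in> carrier G" "h2 \<in> carrier G" using generate_in_carrier[OF assms(2)] by auto
  then show ?case using eng.IH assms(1) by (metis m_assoc)
qed

end

context reflection_system
begin

text \<open>For a reflection subgroup \<open>H\<close> these are the reflections in the walls adjacent to the chamber of \<open>H\<close>
  that contains \<open>\<one>\<close>, namely the set of all \<open>x\<close> with \<open>N x \<inter> H = {}\<close>. They
  are reflections because \<open>r \<in> N r\<close>.\<close>

definition fundamental_reflections :: "'a set \<Rightarrow> 'a set" where
  "fundamental_reflections H = {r \<in> H. r \<otimes> r = \<one> \<and> N r \<inter> H = {r}}"

lemma fundamental_reflection_of_edge:
  assumes H: "subgroup H G" and z: "z \<in> carrier G" "a \<in> A" "N z \<inter> H = {}"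
    and r: "r = z \<otimes> a \<otimes> inv z" "r \<in> H"
  shows "r \<in> fundamental_reflections H"
proof -
  have sq: "r \<otimes> r = \<one>" using reflection_square z r by simp
  have "q \<in> N r \<longleftrightarrow> q = r" if "q \<in> H" for q
  proof -
    have "q \<in> carrier G" using subgroup.mem_carrier[OF H that] .
    moreover have "r \<otimes> q \<otimes> r \<in> H" using H that r(2) by (simp add: subgroup.m_closed)
    ultimately show ?thesis using N_reflection_iff[OF z(1,2) _ r(1)] that z(3) by blast
  qed
  then show ?thesis using sq r(2) by (auto simp: fundamental_reflections_def)
qed

text \<open>Choose \<open>x\<close> of least length. If a geodesic from \<open>\<one>\<close> to \<open>x\<close> crossed walls of \<open>H\<close>, the first of
  these would be fundamental, and reflecting in it would shorten \<open>x\<close>.\<close>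

lemma chamber_decomposition:
  assumes H: "subgroup H G" and w: "w \<in> carrier G"
  obtains h x where "h \<in> generate G (fundamental_reflections H)" "x \<in> carrier G"
    "w = h \<otimes> x" "N x \<inter> H = {}"
proof -
  let ?R = "fundamental_reflections H"
  have R: "?R \<subseteq> carrier G"
    using H subgroup.subset by (auto simp: fundamental_reflections_def)
  define P where "P x \<longleftrightarrow> x \<in> carrier G \<and> (\<exists>h\<in>generate G ?R. w = h \<otimes> x)" for x
  have "P w" using w generate.one[of G ?R] by (auto simp: P_def intro!: bexI[of _ \<one>])
  then obtain x where x: "P x" and min: "\<And>x'. P x' \<Longrightarrow> len x \<le> len x'"
    using ex_has_least_nat[of P w len] by blast
  obtain h where h: "h \<in> generate G ?R" "w = h \<otimes> x" and xc: "x \<in> carrier G"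
    using x by (auto simp: P_def)
  have hc: "h \<in> carrier G" using h(1) generate_in_carrier[OF R] by blast
  have first: "\<exists>u a v. ws = u @ a # v \<and> N (word_prod u) \<inter> H = {} \<and>
      word_prod u \<otimes> a \<otimes> inv (word_prod u) \<in> H \<inter> N (word_prod (u @ [a]))"
    if "ws \<in> lists A" "N (word_prod ws) \<inter> H \<noteq> {}" for ws
    using that
  proof (induction ws rule: rev_induct)
    case (snoc a u)
    have a: "a \<in> A" and u: "u \<in> lists A" "word_prod u \<in> carrier G" using snoc.prems(1) by auto
    show ?case
    proof (cases "N (word_prod u) \<inter> H = {}")
      case False
      then show ?thesis using snoc.IH u(1) by fastforce
    next
      case True
      have eq: "word_prod (u @ [a]) = word_prod u \<otimes> a" using a u by simp
      obtain q where q: "q \<in> N (word_prod u \<otimes> a)" "q \<in> H" using snoc.prems(2) eq by auto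
      then have "q = word_prod u \<otimes> a \<otimes> inv (word_prod u)"
        using N_mult_gen[OF a u(2), of q] True N_closed[OF q(1)] a u(2) by auto
      then show ?thesis using q eq True by (intro exI[of _ u] exI[of _ a] exI[of _ "[]"]) auto
    qed
  qed simp
  have "N x \<inter> H = {}"
  proof (rule ccontr)
    assume ne: "N x \<inter> H \<noteq> {}"
    obtain ws where ws: "reduced ws" "word_prod ws = x" using ex_reduced_word xc by blast
    obtain u a v where u: "ws = u @ a # v" "N (word_prod u) \<inter> H = {}"
      and r: "word_prod u \<otimes> a \<otimes> inv (word_prod u) \<in> H"
        "word_prod u \<otimes> a \<otimes> inv (word_prod u) \<in> N (word_prod (u @ [a]))"
      using first[of ws] ws ne by (auto simp: reduced_def)
    define r where "r = word_prod u \<otimes> a \<otimes> inv (word_prod u)"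
    have a: "a \<in> A" "word_prod u \<in> carrier G" using u(1) reducedD(1)[OF ws(1)] by auto
    have rR: "r \<in> ?R" using fundamental_reflection_of_edge[OF H a(2,1) u(2) r_def] r r_def by simp
    then have rc: "r \<in> carrier G" "r \<otimes> r = \<one>" using R by (auto simp: fundamental_reflections_def)
    have "r \<in> N x" using N_prefix[of "u @ [a]" v] ws u(1) r(2) r_def by auto
    then have "len (r \<otimes> x) < len x" using N_length_less xc by blast
    moreover have "P (r \<otimes> x)"
    proof -
      have "w = (h \<otimes> r) \<otimes> (r \<otimes> x)"
      proof -
        have "(h \<otimes> r) \<otimes> (r \<otimes> x) = h \<otimes> ((r \<otimes> r) \<otimes> x)" using hc rc(1) xc by (simp add: m_assoc)
        then show ?thesis using rc(2) xc h(2) by simp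
      qed
      moreover have "h \<otimes> r \<in> generate G ?R" using h(1) generate.incl[OF rR] by (rule generate.eng)
      ultimately show ?thesis using rc xc unfolding P_def by blast
    qed
    ultimately show False using min[of "r \<otimes> x"] by simp
  qed
  then show thesis using that h xc by blast
qed

text \<open>A reflection \<open>t \<in> H\<close> in the wall of an edge at \<open>z = h \<otimes> x\<close> is moved by \<open>h\<close> from a reflection in the
  wall of an edge at \<open>x\<close>, which is fundamental.\<close>

lemma finite_fundamental_generators:
  assumes T: "finite T" "\<And>t. t \<in> T \<Longrightarrow> \<exists>z\<in>carrier G. \<exists>a\<in>A. t = z \<otimes> a \<otimes> inv z"
    and H: "H = generate G T"
  obtains R where "finite R" "R \<subseteq> fundamental_reflections H" "generate G R = H"
proof -
  let ?R = "fundamental_reflections H"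
  have Tc: "T \<subseteq> carrier G" using T(2) by fastforce
  then have sub: "subgroup H G" unfolding H by (rule generate_is_subgroup)
  have RH: "?R \<subseteq> H" by (auto simp: fundamental_reflections_def)
  have genR: "generate G ?R \<subseteq> H" using generate_subgroup_incl[OF RH sub] .
  have "t \<in> generate G ?R" if t: "t \<in> T" for t
  proof -
    obtain z a where z: "z \<in> carrier G" "a \<in> A" "t = z \<otimes> a \<otimes> inv z" using T(2) t by blast
    obtain h x where hx: "h \<in> generate G ?R" "x \<in> carrier G" "z = h \<otimes> x" "N x \<inter> H = {}"
      using chamber_decomposition[OF sub z(1)] by blast
    let ?r = "x \<otimes> a \<otimes> inv x"
    have hH: "h \<in> H" using hx genR by blast
    then have hc: "h \<in> carrier G" using subgroup.mem_carrier[OF sub hH] by simp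
    have "?r = inv h \<otimes> t \<otimes> h" using hx(2,3) z hc by (simp add: group_word_simps)
    moreover have "t \<in> H" using H t generate.incl[of t T G] by simp
    ultimately have "?r \<in> H" using sub hH by (simp add: subgroup.m_closed subgroup.m_inv_closed)
    then have r: "?r \<in> generate G ?R"
      using fundamental_reflection_of_edge[OF sub hx(2) z(2) hx(4) HOL.refl] by (simp add: generate.incl)
    have "inv h \<in> generate G ?R"
      using hx(1) RH sub generate_m_inv_closed[of ?R h] subgroup.subset[OF sub] by auto
    then have "h \<otimes> ?r \<otimes> inv h \<in> generate G ?R" 
      by (rule generate.eng[OF generate.eng[OF hx(1) r]])
    moreover have "t = h \<otimes> ?r \<otimes> inv h" using hx(2,3) z hc by (simp add: group_word_simps)
    ultimately show ?thesis by simp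
  qed
  then have "\<forall>t\<in>T. \<exists>F. finite F \<and> F \<subseteq> ?R \<and> t \<in> generate G F"
    using generate_finite_subset by blast
  then obtain F where F: "\<And>t. t \<in> T \<Longrightarrow> finite (F t) \<and> F t \<subseteq> ?R \<and> t \<in> generate G (F t)"
    by metis
  let ?F = "\<Union>t\<in>T. F t"
  have Fc: "?F \<subseteq> carrier G" using F RH sub subgroup.subset by fast
  have "T \<subseteq> generate G ?F"
  proof
    fix t assume t: "t \<in> T"
    then show "t \<in> generate G ?F" using F[OF t] mono_generate[of "F t" ?F] by blast
  qed
  then have "H \<subseteq> generate G ?F"
    unfolding H using generate_is_subgroup[OF Fc] generate_subgroup_incl by blast
  moreover have "generate G ?F \<subseteq> H"
    using F RH sub generate_subgroup_incl[of ?F H] by blast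
  ultimately show thesis using that[of ?F] F T(1) by blast
qed

lemma subgroup_reflection_system:
  assumes H: "subgroup H G" and R: "R \<subseteq> fundamental_reflections H" "generate G R = H"
  shows "reflection_system (G\<lparr>carrier := H\<rparr>) R (\<lambda>h. N h \<inter> H)"
proof -
  have RH: "R \<subseteq> H" using R by (auto simp: fundamental_reflections_def)
  have Hc: "h \<in> carrier G" if "h \<in> H" for h using subgroup.mem_carrier[OF H that] .
  have conj: "inv g \<otimes> p \<otimes> g \<in> H" if "g \<in> H" "p \<in> H" for g p
    using that H by (simp add: subgroup.m_closed subgroup.m_inv_closed)
  interpret S: group "G\<lparr>carrier := H\<rparr>" using H by (rule subgroup_imp_group)
  show ?thesis
  proof
    show "R \<subseteq> carrier (G\<lparr>carrier := H\<rparr>)" using RH by simp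
    show "generate (G\<lparr>carrier := H\<rparr>) R = carrier (G\<lparr>carrier := H\<rparr>)"
      using generate_consistent[OF RH H] R(2) by simp
    show "a \<otimes>\<^bsub>G\<lparr>carrier := H\<rparr>\<^esub> a = \<one>\<^bsub>G\<lparr>carrier := H\<rparr>\<^esub>" if "a \<in> R" for a
      using that R by (auto simp: fundamental_reflections_def)
    show "N r \<inter> H = {r}" if "r \<in> R" for r
      using that R by (auto simp: fundamental_reflections_def)
    show "(p \<in> N (g \<otimes>\<^bsub>G\<lparr>carrier := H\<rparr>\<^esub> h) \<inter> H) =
       ((p \<in> N g \<inter> H) \<noteq> (inv\<^bsub>G\<lparr>carrier := H\<rparr>\<^esub> g \<otimes>\<^bsub>G\<lparr>carrier := H\<rparr>\<^esub> p \<otimes>\<^bsub>G\<lparr>carrier := H\<rparr>\<^esub> g \<in> N h \<inter> H))"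
      if "g \<in> carrier (G\<lparr>carrier := H\<rparr>)" "h \<in> carrier (G\<lparr>carrier := H\<rparr>)"
        "p \<in> carrier (G\<lparr>carrier := H\<rparr>)" for g h p
      using that N_mult[of g h p] conj[of g p] Hc m_inv_consistent[OF H, of g] by simp
  qed auto
qed

end

context right_angled_system
begin

text \<open>Follow a shortest expression of \<open>g\<close> in \<open>R\<close> up to the step \<open>u, u \<otimes> r\<close> that crosses \<open>p\<close>. Each wall
  \<open>q\<close> of \<open>H\<close> between \<open>\<one>\<close> and \<open>u\<close> crosses \<open>p\<close>: the points \<open>\<one>\<close>, \<open>u\<close>, \<open>x\<close> and \<open>u \<otimes> r\<close> lie
  in the four quadrants. So \<open>p\<close> commutes with all these \<open>q\<close>, hence with \<open>u\<close>, and translating by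
  \<open>inv u\<close> shows that \<open>p\<close> itself separates \<open>\<one>\<close> from \<open>r\<close>.\<close>

lemma wall_bound:
  assumes H: "subgroup H G" and R: "R \<subseteq> fundamental_reflections H" "generate G R = H"
    and g: "g \<in> H" "p \<in> N g" and x: "x \<in> carrier G" "N x \<inter> H = {}" "p \<in> N x"
  shows "p \<in> (\<Union>r\<in>R. N r)"
proof -
  interpret S: reflection_system "G\<lparr>carrier := H\<rparr>" R "\<lambda>h. N h \<inter> H"
    using H R by (rule subgroup_reflection_system)
  have wp: "S.word_prod ws = word_prod ws" for ws
    by (simp add: S.word_prod_def word_prod_def)
  have Hc: "h \<in> carrier G" if "h \<in> H" for h using subgroup.mem_carrier[OF H that] .
  have RH: "R \<subseteq> H" using S.gens_subset by simp
  have pc: "p \<in> carrier G" using N_closed x by blast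
  obtain rs where rs: "S.reduced rs" "word_prod rs = g"
    using S.ex_reduced_word[of g] g(1) wp by auto
  have "\<exists>u r v. ws = u @ r # v \<and> p \<notin> N (word_prod u) \<and> p \<in> N (word_prod u \<otimes> r)"
    if "set ws \<subseteq> carrier G" "p \<in> N (word_prod ws)" for ws
    using that
  proof (induction ws rule: rev_induct)
    case (snoc r u)
    show ?case
    proof (cases "p \<in> N (word_prod u)")
      case True
      then show ?thesis using snoc by fastforce
    next
      case False
      then show ?thesis using snoc.prems by (intro exI[of _ u] exI[of _ r] exI[of _ "[]"]) auto
    qed
  qed simp
  moreover have "set rs \<subseteq> carrier G" using S.reducedD(1)[OF rs(1)] RH Hc by auto
  ultimately obtain u r v where u: "rs = u @ r # v" "p \<notin> N (word_prod u)" "p \<in> N (word_prod u \<otimes> r)"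
    using rs(2) g(2) by blast
  have red: "S.reduced (u @ [r])" "S.reduced u"
    using rs(1) u(1) S.reduced_append[of "u @ [r]" v] S.reduced_append[of u "[r]"] by auto
  have r: "r \<in> R" using S.reducedD(1)[OF rs(1)] u(1) by auto
  have rH: "r \<in> H" using r RH by blast
  have uH: "word_prod u \<in> H" using S.reducedD(1)[OF red(2)] S.word_prod_closed[of u] S.words_closed wp by auto
  have ur: "word_prod (u @ [r]) = word_prod u \<otimes> r"
    using S.reducedD(1)[OF red(2)] rH RH Hc by (subst word_prod_append) auto
  have mono: "N (word_prod u) \<inter> H \<subseteq> N (word_prod u \<otimes> r) \<inter> H"
    using S.N_prefix[OF red(1)] wp ur by simp
  have comm: "p \<otimes> q = q \<otimes> p" if "q \<in> N (word_prod u) \<inter> H" for q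
  proof (rule crossing_walls_commute[of \<one> "word_prod u" x "word_prod u \<otimes> r"])
    show "(q \<in> N x) \<noteq> (q \<in> N (word_prod u \<otimes> r))" using that mono x(2) by blast
    show "(q \<in> N \<one>) \<noteq> (q \<in> N (word_prod u))" using that by simp
  qed (use u x pc that Hc uH rH in auto)
  have "word_prod u \<in> generate G (N (word_prod u) \<inter> H)"
    using S.reduced_in_generate_N[OF red(2)] generate_consistent[of "N (word_prod u) \<inter> H" H] H wp by simp
  then have "p \<otimes> word_prod u = word_prod u \<otimes> p"
    using subgroup.subset[OF H] by (intro generate_commute[OF pc _ comm]) auto
  then have "inv (word_prod u) \<otimes> p \<otimes> word_prod u = p"
    using pc Hc[OF uH] by (simp add: m_assoc)
  then have "p \<in> N r"
    using N_mult[of "word_prod u" r p] u(2,3) Hc uH rH pc by simp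
  then show ?thesis using r by blast
qed

text \<open>The hypothesis \<open>between\<close> says that no wall separates \<open>w\<close> from both \<open>h1\<close> and \<open>h2\<close>, as is the case on
  a geodesic.\<close>

lemma between_orbit_points:
  assumes H: "subgroup H G" and R: "finite R" "R \<subseteq> fundamental_reflections H" "generate G R = H"
    and h: "h1 \<in> H" "h2 \<in> H" and w: "w \<in> carrier G"
    and between: "\<And>q. q \<in> carrier G \<Longrightarrow> (q \<in> N w) = (q \<in> N h1) \<or> (q \<in> N w) = (q \<in> N h2)"
  shows "\<exists>h\<in>H. len (inv w \<otimes> h) \<le> card (\<Union>r\<in>R. N r)"
proof -
  have Hc: "h \<in> carrier G" if "h \<in> H" for h using subgroup.mem_carrier[OF H that] .
  have sub: "generate G (fundamental_reflections H) \<subseteq> H"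
    by (rule generate_subgroup_incl[OF _ H]) (auto simp: fundamental_reflections_def)
  obtain h x where hR: "h \<in> generate G (fundamental_reflections H)"
    and x: "x \<in> carrier G" "w = h \<otimes> x" "N x \<inter> H = {}"
    using chamber_decomposition[OF H w] by metis
  note hx = subsetD[OF sub hR] x
  have hc: "h \<in> carrier G" using Hc hx by blast
  have "N x \<subseteq> (\<Union>r\<in>R. N r)"
  proof
    fix q assume q: "q \<in> N x"
    then have qc: "q \<in> carrier G" using N_closed hx by blast
    let ?p = "h \<otimes> q \<otimes> inv h"
    have pc: "?p \<in> carrier G" using hc qc by simp
    have tr: "(?p \<in> N (h \<otimes> y)) = ((?p \<in> N h) \<noteq> (q \<in> N y))" if "y \<in> carrier G" for y
    proof -
      have "inv h \<otimes> ?p \<otimes> h = q" using hc qc by (simp add: group_word_simps)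
      then show ?thesis using N_mult[OF hc that pc] by simp
    qed
    have e: "h \<otimes> (inv h \<otimes> h1) = h1" "h \<otimes> (inv h \<otimes> h2) = h2" using Hc h hc by auto
    have "q \<in> N (inv h \<otimes> h1) \<or> q \<in> N (inv h \<otimes> h2)"
      using between[OF pc] tr[of x] tr[of "inv h \<otimes> h1"] tr[of "inv h \<otimes> h2"] e q hx(2,3) hc Hc h by auto
    moreover have "inv h \<otimes> h1 \<in> H" "inv h \<otimes> h2 \<in> H"
      using H h hx(1) by (simp_all add: subgroup.m_closed subgroup.m_inv_closed)
    ultimately show "q \<in> (\<Union>r\<in>R. N r)"
      using wall_bound[OF H R(2,3) _ _ hx(2,4) q] by blast
  qed
  moreover have "finite (\<Union>r\<in>R. N r)"
    using R(1,2) Hc by (auto simp: fundamental_reflections_def)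
  ultimately have "len x \<le> card (\<Union>r\<in>R. N r)" unfolding len_def by (rule card_mono[rotated])
  moreover have "inv w \<otimes> h = inv x" using hx(2,3) hc by (simp add: group_word_simps)
  ultimately show ?thesis using hx len_inv by (intro bexI[of _ h]) auto
qed

lemma cayley_adj_iff:
  "cayley_adj G A g h \<longleftrightarrow> g \<in> carrier G \<and> (\<exists>a\<in>A. h = g \<otimes> a)"
proof -
  have "g = h \<otimes> a" if "a \<in> A" "g \<in> carrier G" "h = g \<otimes> a" for g h a
    using that by (simp add: m_assoc gen_square)
  then show ?thesis unfolding cayley_adj_def by auto
qed

lemma cayley_path_len:
  "(cayley_adj G A ^^ n) g h \<Longrightarrow> g \<in> carrier G \<Longrightarrow> h \<in> carrier G \<and> len (inv g \<otimes> h) \<le> n"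
proof (induction n arbitrary: h)
  case (Suc n)
  then obtain k where k: "(cayley_adj G A ^^ n) g k" "cayley_adj G A k h" by auto
  obtain a where a: "a \<in> A" "h = k \<otimes> a" and kc: "k \<in> carrier G"
    using k(2) by (auto simp: cayley_adj_iff)
  have "len (inv g \<otimes> k \<otimes> a) \<le> len (inv g \<otimes> k) + len a"
    using Suc.prems kc a by (intro len_mult_le) auto
  moreover have "len a = 1" using a by (simp add: len_def N_gen)
  ultimately show ?case using Suc.IH[OF k(1)] Suc.prems a kc by (simp add: m_assoc)
qed auto

lemma cayley_path_word:
  "w \<in> lists A \<Longrightarrow> g \<in> carrier G \<Longrightarrow> (cayley_adj G A ^^ length w) g (g \<otimes> word_prod w)"
proof (induction w rule: rev_induct)
  case (snoc a w)
  have "w \<in> lists A" "a \<in> A" using snoc.prems by auto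
  then show ?case
    using snoc.IH snoc.prems by (auto simp: cayley_adj_iff m_assoc intro!: relcomppI)
qed auto

lemma cayley_dist_eq_len:
  assumes "g \<in> carrier G" "h \<in> carrier G"
  shows "cayley_dist G A g h = len (inv g \<otimes> h)"
  unfolding cayley_dist_def
proof (rule Least_equality)
  obtain w where "reduced w" "word_prod w = inv g \<otimes> h" "length w = len (inv g \<otimes> h)"
    using ex_reduced_word assms by (metis inv_closed m_closed)
  then show "(cayley_adj G A ^^ len (inv g \<otimes> h)) g h"
    using cayley_path_word[of w g] assms by (simp add: reduced_def)
qed (use cayley_path_len assms in blast)

lemma successively_relpowp:
  "successively P (x # xs) \<Longrightarrow> (P ^^ length xs) x (last (x # xs))"
proof (induction xs arbitrary: x)
  case (Cons y ys)
  then have "(P ^^ length ys) y (last (y # ys))" "P x y" by auto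
  then show ?case using relpowp_Suc_I2[of P x y] by simp
qed simp

lemma geodesic_between:
  assumes "cayley_geodesic G A p" "w \<in> set p" "q \<in> carrier G"
  shows "(q \<in> N w) = (q \<in> N (hd p)) \<or> (q \<in> N w) = (q \<in> N (last p))"
proof -
  obtain p1 p2 where p: "p = p1 @ w # p2" using assms(2) by (auto simp: in_set_conv_decomp)
  have pc: "set p \<subseteq> carrier G" and succ: "successively (cayley_adj G A) p"
    and len: "length p = Suc (cayley_dist G A (hd p) (last p))"
    using assms(1) by (auto simp: cayley_geodesic_def)
  let ?a = "hd p" and ?b = "last p"
  have c: "?a \<in> carrier G" "?b \<in> carrier G" "w \<in> carrier G"
    using pc p by (auto simp: hd_append)
  have "(cayley_adj G A ^^ length p1) ?a w"
  proof (cases p1)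
    case (Cons y ys)
    have "successively (cayley_adj G A) ((p1 @ [w]) @ p2)" using succ p by simp
    then have "successively (cayley_adj G A) (p1 @ [w])"
      unfolding successively_append_iff[of _ "p1 @ [w]"] by simp
    then have "successively (cayley_adj G A) (y # ys @ [w])"
      using Cons by simp
    then show ?thesis using successively_relpowp[of _ y "ys @ [w]"] p Cons by simp
  qed (simp add: p)
  then have l1: "len (inv ?a \<otimes> w) \<le> length p1" using cayley_path_len c by blast
  have "successively (cayley_adj G A) (w # p2)"
    using succ p by (simp add: successively_append_iff)
  then have "(cayley_adj G A ^^ length p2) w ?b" using successively_relpowp p by fastforce
  then have l2: "len (inv w \<otimes> ?b) \<le> length p2" using cayley_path_len c by blast
  have eq: "(inv ?a \<otimes> w) \<otimes> (inv w \<otimes> ?b) = inv ?a \<otimes> ?b" using c by (simp add: m_assoc)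
  have "len (inv ?a \<otimes> ?b) = length p1 + length p2"
    using len p cayley_dist_eq_len[OF c(1,2)] by simp
  then have "len ((inv ?a \<otimes> w) \<otimes> (inv w \<otimes> ?b)) = len (inv ?a \<otimes> w) + len (inv w \<otimes> ?b)"
    using l1 l2 eq len_mult_le[of "inv ?a \<otimes> w" "inv w \<otimes> ?b"] c by simp
  then have "N (inv ?a \<otimes> w) \<subseteq> N (inv ?a \<otimes> ?b)"
    using N_subset_N_mult[of "inv ?a \<otimes> w" "inv w \<otimes> ?b"] c eq by simp
  moreover have "?a \<otimes> (inv ?a \<otimes> w) = w" "?a \<otimes> (inv ?a \<otimes> ?b) = ?b" using c by auto
  then have "(q \<in> N w) = ((q \<in> N ?a) \<noteq> (inv ?a \<otimes> q \<otimes> ?a \<in> N (inv ?a \<otimes> w)))"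
    "(q \<in> N ?b) = ((q \<in> N ?a) \<noteq> (inv ?a \<otimes> q \<otimes> ?a \<in> N (inv ?a \<otimes> ?b)))"
    using N_mult[of ?a "inv ?a \<otimes> w" q] N_mult[of ?a "inv ?a \<otimes> ?b" q] c assms(3) by simp_all
  ultimately show ?thesis by blast
qed

theorem reflection_subgroup_quasiconvex:
  assumes T: "finite T" "\<And>t. t \<in> T \<Longrightarrow> \<exists>z\<in>carrier G. \<exists>a\<in>A. t = z \<otimes> a \<otimes> inv z"
  shows "quasiconvex G A (generate G T)"
proof -
  let ?H = "generate G T"
  obtain R where R: "finite R" "R \<subseteq> fundamental_reflections ?H" "generate G R = ?H"
    using finite_fundamental_generators[OF T HOL.refl] by blast
  have "T \<subseteq> carrier G" using T(2) by fastforce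
  then have H: "subgroup ?H G" by (rule generate_is_subgroup)
  have Hc: "h \<in> carrier G" if "h \<in> ?H" for h using subgroup.mem_carrier[OF H that] .
  show ?thesis
    unfolding quasiconvex_def
  proof (intro exI allI impI ballI)
    fix p x assume p: "cayley_geodesic G A p \<and> hd p \<in> ?H \<and> last p \<in> ?H" and x: "x \<in> set p"
    then have xc: "x \<in> carrier G" by (auto simp: cayley_geodesic_def)
    show "\<exists>h\<in>?H. cayley_dist G A x h \<le> card (\<Union>r\<in>R. N r)"
      using between_orbit_points[OF H R _ _ xc, of "hd p" "last p"] geodesic_between[of p x] p x
        cayley_dist_eq_len[OF xc] Hc by auto
  qed
qed

end

section \<open>Almost invariant sets in one-ended groups\<close>

context group
begin

lemma finite_right_translate:
  assumes "finite S" "S \<subseteq> carrier G" "x \<in> carrier G"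
  shows "finite {h \<in> carrier G. h \<otimes> x \<in> S}"
proof (rule finite_subset)
  show "{h \<in> carrier G. h \<otimes> x \<in> S} \<subseteq> (\<lambda>k. k \<otimes> inv x) ` S"
  proof
    fix h assume "h \<in> {h \<in> carrier G. h \<otimes> x \<in> S}"
    then have "h = (h \<otimes> x) \<otimes> inv x" "h \<otimes> x \<in> S" using assms(3) by (auto simp: m_assoc)
    then show "h \<in> (\<lambda>k. k \<otimes> inv x) ` S" by blast
  qed
qed (use assms in simp)

lemma almost_invariant_generate:
  fixes \<chi> :: "'a \<Rightarrow> bool"
  assumes "B \<subseteq> carrier G" "\<And>b. b \<in> B \<Longrightarrow> finite {h \<in> carrier G. \<chi> (h \<otimes> b) \<noteq> \<chi> h}"
    and "x \<in> generate G B"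
  shows "finite {h \<in> carrier G. \<chi> (h \<otimes> x) \<noteq> \<chi> h}"
  using assms(3)
proof (induction rule: generate.induct)
  case one
  show ?case by (rule finite_subset[of _ "{}"]) auto
next
  case (incl b)
  then show ?case using assms(2) by simp
next
  case (inv b)
  then have b: "b \<in> carrier G" using assms(1) by auto
  have "{h \<in> carrier G. \<chi> (h \<otimes> inv b) \<noteq> \<chi> h} \<subseteq>
      {h \<in> carrier G. h \<otimes> inv b \<in> {h \<in> carrier G. \<chi> (h \<otimes> b) \<noteq> \<chi> h}}"
    using b by (auto simp: m_assoc)
  then show ?case
    by (rule finite_subset) (rule finite_right_translate, use inv assms(2) b in auto)
next
  case (eng x y)
  then have xy: "x \<in> carrier G" "y \<in> carrier G" using generate_in_carrier[OF assms(1)] by auto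
  have "{h \<in> carrier G. \<chi> (h \<otimes> (x \<otimes> y)) \<noteq> \<chi> h} \<subseteq> {h \<in> carrier G. \<chi> (h \<otimes> x) \<noteq> \<chi> h} \<union>
      {h \<in> carrier G. h \<otimes> x \<in> {h \<in> carrier G. \<chi> (h \<otimes> y) \<noteq> \<chi> h}}"
    using xy by (auto simp: m_assoc)
  moreover have "finite {h \<in> carrier G. h \<otimes> x \<in> {h \<in> carrier G. \<chi> (h \<otimes> y) \<noteq> \<chi> h}}"
    by (rule finite_right_translate) (use eng xy in auto)
  ultimately show ?case using eng.IH(1) by (meson finite_UnI finite_subset)
qed

lemma one_ended_infinite:
  assumes "one_ended G"
  shows "infinite (carrier G)"
proof -
  obtain A where A: "A \<subseteq> carrier G"
    and ends: "\<exists>!C. C \<in> components_outside G A {} \<and> infinite C"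
    using assms unfolding one_ended_def by (metis finite.emptyI)
  obtain C where C: "C \<in> components_outside G A {}" "infinite C" using ends by auto
  have "C \<subseteq> carrier G"
  proof -
    obtain x where x: "x \<in> carrier G" "C = {y. (\<lambda>u v. cayley_adj G A u v \<and> u \<notin> {} \<and> v \<notin> {})\<^sup>*\<^sup>* x y}"
      using C(1) unfolding components_outside_def by auto
    have "(\<lambda>u v. cayley_adj G A u v \<and> u \<notin> {} \<and> v \<notin> {})\<^sup>*\<^sup>* x y \<Longrightarrow> y \<in> carrier G" for y
      by (induction rule: rtranclp_induct) (use x(1) in \<open>auto simp: cayley_adj_def\<close>)
    then show ?thesis using x(2) by blast
  qed
  then show ?thesis using C(2) finite_subset by blast
qed

text \<open>Let \<open>K\<close> be the finite set of ends of Cayley graph edges along which \<open>\<chi>\<close> changes. Outside \<open>K\<close> the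
  value of \<open>\<chi>\<close> is constant on components, and only one component is infinite. Every component has a
  member next to \<open>K\<close>, so there are finitely many of them, and those with the other value of \<open>\<chi>\<close>
  are finite.\<close>

lemma one_ended_almost_invariant:
  fixes \<chi> :: "'a \<Rightarrow> bool"
  assumes "one_ended G"
    and B: "B \<subseteq> carrier G" "generate G B = carrier G"
    and inv: "\<And>b. b \<in> B \<Longrightarrow> finite {h \<in> carrier G. \<chi> (h \<otimes> b) \<noteq> \<chi> h}"
  shows "\<exists>c. finite {h \<in> carrier G. \<chi> h \<noteq> c}"
proof -
  obtain A where A: "finite A" "A \<subseteq> carrier G" "generate G A = carrier G"
    and ends: "\<And>K. finite K \<Longrightarrow> \<exists>!C. C \<in> components_outside G A K \<and> infinite C"
    using assms(1) unfolding one_ended_def by metis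
  have A_inv: "finite {h \<in> carrier G. \<chi> (h \<otimes> x) \<noteq> \<chi> h}" if "x \<in> carrier G" for x
    using almost_invariant_generate[OF B(1) inv] that B(2) by simp
  define K where "K = insert \<one> (\<Union>a\<in>A. {h \<in> carrier G. \<chi> (h \<otimes> a) \<noteq> \<chi> h} \<union>
    {h \<in> carrier G. \<chi> (h \<otimes> inv a) \<noteq> \<chi> h})"
  have finK: "finite K" using A A_inv by (auto simp: K_def)
  \<comment> \<open>The element \<open>\<one>\<close> is put into \<open>K\<close> so that every path to \<open>\<one>\<close> runs into \<open>K\<close>.\<close>
  let ?adj = "\<lambda>u v. cayley_adj G A u v \<and> u \<notin> K \<and> v \<notin> K"
  define comp where "comp x = {y. ?adj\<^sup>*\<^sup>* x y}" for x
  have comps: "components_outside G A K = comp ` (carrier G - K)"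
    by (simp add: components_outside_def comp_def)
  have step: "\<chi> v = \<chi> u" if "?adj u v" for u v
  proof -
    have uc: "u \<in> carrier G" "v \<in> carrier G" "u \<notin> K" using that by (auto simp: cayley_adj_def)
    obtain a where a: "a \<in> A" "v = u \<otimes> a \<or> u = v \<otimes> a"
      using \<open>?adj u v\<close> unfolding cayley_adj_def by blast
    have "v = u \<otimes> a \<or> v = u \<otimes> inv a" using a A(2) uc by (auto simp: m_assoc)
    then show ?thesis using a(1) uc unfolding K_def by auto
  qed
  have const: "y \<in> carrier G \<and> \<chi> y = \<chi> x" if "y \<in> comp x" "x \<in> carrier G" for x y
  proof -
    have "?adj\<^sup>*\<^sup>* x y" using that by (simp add: comp_def)
    then show ?thesis
      by (induction rule: rtranclp_induct) (use that step in \<open>auto simp: cayley_adj_def\<close>)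
  qed
  have ex1: "\<exists>!C. C \<in> comp ` (carrier G - K) \<and> infinite C" using ends[OF finK] comps by simp
  then obtain x0 where x0: "x0 \<in> carrier G - K" "infinite (comp x0)" by auto
  have other: "finite (comp x)" if "x \<in> carrier G - K" "\<chi> x \<noteq> \<chi> x0" for x
  proof (rule ccontr)
    assume "infinite (comp x)"
    then have "comp x = comp x0" using ex1 that(1) x0 by blast
    moreover have "x \<in> comp x" by (simp add: comp_def)
    ultimately show False using const[of x x0] x0 that(2) by blast
  qed
  define Nb where "Nb = (\<Union>a\<in>A. (\<lambda>k. k \<otimes> a) ` (K \<inter> carrier G) \<union> (\<lambda>k. k \<otimes> inv a) ` (K \<inter> carrier G))"
  have finNb: "finite Nb" using A finK by (auto simp: Nb_def)
  \<comment> \<open>The set \<open>Z\<close> consists of \<open>K\<close> and the components next to it; it is shown to be everything.\<close>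
  define Z where "Z = (K \<inter> carrier G) \<union> (\<Union>x\<in>Nb - K. comp x)"
  have NbC: "Nb \<subseteq> carrier G" using A(2) by (auto simp: Nb_def)
  have ZC: "Z \<subseteq> carrier G" using const NbC by (fastforce simp: Z_def)
  have Zstep: "z \<otimes> e \<in> Z" if z: "z \<in> Z" and e: "a \<in> A" "e = a \<or> e = inv a" for z e a
  proof -
    have ac: "a \<in> carrier G" using A(2) e(1) by auto
    have zc: "z \<in> carrier G" using ZC z by auto
    have ec: "e \<in> carrier G" using ac e(2) by auto
    show ?thesis
    proof (cases "z \<otimes> e \<in> K")
      case True
      then show ?thesis using zc ec by (simp add: Z_def)
    next
      case False
      show ?thesis
      proof (cases "z \<in> K")
        case True
        then have "z \<otimes> e \<in> Nb" using zc e by (auto simp: Nb_def)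
        moreover have "z \<otimes> e \<in> comp (z \<otimes> e)" by (simp add: comp_def)
        ultimately show ?thesis using False by (auto simp: Z_def)
      next
        case zK: False
        then obtain x where x: "x \<in> Nb - K" "z \<in> comp x" using z by (auto simp: Z_def)
        have "z = z \<otimes> e \<otimes> a \<or> z \<otimes> e = z \<otimes> a" using e(2) ac zc by (auto simp: m_assoc)
        then have "cayley_adj G A z (z \<otimes> e)"
          using zc ec e(1) unfolding cayley_adj_def by auto
        then have "?adj z (z \<otimes> e)" using zK False by simp
        then have "z \<otimes> e \<in> comp x" using x(2) unfolding comp_def
          by (auto intro: rtranclp.rtrancl_into_rtrancl)
        then show ?thesis using x(1) by (auto simp: Z_def)
      qed
    qed
  qed
  have "\<forall>z\<in>Z. z \<otimes> h \<in> Z" if "h \<in> generate G A" for h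
    using that
  proof (induction rule: generate.induct)
    case one
    then show ?case using ZC by auto
  next
    case (eng x y)
    then have "x \<in> carrier G" "y \<in> carrier G" using generate_in_carrier[OF A(2)] by auto
    then show ?case using eng.IH ZC by (metis m_assoc subsetD)
  qed (use Zstep in blast)+
  moreover have "\<one> \<in> Z" by (simp add: Z_def K_def)
  ultimately have "carrier G \<subseteq> Z" using A(3) by fastforce
  moreover have "{h \<in> Z. \<chi> h \<noteq> \<chi> x0} \<subseteq> K \<union> (\<Union>x\<in>{x \<in> Nb - K. \<chi> x \<noteq> \<chi> x0}. comp x)"
    using const NbC by (fastforce simp: Z_def)
  moreover have "finite (K \<union> (\<Union>x\<in>{x \<in> Nb - K. \<chi> x \<noteq> \<chi> x0}. comp x))"
    using finK finNb other NbC by auto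
  ultimately have "finite {h \<in> carrier G. \<chi> h \<noteq> \<chi> x0}"
    by (elim finite_subset[rotated]) blast
  then show ?thesis by blast
qed

end

section \<open>Splittings over finite subgroups\<close>

lemma even_card_involution:
  assumes "finite X" "\<And>x. x \<in> X \<Longrightarrow> f x \<in> X" "\<And>x. x \<in> X \<Longrightarrow> f (f x) = x" "\<And>x. x \<in> X \<Longrightarrow> f x \<noteq> x"
  shows "even (card X)"
  using assms
proof (induction "card X" arbitrary: X rule: less_induct)
  case less
  show ?case
  proof (cases "X = {}")
    case False
    then obtain x where x: "x \<in> X" by blast
    let ?Y = "X - {x, f x}"
    have cX: "card X = card ?Y + 2"
    proof -
      have "card {x, f x} = 2" using less.prems(4)[OF x] by (simp add: card_insert_if)
      moreover have "{x, f x} \<subseteq> X" using x less.prems(2) by blast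
      moreover have "card {x, f x} \<le> card X" using calculation(2) less.prems(1) card_mono by blast
      ultimately show ?thesis using less.prems(1) by (simp add: card_Diff_subset)
    qed
    have "f y \<in> ?Y" if "y \<in> ?Y" for y
      using that less.prems(2,3) x by (metis Diff_iff insertCI insertE singletonD)
    then have "even (card ?Y)"
      using less.hyps[of ?Y] cX less.prems by auto
    then show ?thesis using cX by simp
  qed simp
qed

context group
begin

text \<open>Here \<open>\<chi>\<close> is the indicator of a half-space: for \<open>K\<close> a union of left cosets of the subgroup
  generated by the members of \<open>B\<close> that commute with \<open>a\<close>, it cuts exactly the Cayley graph edges with
  label \<open>a\<close> that lie in \<open>K\<close>. For a group with Coxeter generators \<open>B\<close> this expresses the decomposition as
  an amalgam of the subgroup generated by \<open>B - {a}\<close> and the subgroup generated by \<open>a\<close> and its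
  commuting generators.\<close>

definition splits_along :: "'a set \<Rightarrow> 'a \<Rightarrow> bool" where
  "splits_along B a \<longleftrightarrow> (\<forall>K \<subseteq> carrier G.
     (\<forall>b\<in>B. b \<otimes> a = a \<otimes> b \<longrightarrow> (\<forall>k\<in>K. k \<otimes> b \<in> K)) \<longrightarrow>
     (\<exists>\<chi>. \<forall>h\<in>carrier G. \<forall>b\<in>B. \<chi> (h \<otimes> b) \<longleftrightarrow> \<chi> h \<noteq> (b = a \<and> h \<in> K)))"

lemma infinite_of_infinite_order:
  assumes "x \<in> F" "F \<subseteq> carrier G" "z \<in> carrier G" "\<And>h. h \<in> F \<Longrightarrow> h \<otimes> z \<in> F"
    and "\<And>n. n > 0 \<Longrightarrow> z [^] (n::nat) \<noteq> \<one>"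
  shows "infinite F"
proof -
  have xc: "x \<in> carrier G" using assms by auto
  have mem: "x \<otimes> z [^] (n::nat) \<in> F" for n
  proof (induction n)
    case (Suc n)
    then have "x \<otimes> z [^] n \<otimes> z \<in> F" using assms(4) by blast
    then show ?case using xc assms(3) by (simp add: m_assoc)
  qed (use assms xc in simp)
  have inj: "inj (\<lambda>n::nat. x \<otimes> z [^] n)"
  proof (rule linorder_injI)
    fix m n :: nat assume mn: "m < n"
    then obtain d where d: "n = m + d" "d > 0" using less_imp_add_positive by blast
    show "x \<otimes> z [^] m \<noteq> x \<otimes> z [^] n"
    proof
      assume "x \<otimes> z [^] m = x \<otimes> z [^] n"
      then have "z [^] m \<otimes> \<one> = z [^] m \<otimes> z [^] d"
        using xc assms(3) d(1) by (simp flip: nat_pow_mult)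
      then have "z [^] d = \<one>" using assms(3) by simp
      then show False using assms(5)[OF d(2)] by simp
    qed
  qed
  then have "infinite (range (\<lambda>n::nat. x \<otimes> z [^] n))" using range_inj_infinite by blast
  then show ?thesis using mem finite_subset[of "range (\<lambda>n::nat. x \<otimes> z [^] n)" F] by blast
qed

text \<open>Let \<open>C\<close> be generated by the members of \<open>B - {a}\<close> that commute with \<open>a\<close>, a finite group if the
  centralizer of \<open>a\<close> is finite. The half-space with boundary \<open>K = C \<union> C a\<close>, or its complement, is a
  finite set \<open>F\<close>, invariant under right multiplication by \<open>B - {a}\<close>. There is \<open>b \<in> B - {a}\<close> outside
  \<open>C\<close>, as otherwise the group is \<open>K\<close>. If \<open>b\<close> fails to commute with some generator \<open>l\<close> of \<open>C\<close>, then
  \<open>b \<otimes> l\<close> has infinite order and \<open>F\<close> is infinite. If \<open>b\<close> commutes with \<open>C\<close>, it acts without fixed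
  points on the cosets of \<open>C\<close> in \<open>F\<close>, so their number is even; but \<open>a\<close> acts without fixed points on
  those outside \<open>K\<close>, and exactly one of the two cosets in \<open>K\<close> lies in \<open>F\<close>, so their number is odd.\<close>

lemma one_ended_not_splits:
  assumes one: "one_ended G"
    and B: "B \<subseteq> carrier G" "generate G B = carrier G" "\<And>b. b \<in> B \<Longrightarrow> b \<otimes> b = \<one>"
    and tor: "\<And>b c n. b \<in> B \<Longrightarrow> c \<in> B \<Longrightarrow> n > 0 \<Longrightarrow> (b \<otimes> c) [^] (n::nat) = \<one> \<Longrightarrow> b \<otimes> c = c \<otimes> b"
    and a: "a \<in> B" "splits_along B a"
  shows "infinite {c \<in> carrier G. c \<otimes> a = a \<otimes> c}"
proof
  assume cent: "finite {c \<in> carrier G. c \<otimes> a = a \<otimes> c}"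
  define L where "L = {b \<in> B - {a}. b \<otimes> a = a \<otimes> b}"
  define C where "C = generate G L"
  have Lc: "L \<subseteq> carrier G" and ac: "a \<in> carrier G" using B(1) a(1) by (auto simp: L_def)
  have aa: "a \<otimes> a = \<one>" using B(3) a(1) by blast
  have aac: "g \<otimes> a \<otimes> a = g" if "g \<in> carrier G" for g using that ac aa by (simp add: m_assoc)
  have C: "subgroup C G" unfolding C_def using Lc by (rule generate_is_subgroup)
  have Cc: "c \<in> carrier G" if "c \<in> C" for c using subgroup.mem_carrier[OF C that] .
  have Ca: "c \<otimes> a = a \<otimes> c" if "c \<in> C" for c
    using generate_commute[OF ac Lc _ that[unfolded C_def]] by (auto simp: L_def)
  have finC: "finite C"
    by (rule finite_subset[OF _ cent]) (use Cc Ca in auto)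
  have LC: "L \<subseteq> C" unfolding C_def using generate.incl by fast
  define K where "K = {h \<in> carrier G. h \<in> C \<or> h \<otimes> a \<in> C}"
  have K_a: "k \<otimes> a \<in> K" if "k \<in> K" for k
    using that ac by (auto simp: K_def aac)
  have K_C: "k \<otimes> c \<in> K" if "k \<in> K" "c \<in> C" for k c
  proof -
    have kc: "k \<in> carrier G" "c \<in> carrier G" using that Cc by (auto simp: K_def)
    then have "k \<otimes> c \<otimes> a = k \<otimes> a \<otimes> c" using ac Ca[OF that(2)] by (simp add: m_assoc)
    then show ?thesis using that kc subgroup.m_closed[OF C] by (auto simp: K_def)
  qed
  have "K \<subseteq> carrier G" by (auto simp: K_def)
  moreover have "\<forall>b\<in>B. b \<otimes> a = a \<otimes> b \<longrightarrow> (\<forall>k\<in>K. k \<otimes> b \<in> K)"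
  proof (intro ballI impI)
    fix b k assume "b \<in> B" "b \<otimes> a = a \<otimes> b" "k \<in> K"
    then show "k \<otimes> b \<in> K" using K_a K_C LC by (cases "b = a") (auto simp: L_def)
  qed
  ultimately obtain \<chi> where \<chi>: "\<And>h b. h \<in> carrier G \<Longrightarrow> b \<in> B \<Longrightarrow>
      \<chi> (h \<otimes> b) \<longleftrightarrow> \<chi> h \<noteq> (b = a \<and> h \<in> K)"
    using a(2) unfolding splits_along_def by metis
  have finK: "finite K"
  proof -
    have "K \<subseteq> C \<union> {h \<in> carrier G. h \<otimes> a \<in> C}" by (auto simp: K_def)
    then show ?thesis using finC finite_right_translate[OF finC _ ac] Cc
      by (meson finite_UnI finite_subset subsetI)
  qed
  have "finite {h \<in> carrier G. \<chi> (h \<otimes> b) \<noteq> \<chi> h}" if "b \<in> B" for b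
    by (rule finite_subset[OF _ finK]) (use \<chi> that in auto)
  then obtain e where e: "finite {h \<in> carrier G. \<chi> h \<noteq> e}"
    using one_ended_almost_invariant[OF one B(1,2)] by blast
  define F where "F = {h \<in> carrier G. \<chi> h \<noteq> e}"
  have finF: "finite F" and Fc: "F \<subseteq> carrier G" using e by (auto simp: F_def)
  have Fb: "h \<otimes> b \<in> F \<longleftrightarrow> h \<in> F" if "h \<in> carrier G" "b \<in> B" "b \<noteq> a" for h b
    using \<chi>[OF that(1,2)] that B(1) by (auto simp: F_def)
  have Fa: "(h \<otimes> a \<in> F) \<noteq> (h \<in> F) \<longleftrightarrow> h \<in> K" if "h \<in> carrier G" for h
    using \<chi>[OF that a(1)] that ac by (auto simp: F_def)
  have FC: "h \<otimes> c \<in> F \<longleftrightarrow> h \<in> F" if "h \<in> carrier G" "c \<in> C" for h c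
    using that(2,1) unfolding C_def
  proof (induction arbitrary: h rule: generate.induct)
    case (incl b)
    then show ?case using Fb by (auto simp: L_def)
  next
    case (inv b)
    then have "b \<in> B" "b \<noteq> a" "b \<in> carrier G" using B(1) by (auto simp: L_def)
    then show ?case using Fb[of "h \<otimes> inv b" b] inv by (simp add: m_assoc)
  next
    case (eng x y)
    then have "x \<in> carrier G" "y \<in> carrier G" using generate_in_carrier[OF Lc] by auto
    then show ?case using eng.IH(1)[of h] eng.IH(2)[of "h \<otimes> x"] eng.prems by (simp add: m_assoc)
  qed simp
  have oneK: "\<one> \<in> K" using subgroup.one_closed[OF C] by (simp add: K_def)
  then have a_F: "(a \<in> F) \<noteq> (\<one> \<in> F)" using Fa[of \<one>] ac by simp
  \<comment> \<open>Otherwise \<open>F\<close> would be invariant under \<open>a\<close> and \<open>K\<close> empty.\<close>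
  have aC: "a \<notin> C" using FC[of \<one> a] a_F ac by auto
  have "\<exists>b\<in>B. b \<noteq> a \<and> b \<notin> C"
  proof (rule ccontr)
    assume "\<not> ?thesis"
    then have BC: "b = a \<or> b \<in> C" if "b \<in> B" for b using that by blast
    have "\<forall>k\<in>K. k \<otimes> h \<in> K" if "h \<in> generate G B" for h
      using that
    proof (induction rule: generate.induct)
      case one
      then show ?case by (auto simp: K_def)
    next
      case (incl b)
      then show ?case using BC K_a K_C by blast
    next
      case (inv b)
      then have "inv b = b" using B(1,3) by (auto intro!: inv_equality)
      then show ?case using inv BC K_a K_C by metis
    next
      case (eng x y)
      then have "x \<in> carrier G" "y \<in> carrier G" using generate_in_carrier[OF B(1)] by auto
      then show ?case using eng.IH by (auto simp: K_def m_assoc[symmetric])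
    qed
    then have "carrier G \<subseteq> K" using oneK B(2) by fastforce
    then show False using one_ended_infinite[OF one] finK finite_subset by blast
  qed
  then obtain b where b: "b \<in> B" "b \<noteq> a" "b \<notin> C" by blast
  have bc: "b \<in> carrier G" and bb: "b \<otimes> b = \<one>" using b B by auto
  have bbc: "g \<otimes> b \<otimes> b = g" if "g \<in> carrier G" for g using that bc bb by (simp add: m_assoc)
  show False
  proof (cases "\<forall>l\<in>L. b \<otimes> l = l \<otimes> b")
    case False
    then obtain l where l: "l \<in> L" "b \<otimes> l \<noteq> l \<otimes> b" by blast
    then have lB: "l \<in> B" "l \<noteq> a" "l \<in> carrier G" using Lc by (auto simp: L_def)
    have "F \<noteq> {}" using a_F by auto
    then obtain x where x: "x \<in> F" by blast
    have "infinite F"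
    proof (rule infinite_of_infinite_order[OF x Fc])
      show "b \<otimes> l \<in> carrier G" using bc lB by simp
      show "h \<otimes> (b \<otimes> l) \<in> F" if "h \<in> F" for h
        using that Fb[of h b] Fb[of "h \<otimes> b" l] b lB bc Fc by (auto simp: m_assoc[symmetric])
      show "(b \<otimes> l) [^] n \<noteq> \<one>" if "n > 0" for n :: nat
        using tor[OF b(1) lB(1) that] l(2) by blast
    qed
    then show False using finF by blast
  next
    case True
    have Cb: "c \<otimes> b = b \<otimes> c" if "c \<in> C" for c
      using generate_commute[OF bc Lc _ that[unfolded C_def]] True by auto
    define cos where "cos h = (\<lambda>c. h \<otimes> c) ` C" for h
    have cos_eq: "cos h = cos k \<longleftrightarrow> inv h \<otimes> k \<in> C" if hk: "h \<in> carrier G" "k \<in> carrier G" for h k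
    proof
      assume "cos h = cos k"
      moreover have "k \<in> cos k" unfolding cos_def
        using hk subgroup.one_closed[OF C] by (intro image_eqI[of _ _ \<one>]) auto
      ultimately obtain c where "c \<in> C" "k = h \<otimes> c" by (auto simp: cos_def)
      then show "inv h \<otimes> k \<in> C" using hk Cc by simp
    next
      assume c: "inv h \<otimes> k \<in> C"
      have sub: "cos k \<subseteq> cos h" if hk: "h \<in> carrier G" "k \<in> carrier G" "inv h \<otimes> k \<in> C" for h k
      proof
        fix x assume "x \<in> cos k"
        then obtain d where d: "d \<in> C" "x = k \<otimes> d" by (auto simp: cos_def)
        then have "x = h \<otimes> (inv h \<otimes> k \<otimes> d)" using hk Cc by (simp add: m_assoc)
        moreover have "inv h \<otimes> k \<otimes> d \<in> C" using hk(3) d(1) subgroup.m_closed[OF C] by blast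
        ultimately show "x \<in> cos h" unfolding cos_def by blast
      qed
      have "inv k \<otimes> h = inv (inv h \<otimes> k)" using hk by (simp add: inv_mult_group)
      then have "inv k \<otimes> h \<in> C" using c subgroup.m_inv_closed[OF C] by simp
      then show "cos h = cos k" using sub[OF hk c] sub[OF hk(2,1)] by blast
    qed
    have parity: "even (card (cos ` X))"
      if X: "X \<subseteq> carrier G" "finite X" and s: "s \<in> carrier G" "s \<otimes> s = \<one>" "s \<notin> C"
        "\<And>c. c \<in> C \<Longrightarrow> c \<otimes> s = s \<otimes> c" and closed: "\<And>x. x \<in> X \<Longrightarrow> x \<otimes> s \<in> X" for X s
    proof -
      define f where "f P = (\<lambda>h. h \<otimes> s) ` P" for P
      have f: "f (cos x) = cos (x \<otimes> s)" if "x \<in> carrier G" for x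
      proof -
        have "x \<otimes> c \<otimes> s = x \<otimes> s \<otimes> c" if "c \<in> C" for c
          using s(1) s(4)[OF that] Cc[OF that] \<open>x \<in> carrier G\<close> by (simp add: m_assoc)
        then show ?thesis unfolding f_def cos_def image_image by (intro image_cong) auto
      qed
      have ss: "x \<otimes> s \<otimes> s = x" if "x \<in> carrier G" for x using that s(1,2) by (simp add: m_assoc)
      show ?thesis
      proof (rule even_card_involution[of _ f])
        show "finite (cos ` X)" using X by simp
        show "f P \<in> cos ` X" if "P \<in> cos ` X" for P using that f closed X(1) by auto
        show "f (f P) = P" if "P \<in> cos ` X" for P
          using that f closed X(1) s(1) ss by auto
        show "f P \<noteq> P" if "P \<in> cos ` X" for P
        proof -
          obtain x where x: "x \<in> X" "P = cos x" using \<open>P \<in> cos ` X\<close> by blast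
          then have xc: "x \<in> carrier G" using X(1) by auto
          have "inv x \<otimes> (x \<otimes> s) = s" using xc s(1) by simp
          then show ?thesis using cos_eq[OF xc, of "x \<otimes> s"] f[OF xc] x(2) xc s(1,3) by auto
        qed
      qed
    qed
    \<comment> \<open>The number of cosets in \<open>F\<close> is even because of \<open>b\<close>, and odd because of \<open>a\<close>.\<close>
    have even1: "even (card (cos ` F))"
      using parity[OF Fc finF bc bb b(3) Cb] Fb[OF _ b(1,2)] Fc by blast
    have FK: "x \<otimes> a \<in> F - K" if "x \<in> F - K" for x
    proof -
      have xc: "x \<in> carrier G" using that Fc by auto
      have "x \<otimes> a \<in> F" using Fa[OF xc] that by auto
      moreover have "x \<otimes> a \<notin> K" using K_a[of "x \<otimes> a"] aac[OF xc] that by auto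
      ultimately show ?thesis by blast
    qed
    have even2: "even (card (cos ` (F - K)))"
      using parity[of "F - K" a] Fc finF ac aa aC Ca FK by blast
    \<comment> \<open>The representative of the only coset of \<open>C\<close> in \<open>K\<close> that lies in \<open>F\<close>.\<close>
    define u where "u = (if \<one> \<in> F then \<one> else a)"
    have u: "u \<in> F" "u \<in> K" "u \<in> carrier G"
      using a_F oneK ac K_a[OF oneK] by (auto simp: u_def)
    have FKu: "cos x = cos u" if x: "x \<in> F \<inter> K" for x
    proof -
      have xc: "x \<in> carrier G" using x Fc by auto
      have "inv u \<otimes> x \<in> C"
      proof (cases "\<one> \<in> F")
        case True
        have "x \<in> C"
        proof (rule ccontr)
          assume "x \<notin> C"
          then have xa: "x \<otimes> a \<in> C" using x by (auto simp: K_def)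
          then have "inv (x \<otimes> a) \<in> C" using subgroup.m_inv_closed[OF C] by blast
          then have "x \<otimes> a \<otimes> inv (x \<otimes> a) \<in> F \<longleftrightarrow> x \<otimes> a \<in> F"
            using FC xc ac by blast
          then have "x \<otimes> a \<in> F" using True xc ac by simp
          then show False using Fa[OF xc] x by blast
        qed
        then show ?thesis using True xc by (simp add: u_def)
      next
        case False
        then have "x \<notin> C" using FC[of \<one> x] x xc by auto
        then have xa: "x \<otimes> a \<in> C" using x by (auto simp: K_def)
        have "inv a = a" using ac aa by (simp add: inv_equality)
        moreover have "a \<otimes> x = x \<otimes> a"
        proof -
          have "a \<otimes> x = a \<otimes> (x \<otimes> a) \<otimes> a" using xc ac aa by (simp add: m_assoc)
          also have "\<dots> = x \<otimes> a \<otimes> a \<otimes> a" using Ca[OF xa] by simp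
          also have "\<dots> = x \<otimes> a" using aac[OF xc] by simp
          finally show ?thesis .
        qed
        ultimately show ?thesis using False xa by (simp add: u_def)
      qed
      then show ?thesis using cos_eq[OF u(3) xc] by simp
    qed
    have split: "cos ` F = insert (cos u) (cos ` (F - K))"
    proof -
      have "cos ` F = cos ` (F \<inter> K) \<union> cos ` (F - K)" by blast
      moreover have "cos ` (F \<inter> K) = {cos u}"
      proof
        show "cos ` (F \<inter> K) \<subseteq> {cos u}" by (rule image_subsetI) (simp add: FKu)
        show "{cos u} \<subseteq> cos ` (F \<inter> K)" using u(1,2) by simp
      qed
      ultimately show ?thesis by simp
    qed
    have "cos u \<notin> cos ` (F - K)"
    proof
      assume "cos u \<in> cos ` (F - K)"
      then obtain x where x: "x \<in> F - K" "cos u = cos x" by auto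
      then have "inv u \<otimes> x \<in> C" using cos_eq[OF u(3), of x] Fc by auto
      then have "u \<otimes> (inv u \<otimes> x) \<in> K" using K_C u(2) by blast
      moreover have "u \<otimes> (inv u \<otimes> x) = x" using x(1) Fc u(3) by auto
      ultimately show False using x(1) by simp
    qed
    then have "card (cos ` F) = Suc (card (cos ` (F - K)))"
      unfolding split using finF by simp
    then show False using even1 even2 by simp
  qed
qed

end

section \<open>Half-spaces in Coxeter groups\<close>

lemma fold_replicate_pairs:
  assumes "\<And>h e. h \<in> A \<Longrightarrow> F t (F s (h, e)) = (f h, e \<noteq> (d \<and> h \<in> K))"
    and "\<And>h. h \<in> A \<Longrightarrow> f h \<in> A" "\<And>h. d \<Longrightarrow> h \<in> A \<Longrightarrow> f h \<in> K \<longleftrightarrow> h \<in> K" "h \<in> A"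
  shows "fold F (concat (replicate n [s, t])) (h, e) = ((f ^^ n) h, e \<noteq> (odd n \<and> d \<and> h \<in> K))"
  using assms(4)
proof (induction n arbitrary: h e)
  case (Suc n)
  have "fold F (concat (replicate (Suc n) [s, t])) (h, e) =
      fold F (concat (replicate n [s, t])) (f h, e \<noteq> (d \<and> h \<in> K))"
    using assms(1)[OF Suc.prems] by simp
  also have "\<dots> = ((f ^^ n) (f h), (e \<noteq> (d \<and> h \<in> K)) \<noteq> (odd n \<and> d \<and> f h \<in> K))"
    using Suc assms(2) by blast
  also have "\<dots> = ((f ^^ Suc n) h, e \<noteq> (odd (Suc n) \<and> d \<and> h \<in> K))"
    using assms(3)[OF _ Suc.prems] by (auto simp: funpow_swap1)
  finally show ?case .
qed simp

text \<open>The half-space for \<open>a\<close> and \<open>K\<close> is obtained by letting the group act on pairs of an element and a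
  sign: every generator equal to \<open>a\<close> flips the sign over \<open>K\<close>. The relation \<open>(s t)^n\<close> is
  respected because the torsion hypothesis makes \<open>s\<close> and \<open>t\<close> commute. If exactly one of them equals
  \<open>a\<close>, the sign flips \<open>n\<close> times or never, and \<open>n\<close> is even because \<open>s\<close> and \<open>t\<close> differ. Distinct
  letters of the presentation may define the same element; only the elements matter here.\<close>

lemma (in group) coxeter_generators:
  fixes S :: "'s set"
  assumes m: "coxeter_matrix S m" and iso: "G \<cong> coxeter_group S m"
    and tor: "\<And>h n. h \<in> carrier G \<Longrightarrow> n > 0 \<Longrightarrow> h [^] (n::nat) = \<one> \<Longrightarrow> h \<otimes> h = \<one>"
  obtains g where "g ` S \<subseteq> carrier G" "generate G (g ` S) = carrier G"
    "\<And>b. b \<in> g ` S \<Longrightarrow> b \<otimes> b = \<one>" "\<And>a. a \<in> g ` S \<Longrightarrow> splits_along (g ` S) a"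
proof -
  define Rel :: "('s word \<times> 's word) set" where "Rel = {(concat (replicate n [(s, True), (t, True)]), []) | s t n.
          s \<in> S \<and> t \<in> S \<and> m s t = enat n}"
  let ?C = "presented_group S Rel"
  have C: "coxeter_group S m = ?C" by (simp add: coxeter_group_def Rel_def)
  interpret C: group ?C by (rule group_presented_group)
  obtain \<phi> where \<phi>: "\<phi> \<in> iso G ?C" using iso C by (auto simp: is_iso_def)
  define \<psi> where "\<psi> = inv_into (carrier G) \<phi>"
  have \<psi>: "\<psi> \<in> iso ?C G" unfolding \<psi>_def using \<phi> by (rule iso_set_sym)
  interpret \<phi>: group_hom G ?C \<phi>
    using \<phi> by unfold_locales (simp add: iso_def)
  interpret \<psi>: group_hom ?C G \<psi>
    using \<psi> by unfold_locales (simp add: iso_def)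
  have \<phi>\<psi>: "\<phi> (\<psi> c) = c" if "c \<in> carrier ?C" for c
    using \<phi> that unfolding \<psi>_def iso_def bij_betw_def by (simp add: f_inv_into_f)
  define \<iota> where "\<iota> s = word_class S Rel [(s, True)]" for s
  have wc: "word_class S Rel u \<in> carrier ?C" if "u \<in> words_over S" for u
    using that by (simp add: presented_group_def)
  have \<iota>: "\<iota> s \<in> carrier ?C" if "s \<in> S" for s using that wc by (simp add: \<iota>_def)
  define g where "g s = \<psi> (\<iota> s)" for s
  have gc: "g s \<in> carrier G" if "s \<in> S" for s using \<iota> that by (simp add: g_def)
  have pow: "\<psi> (word_class S Rel (concat (replicate n [(s, True), (t, True)]))) = (g s \<otimes> g t) [^] n"
    if "s \<in> S" "t \<in> S" for s t and n :: nat
  proof (induction n)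
    case 0
    have "word_class S Rel [] = \<one>\<^bsub>?C\<^esub>" by (simp add: presented_group_def)
    then show ?case by simp
  next
    case (Suc n)
    let ?w = "concat (replicate n [(s, True), (t, True)])"
    have w: "?w \<in> words_over S" using that by (induction n) auto
    have "word_class S Rel ([(s, True)] @ [(t, True)] @ ?w) =
        \<iota> s \<otimes>\<^bsub>?C\<^esub> (\<iota> t \<otimes>\<^bsub>?C\<^esub> word_class S Rel ?w)"
      using that w unfolding \<iota>_def by (simp add: mult_word_class)
    then have "\<psi> (word_class S Rel (concat (replicate (Suc n) [(s, True), (t, True)]))) =
        g s \<otimes> (g t \<otimes> (g s \<otimes> g t) [^] n)"
      using Suc \<iota> that wc w by (simp add: g_def)
    then show ?case
      using gc that nat_pow_Suc2[of "g s \<otimes> g t" n] by (simp add: m_assoc del: nat_pow_Suc)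
  qed
  have rel: "(g s \<otimes> g t) [^] n = \<one>" if "s \<in> S" "t \<in> S" "m s t = enat n" for s t n
  proof -
    let ?w = "concat (replicate n [(s, True), (t, True)])"
    have w: "?w \<in> words_over S" using that(1,2) by (induction n) auto
    have "(?w, []) \<in> Rel" using that by (auto simp: Rel_def)
    then have "word_eq S Rel ?w []" using w by (intro word_eq.relation) auto
    then have "word_class S Rel ?w = \<one>\<^bsub>?C\<^esub>"
      using w by (simp add: presented_group_def word_class_eq_iff)
    then show ?thesis using pow[OF that(1,2), of n] by simp
  qed
  have sq: "g s \<otimes> g s = \<one>" if "s \<in> S" for s
    using rel[OF that that, of 1] m that gc by (simp add: coxeter_matrix_def one_enat_def)
  have comm: "g s \<otimes> g t = g t \<otimes> g s" "n > 0" "odd n \<Longrightarrow> g s = g t"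
    if st: "s \<in> S" "t \<in> S" "m s t = enat n" for s t n
  proof -
    have gs: "g s \<in> carrier G" "g t \<in> carrier G" using gc st by auto
    have "2 \<le> m s t \<or> m s t = 1" using m st(1,2) unfolding coxeter_matrix_def by metis
    then show n: "n > 0" using st(3) by (cases n) (auto simp: enat_0 enat_0_iff)
    have "(g s \<otimes> g t) \<otimes> (g s \<otimes> g t) = \<one>" using tor[OF _ n rel[OF st]] gs by simp
    then show "g s \<otimes> g t = g t \<otimes> g s" using involutions_commute gs sq st by blast
    assume "odd n"
    then obtain k where k: "n = 2 * k + 1" by (auto elim: oddE)
    have "(g s \<otimes> g t) [^] (2 * k) = ((g s \<otimes> g t) [^] (2::nat)) [^] k"
      using gs by (simp add: nat_pow_pow)
    also have "(g s \<otimes> g t) [^] (2::nat) = \<one>"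
      using \<open>(g s \<otimes> g t) \<otimes> (g s \<otimes> g t) = \<one>\<close> gs by (simp add: numeral_2_eq_2)
    finally have "g s \<otimes> g t = \<one>" using rel[OF st] k gs by (simp flip: nat_pow_mult)
    then have "inv (g t) = g s" using gs by (intro inv_equality)
    then show "g s = g t" using inv_equality[OF sq[OF st(2)]] gs by simp
  qed
  have gen: "generate G (g ` S) = carrier G"
  proof -
    have "generate G (\<psi> ` \<iota> ` S) = \<psi> ` generate ?C (\<iota> ` S)"
      using \<psi>.generate_img[of "\<iota> ` S"] \<iota> by auto
    also have "generate ?C (\<iota> ` S) = carrier ?C"
      using generate_presented_group[of S Rel] by (simp add: \<iota>_def)
    also have "\<psi> ` carrier ?C = carrier G" using \<psi> by (simp add: iso_def bij_betw_def)
    finally show ?thesis by (simp add: g_def image_image)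
  qed
  have "splits_along (g ` S) a" if a: "a \<in> g ` S" for a
    unfolding splits_along_def
  proof (intro allI impI)
    fix K assume K: "K \<subseteq> carrier G" "\<forall>b\<in>g ` S. b \<otimes> a = a \<otimes> b \<longrightarrow> (\<forall>k\<in>K. k \<otimes> b \<in> K)"
    have Kst: "h \<otimes> g s \<in> K \<longleftrightarrow> h \<in> K" if "h \<in> carrier G" "s \<in> S" "g s \<otimes> a = a \<otimes> g s" for h s
    proof -
      have "h \<otimes> g s \<otimes> g s = h" using that gc sq by (simp add: m_assoc)
      then show ?thesis using K(2) that by (metis imageI)
    qed
    define F where "F = (\<lambda>(x, b :: bool) (h, e). (h \<otimes> g x, e \<noteq> (g x = a \<and> h \<in> K)))"
    have F: "F (x, b) (h, e) = (h \<otimes> g x, e \<noteq> (g x = a \<and> h \<in> K))" for x b h e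
      by (simp add: F_def)
    let ?A = "carrier G \<times> (UNIV :: bool set)"
    obtain \<alpha> where \<alpha>1: "\<And>o'. o' \<in> ?A \<Longrightarrow> \<alpha> \<one>\<^bsub>?C\<^esub> o' = o'"
      and \<alpha>m: "\<And>c d o'. c \<in> carrier ?C \<Longrightarrow> d \<in> carrier ?C \<Longrightarrow> o' \<in> ?A \<Longrightarrow>
        \<alpha> (c \<otimes>\<^bsub>?C\<^esub> d) o' = \<alpha> d (\<alpha> c o')"
      and \<alpha>g: "\<And>x b o'. x \<in> S \<Longrightarrow> o' \<in> ?A \<Longrightarrow> \<alpha> (word_class S Rel [(x, b)]) o' = F (x, b) o'"
      and \<alpha>c: "\<And>c o'. c \<in> carrier ?C \<Longrightarrow> o' \<in> ?A \<Longrightarrow> \<alpha> c o' \<in> ?A"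
    proof (rule presented_group_action[of S ?A F Rel])
      show "F (x, b) o' \<in> ?A" if "x \<in> S" "o' \<in> ?A" for x b o'
        using that gc by (auto simp: F)
      show "F (x, \<not> b) (F (x, b) o') = o'" if "x \<in> S" "o' \<in> ?A" for x b o'
      proof -
        obtain h e where o': "o' = (h, e)" "h \<in> carrier G" using \<open>o' \<in> ?A\<close> by auto
        have "h \<otimes> g x \<otimes> g x = h" using o'(2) that gc sq by (simp add: m_assoc)
        then show ?thesis using Kst[OF o'(2) that(1)] o'(1) by (auto simp: F)
      qed
      show "fold F u o' = fold F v o'"
        if uv: "(u, v) \<in> Rel" "u \<in> words_over S" "v \<in> words_over S" "o' \<in> ?A" for u v o'
      proof -
        obtain h e where o': "o' = (h, e)" "h \<in> carrier G" using uv(4) by auto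
        obtain s t n where st: "s \<in> S" "t \<in> S" "m s t = enat n"
          and u: "u = concat (replicate n [(s, True), (t, True)])" "v = []"
          using uv(1) by (auto simp: Rel_def)
        have gs: "g s \<in> carrier G" "g t \<in> carrier G" using gc st by auto
        note c = comm[OF st]
        define d where "d \<longleftrightarrow> (g s = a) \<noteq> (g t = a)"
        have inK: "h \<otimes> g s \<in> K \<longleftrightarrow> h \<in> K" "h \<otimes> g t \<in> K \<longleftrightarrow> h \<in> K"
          if "h \<in> carrier G" "g s = a \<or> g t = a" for h
          using Kst[OF that(1) st(1)] Kst[OF that(1) st(2)] c(1) that(2) by auto
        have two: "F (t, True) (F (s, True) (h, e)) = (h \<otimes> (g s \<otimes> g t), e \<noteq> (d \<and> h \<in> K))"
          if "h \<in> carrier G" for h e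
          using inK[OF that] gs that by (auto simp: F d_def m_assoc)
        have "fold F u (h, e) = (((\<lambda>h. h \<otimes> (g s \<otimes> g t)) ^^ n) h, e \<noteq> (odd n \<and> d \<and> h \<in> K))"
          unfolding u(1)
        proof (rule fold_replicate_pairs[where A = "carrier G" and F = F and
              f = "\<lambda>h. h \<otimes> (g s \<otimes> g t)" and d = d and K = K])
          show "F (t, True) (F (s, True) (h, e)) = (h \<otimes> (g s \<otimes> g t), e \<noteq> (d \<and> h \<in> K))"
            if "h \<in> carrier G" for h e using that by (rule two)
          show "h \<otimes> (g s \<otimes> g t) \<in> K \<longleftrightarrow> h \<in> K" if "d" "h \<in> carrier G" for h
            using inK[of h] inK[of "h \<otimes> g s"] that gs by (auto simp: d_def m_assoc[symmetric])
        qed (use gs o' in auto)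
        moreover have "((\<lambda>h. h \<otimes> (g s \<otimes> g t)) ^^ k) h = h \<otimes> (g s \<otimes> g t) [^] k" for k
          by (induction k) (use gs o' in \<open>auto simp: m_assoc\<close>)
        moreover have "\<not> (odd n \<and> d)" using c(3) by (auto simp: d_def)
        ultimately show ?thesis using rel[OF st] o' u(2) by auto
      qed
    qed blast
    define \<chi> where "\<chi> h = snd (\<alpha> (\<phi> h) (\<one>, False))" for h
    have step: "\<alpha> (\<phi> (h \<otimes> g x)) (\<one>, False) = F (x, True) (\<alpha> (\<phi> h) (\<one>, False))"
      if "h \<in> carrier G" "x \<in> S" for h x
    proof -
      have "\<phi> (h \<otimes> g x) = \<phi> h \<otimes>\<^bsub>?C\<^esub> \<iota> x" using that gc \<phi>\<psi>[OF \<iota>[OF that(2)]] by (simp add: g_def)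
      then show ?thesis using that \<iota> \<alpha>m \<alpha>g \<alpha>c by (simp add: \<iota>_def)
    qed
    have fst: "fst (\<alpha> (\<phi> h) (\<one>, False)) = h" if h: "h \<in> carrier G" for h
    proof -
      obtain w where "w \<in> lists (g ` S)" "word_prod w = h"
        using generate_involutions_word[of "g ` S" h] gc sq gen h by auto
      moreover have "fst (\<alpha> (\<phi> (word_prod w)) (\<one>, False)) = word_prod w" if "w \<in> lists (g ` S)" for w
        using that
      proof (induction w rule: rev_induct)
        case Nil
        then show ?case using \<alpha>1 by simp
      next
        case (snoc b w)
        then obtain x where x: "x \<in> S" "b = g x" by auto
        have "set w \<subseteq> carrier G" using snoc.prems gc by auto
        then have w: "word_prod (w @ [b]) = word_prod w \<otimes> g x" "word_prod w \<in> carrier G"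
          using x gc by auto
        have "fst (\<alpha> (\<phi> (word_prod w)) (\<one>, False)) = word_prod w" using snoc by simp
        then show ?case
          unfolding w(1) step[OF w(2) x(1)] by (cases "\<alpha> (\<phi> (word_prod w)) (\<one>, False)") (simp add: F)
      qed
      ultimately show ?thesis by blast
    qed
    show "\<exists>\<chi>. \<forall>h\<in>carrier G. \<forall>b\<in>g ` S. \<chi> (h \<otimes> b) \<longleftrightarrow> \<chi> h \<noteq> (b = a \<and> h \<in> K)"
    proof (intro exI[of _ \<chi>] ballI)
      fix h b assume h: "h \<in> carrier G" and "b \<in> g ` S"
      then obtain x where x: "x \<in> S" "b = g x" by blast
      show "\<chi> (h \<otimes> b) \<longleftrightarrow> \<chi> h \<noteq> (b = a \<and> h \<in> K)"
        using fst[OF h] unfolding \<chi>_def x(2) step[OF h x(1)]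
        by (cases "\<alpha> (\<phi> h) (\<one>, False)") (simp add: F)
    qed
  qed
  then show thesis using that[of g] gc gen sq by blast
qed

section \<open>Right-angled Coxeter groups\<close>

text \<open>The action \<open>\<delta>\<close> is that of an infinite dihedral group on a line, \<open>a\<close> and \<open>b\<close> being the reflections
  in \<open>0\<close> and \<open>2\<close>. Stripping a shortest representative of the coset of \<open>g\<close> reduces the claim to an
  alternating word \<open>w\<close> in \<open>a\<close> and \<open>b\<close>. A path that leaves the interval between \<open>0\<close> and \<open>2\<close> through
  one end never crosses the walls beyond the other end: a reflection \<open>n \<mapsto> c - n\<close> with
  \<open>c \<ge> 4\<close> has its wall at or beyond \<open>2\<close>, one with \<open>c \<le> 0\<close> at or below \<open>0\<close>.\<close>

lemma (in reflection_system) dihedral_descents: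
  fixes \<delta> :: "'a \<Rightarrow> int \<Rightarrow> int"
  assumes ab: "a \<in> A" "b \<in> A"
    and \<delta>_mult: "\<And>g h n. g \<in> carrier G \<Longrightarrow> h \<in> carrier G \<Longrightarrow> \<delta> (g \<otimes> h) n = \<delta> h (\<delta> g n)"
    and \<delta>_a: "\<And>n. \<delta> a n = - n" and \<delta>_b: "\<And>n. \<delta> b n = 4 - n"
    and g: "g \<in> carrier G" "a \<in> N g" "b \<in> N g"
  shows False
proof -
  define P where "P x \<longleftrightarrow> x \<in> carrier G \<and> (\<exists>w\<in>lists {a, b}. g = word_prod w \<otimes> x)" for x
  have "P g" using g(1) by (auto simp: P_def intro!: bexI[of _ "[]"])
  then obtain x where x: "P x" and min: "\<And>x'. P x' \<Longrightarrow> len x \<le> len x'"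
    using ex_has_least_nat[of P g len] by blast
  have xc: "x \<in> carrier G" using x by (simp add: P_def)
  let ?Q = "\<lambda>w. w \<in> lists {a, b} \<and> g = word_prod w \<otimes> x"
  obtain w where w: "?Q w" and wmin: "\<And>v. ?Q v \<Longrightarrow> length w \<le> length v"
    using ex_has_least_nat[of ?Q _ length] x unfolding P_def by metis
  have sub: "set v \<subseteq> carrier G" if "v \<in> lists {a, b}" for v using that ab by auto
  have wc: "word_prod w \<in> carrier G" using w sub by simp
  have inN: "p \<in> N (word_prod w)" if p: "p \<in> {a, b}" "p \<in> N g" for p
  proof (rule ccontr)
    assume no: "p \<notin> N (word_prod w)"
    have pA: "p \<in> A" and pc: "p \<in> carrier G" using p ab by auto
    let ?q = "inv (word_prod w) \<otimes> p \<otimes> word_prod w"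
    have "?q \<in> N x" using N_mult[OF wc xc pc] no p(2) w by simp
    then have "len (?q \<otimes> x) < len x" using N_length_less xc by blast
    moreover have "P (?q \<otimes> x)"
    proof -
      have "word_prod (p # w) \<otimes> (?q \<otimes> x) = p \<otimes> (p \<otimes> (word_prod w \<otimes> x))"
        using pc wc xc by (simp add: group_word_simps)
      also have "\<dots> = g" using pA wc xc w by simp
      finally show ?thesis using p(1) w pc wc xc unfolding P_def by (intro conjI bexI[of _ "p # w"]) auto
    qed
    ultimately show False using min by fastforce
  qed
  have "distinct_adj w"
  proof (rule ccontr)
    assume "\<not> distinct_adj w"
    then obtain u y v where u: "w = u @ [y, y] @ v"
    proof (induction w)
      case (Cons z w)
      show ?case
      proof (cases "distinct_adj w")
        case True
        then obtain v where "w = z # v" using Cons.prems by (cases w) auto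
        then show ?thesis using Cons.prems(1)[of "[]" z v] by simp
      next
        case False
        show ?thesis
        proof (rule Cons.IH[OF _ False])
          fix u y v assume "w = u @ [y, y] @ v"
          then show ?thesis using Cons.prems(1)[of "z # u" y v] by simp
        qed
      qed
    qed simp
    have y: "y \<in> A" and uv: "u \<in> lists {a, b}" "v \<in> lists {a, b}" using w u ab by auto
    have "word_prod w = word_prod (u @ v)"
      using y sub[OF uv(1)] sub[OF uv(2)] u by simp
    then show False using wmin[of "u @ v"] uv w u by simp
  qed
  have "(v = [] \<or> hd v = a \<longrightarrow> (\<forall>p\<in>carrier G. \<forall>c\<ge>4. (\<forall>n. \<delta> p n = c - n) \<longrightarrow> p \<notin> N (word_prod v))) \<and>
      (v = [] \<or> hd v = b \<longrightarrow> (\<forall>p\<in>carrier G. \<forall>c\<le>0. (\<forall>n. \<delta> p n = c - n) \<longrightarrow> p \<notin> N (word_prod v)))"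
    if "v \<in> lists {a, b}" "distinct_adj v" for v
    using that
  proof (induction v)
    case (Cons y v)
    have v: "v \<in> lists {a, b}" "distinct_adj v" and y: "y = a \<or> y = b"
      using Cons.hyps Cons.prems by (auto simp: distinct_adj_Cons)
    have vc: "word_prod v \<in> carrier G" using v sub by simp
    have hd: "v = [] \<or> hd v \<in> {a, b} - {y}"
      using Cons.prems v(1) by (cases v) auto
    have ne: "a \<noteq> b" using \<delta>_a[of 0] \<delta>_b[of 0] by auto
    have A_case: "p \<notin> N (a \<otimes> word_prod v)"
      if "y = a" and p: "p \<in> carrier G" "c \<ge> 4" "\<And>n. \<delta> p n = c - n" for p c
    proof -
      have "\<delta> (a \<otimes> p \<otimes> a) n = - c - n" for n
        using p ab by (simp add: \<delta>_mult \<delta>_a)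
      moreover have "v = [] \<or> hd v = b" using hd \<open>y = a\<close> by auto
      ultimately have "a \<otimes> p \<otimes> a \<notin> N (word_prod v)"
        using Cons.IH v p ab by (metis gen_closed m_closed neg_le_0_iff_le order.trans zero_le_numeral)
      moreover have "p \<noteq> a" using p(2) p(3)[of 0] \<delta>_a[of 0] by auto
      ultimately show ?thesis using N_gen_mult[OF ab(1) vc p(1)] by simp
    qed
    have B_case: "p \<notin> N (b \<otimes> word_prod v)"
      if "y = b" and p: "p \<in> carrier G" "c \<le> 0" "\<And>n. \<delta> p n = c - n" for p c
    proof -
      have "\<delta> (b \<otimes> p \<otimes> b) n = (8 - c) - n" for n
        using p ab by (simp add: \<delta>_mult \<delta>_b)
      moreover have "v = [] \<or> hd v = a" using hd \<open>y = b\<close> by auto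
      moreover have "8 - c \<ge> 4" using p(2) by simp
      ultimately have "b \<otimes> p \<otimes> b \<notin> N (word_prod v)"
        using Cons.IH v p ab by (metis gen_closed m_closed)
      moreover have "p \<noteq> b" using p(2) p(3)[of 0] \<delta>_b[of 0] by auto
      ultimately show ?thesis using N_gen_mult[OF ab(2) vc p(1)] by simp
    qed
    show ?case using y ne A_case B_case by auto
  qed simp
  then have *: "w = [] \<or> hd w = a \<Longrightarrow> b \<notin> N (word_prod w)" "w = [] \<or> hd w = b \<Longrightarrow> a \<notin> N (word_prod w)"
    using w \<open>distinct_adj w\<close> ab \<delta>_a \<delta>_b
    by (metis gen_closed order.refl, metis gen_closed order.refl diff_0)
  moreover have "w = [] \<or> hd w = a \<or> hd w = b" using w by (cases w) auto
  ultimately show False using inN g by blast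
qed

lemma racg_int_action:
  fixes f :: "'v \<Rightarrow> int \<Rightarrow> int"
  assumes "\<And>x n. x \<in> V \<Longrightarrow> f x (f x n) = n"
    and "\<And>x y n. x \<in> V \<Longrightarrow> y \<in> V \<Longrightarrow> {x, y} \<in> E \<Longrightarrow> f x (f y n) = f y (f x n)"
  obtains \<delta> where
    "\<And>g h n. g \<in> carrier (racg V E) \<Longrightarrow> h \<in> carrier (racg V E) \<Longrightarrow>
      \<delta> (g \<otimes>\<^bsub>racg V E\<^esub> h) n = \<delta> h (\<delta> g n)"
    "\<And>x n. x \<in> V \<Longrightarrow> \<delta> (word_class V (racg_relations V E) [(x, True)]) n = f x n"
proof (rule presented_group_action[of V UNIV "\<lambda>l. f (fst l)" "racg_relations V E"])
  fix u v :: "'v word" and n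
  assume "(u, v) \<in> racg_relations V E" "u \<in> words_over V" "v \<in> words_over V"
  then show "fold (\<lambda>l. f (fst l)) u n = fold (\<lambda>l. f (fst l)) v n"
    unfolding racg_relations_def by (auto simp: assms(1) intro: assms(2)[symmetric])
next
  fix \<alpha>
  assume "\<And>g h n. g \<in> carrier (presented_group V (racg_relations V E)) \<Longrightarrow>
      h \<in> carrier (presented_group V (racg_relations V E)) \<Longrightarrow> n \<in> UNIV \<Longrightarrow>
      \<alpha> (g \<otimes>\<^bsub>presented_group V (racg_relations V E)\<^esub> h) n = \<alpha> h (\<alpha> g n)"
    "\<And>x b n. x \<in> V \<Longrightarrow> n \<in> UNIV \<Longrightarrow>
      \<alpha> (word_class V (racg_relations V E) [(x, b)]) n = f (fst (x, b)) n"
  then show thesis using that[of \<alpha>] by (simp add: racg_def)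
qed (use assms in auto)

lemma racg_gens_simps:
  fixes V E
  defines "G \<equiv> racg V E"
  shows "racg_gens V E \<subseteq> carrier G" "generate G (racg_gens V E) = carrier G"
    and "s \<in> racg_gens V E \<Longrightarrow> s \<otimes>\<^bsub>G\<^esub> s = \<one>\<^bsub>G\<^esub>"
    and "x \<in> V \<Longrightarrow> y \<in> V \<Longrightarrow> {x, y} \<in> E \<Longrightarrow>
      word_class V (racg_relations V E) [(x, True)] \<otimes>\<^bsub>G\<^esub> word_class V (racg_relations V E) [(y, True)] =
      word_class V (racg_relations V E) [(y, True)] \<otimes>\<^bsub>G\<^esub> word_class V (racg_relations V E) [(x, True)]"
proof -
  have G: "G = presented_group V (racg_relations V E)" by (simp add: G_def racg_def)
  show "racg_gens V E \<subseteq> carrier G"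
    by (auto simp: racg_gens_def G presented_group_def)
  show "generate G (racg_gens V E) = carrier G"
    unfolding G racg_gens_def by (rule generate_presented_group)
  show "s \<otimes>\<^bsub>G\<^esub> s = \<one>\<^bsub>G\<^esub>" if s: "s \<in> racg_gens V E"
  proof -
    obtain x where x: "x \<in> V" "s = word_class V (racg_relations V E) [(x, True)]"
      using s by (auto simp: racg_gens_def)
    have "word_eq V (racg_relations V E) [(x, True), (x, True)] []"
      using x by (intro word_eq.relation) (auto simp: racg_relations_def)
    then have "word_class V (racg_relations V E) [(x, True), (x, True)] =
        word_class V (racg_relations V E) []"
      using x by (subst word_class_eq_iff) auto
    moreover have "s \<otimes>\<^bsub>G\<^esub> s = word_class V (racg_relations V E) [(x, True), (x, True)]"
      unfolding G x(2) using x(1) by (subst mult_word_class) auto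
    ultimately show ?thesis by (simp add: G presented_group_def)
  qed
  show "word_class V (racg_relations V E) [(x, True)] \<otimes>\<^bsub>G\<^esub> word_class V (racg_relations V E) [(y, True)] =
      word_class V (racg_relations V E) [(y, True)] \<otimes>\<^bsub>G\<^esub> word_class V (racg_relations V E) [(x, True)]"
    if "x \<in> V" "y \<in> V" "{x, y} \<in> E"
  proof -
    have "word_eq V (racg_relations V E) [(x, True), (y, True)] [(y, True), (x, True)]"
      using that by (intro word_eq.relation) (auto simp: racg_relations_def)
    then show ?thesis
      using that by (simp add: G mult_word_class word_class_eq_iff)
  qed
qed

text \<open>The group acts on pairs of an element \<open>p\<close> and a sign, where \<open>p\<close> is conjugated and the sign flips
  whenever \<open>p\<close> equals the generator that is applied. The sign accumulated along \<open>g\<close> tells whether the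
  wall \<open>p\<close> separates \<open>\<one>\<close> from \<open>g\<close>.\<close>

lemma racg_reflection_system:
  obtains N where "reflection_system (racg V E) (racg_gens V E) N"
proof -
  let ?G = "racg V E" let ?R = "racg_relations V E"
  have G: "?G = presented_group V ?R" by (simp add: racg_def)
  interpret group ?G unfolding G by (rule group_presented_group)
  define \<iota> where "\<iota> x = word_class V ?R [(x, True)]" for x
  have gens: "racg_gens V E = \<iota> ` V" by (simp add: racg_gens_def \<iota>_def)
  note simps = racg_gens_simps[where V = V and E = E]
  have \<iota>c: "\<iota> x \<in> carrier ?G" and \<iota>2: "\<iota> x \<otimes>\<^bsub>?G\<^esub> \<iota> x = \<one>\<^bsub>?G\<^esub>" if "x \<in> V" for x
    using simps(1,3) gens that by auto
  have \<iota>_cancel: "\<iota> x \<otimes>\<^bsub>?G\<^esub> (\<iota> x \<otimes>\<^bsub>?G\<^esub> g) = g" if "x \<in> V" "g \<in> carrier ?G" for x g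
    using that \<iota>c \<iota>2 by (simp flip: m_assoc)
  have \<iota>inv: "inv\<^bsub>?G\<^esub> \<iota> x = \<iota> x" if "x \<in> V" for x using that \<iota>c \<iota>2 by (simp add: inv_equality)
  define F where "F = (\<lambda>(x, b :: bool) (p, e). (\<iota> x \<otimes>\<^bsub>?G\<^esub> p \<otimes>\<^bsub>?G\<^esub> \<iota> x, e \<noteq> (p = \<iota> x)))"
  have F: "F (x, b) (p, e) = (\<iota> x \<otimes>\<^bsub>?G\<^esub> p \<otimes>\<^bsub>?G\<^esub> \<iota> x, e \<noteq> (p = \<iota> x))" for x b p e
    by (simp add: F_def)
  have conj_iff: "\<iota> x \<otimes>\<^bsub>?G\<^esub> p \<otimes>\<^bsub>?G\<^esub> \<iota> x = q \<longleftrightarrow> p = \<iota> x \<otimes>\<^bsub>?G\<^esub> q \<otimes>\<^bsub>?G\<^esub> \<iota> x"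
    if "x \<in> V" "p \<in> carrier ?G" "q \<in> carrier ?G" for x p q
    using that \<iota>c[OF that(1)] \<iota>_cancel[OF that(1)] \<iota>2[OF that(1)] by (auto simp: m_assoc)
  let ?A = "carrier ?G \<times> (UNIV :: bool set)"
  obtain \<alpha> where \<alpha>1: "\<And>o'. o' \<in> ?A \<Longrightarrow> \<alpha> \<one>\<^bsub>?G\<^esub> o' = o'"
    and \<alpha>m: "\<And>c d o'. c \<in> carrier ?G \<Longrightarrow> d \<in> carrier ?G \<Longrightarrow> o' \<in> ?A \<Longrightarrow>
      \<alpha> (c \<otimes>\<^bsub>?G\<^esub> d) o' = \<alpha> d (\<alpha> c o')"
    and \<alpha>g: "\<And>x b o'. x \<in> V \<Longrightarrow> o' \<in> ?A \<Longrightarrow> \<alpha> (word_class V ?R [(x, b)]) o' = F (x, b) o'"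
    and \<alpha>c: "\<And>c o'. c \<in> carrier ?G \<Longrightarrow> o' \<in> ?A \<Longrightarrow> \<alpha> c o' \<in> ?A"
    unfolding G
  proof (rule presented_group_action[of V "carrier (presented_group V ?R) \<times> (UNIV :: bool set)" F ?R],
      unfold G[symmetric])
    show "F (x, b) o' \<in> ?A" if "x \<in> V" "o' \<in> ?A" for x b o'
      using that \<iota>c by (auto simp: F)
    show "F (x, \<not> b) (F (x, b) o') = o'" if x: "x \<in> V" "o' \<in> ?A" for x b o'
    proof -
      obtain p e where o': "o' = (p, e)" "p \<in> carrier ?G" using x(2) by auto
      have "\<iota> x \<otimes>\<^bsub>?G\<^esub> p \<otimes>\<^bsub>?G\<^esub> \<iota> x = \<iota> x \<longleftrightarrow> p = \<iota> x"
        using conj_iff[OF x(1) o'(2) \<iota>c[OF x(1)]] \<iota>c[OF x(1)] \<iota>2[OF x(1)] by simp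
      then show ?thesis
        using o' conj_iff[OF x(1) o'(2), of "\<iota> x \<otimes>\<^bsub>?G\<^esub> p \<otimes>\<^bsub>?G\<^esub> \<iota> x"] \<iota>c[OF x(1)]
        by (auto simp: F)
    qed
    show "fold F u o' = fold F v o'"
      if uv: "(u, v) \<in> ?R" "u \<in> words_over V" "v \<in> words_over V" "o' \<in> ?A" for u v o'
    proof -
      obtain p e where o': "o' = (p, e)" "p \<in> carrier ?G" using uv(4) by auto
      from uv(1) consider (sq) s where "s \<in> V" "u = [(s, True), (s, True)]" "v = []"
        | (comm) s t where "{s, t} \<in> E" "u = [(s, True), (t, True)]" "v = [(t, True), (s, True)]"
        by (auto simp: racg_relations_def)
      then show ?thesis
      proof cases
        case sq
        have "\<iota> s \<otimes>\<^bsub>?G\<^esub> p \<otimes>\<^bsub>?G\<^esub> \<iota> s = \<iota> s \<longleftrightarrow> p = \<iota> s"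
          using conj_iff[OF sq(1) o'(2) \<iota>c[OF sq(1)]] \<iota>c[OF sq(1)] \<iota>2[OF sq(1)] by simp
        then show ?thesis
          using o' conj_iff[OF sq(1) o'(2), of "\<iota> s \<otimes>\<^bsub>?G\<^esub> p \<otimes>\<^bsub>?G\<^esub> \<iota> s"] \<iota>c[OF sq(1)] sq(2,3)
          by (auto simp: F)
      next
        case comm
        then have st: "s \<in> V" "t \<in> V" using uv(2) by auto
        note c = \<iota>c[OF st(1)] \<iota>c[OF st(2)]
        have com: "\<iota> s \<otimes>\<^bsub>?G\<^esub> \<iota> t = \<iota> t \<otimes>\<^bsub>?G\<^esub> \<iota> s"
          using simps(4)[OF st comm(1)] by (simp add: \<iota>_def)
        have conj1: "\<iota> s \<otimes>\<^bsub>?G\<^esub> \<iota> t \<otimes>\<^bsub>?G\<^esub> \<iota> s = \<iota> t"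
          unfolding com using c \<iota>2[OF st(1)] by (simp add: m_assoc)
        have conj2: "\<iota> t \<otimes>\<^bsub>?G\<^esub> \<iota> s \<otimes>\<^bsub>?G\<^esub> \<iota> t = \<iota> s"
          unfolding com[symmetric] using c \<iota>2[OF st(2)] by (simp add: m_assoc)
        have e1: "\<iota> s \<otimes>\<^bsub>?G\<^esub> p \<otimes>\<^bsub>?G\<^esub> \<iota> s = \<iota> t \<longleftrightarrow> p = \<iota> t"
          using conj_iff[OF st(1) o'(2) c(2)] conj1 by simp
        have e2: "\<iota> t \<otimes>\<^bsub>?G\<^esub> p \<otimes>\<^bsub>?G\<^esub> \<iota> t = \<iota> s \<longleftrightarrow> p = \<iota> s"
          using conj_iff[OF st(2) o'(2) c(1)] conj2 by simp
        have "\<iota> t \<otimes>\<^bsub>?G\<^esub> (\<iota> s \<otimes>\<^bsub>?G\<^esub> p \<otimes>\<^bsub>?G\<^esub> \<iota> s) \<otimes>\<^bsub>?G\<^esub> \<iota> t =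
            (\<iota> t \<otimes>\<^bsub>?G\<^esub> \<iota> s) \<otimes>\<^bsub>?G\<^esub> p \<otimes>\<^bsub>?G\<^esub> (\<iota> s \<otimes>\<^bsub>?G\<^esub> \<iota> t)"
          using c o'(2) by (simp add: m_assoc)
        also have "\<dots> = (\<iota> s \<otimes>\<^bsub>?G\<^esub> \<iota> t) \<otimes>\<^bsub>?G\<^esub> p \<otimes>\<^bsub>?G\<^esub> (\<iota> t \<otimes>\<^bsub>?G\<^esub> \<iota> s)"
          using com by simp
        also have "\<dots> = \<iota> s \<otimes>\<^bsub>?G\<^esub> (\<iota> t \<otimes>\<^bsub>?G\<^esub> p \<otimes>\<^bsub>?G\<^esub> \<iota> t) \<otimes>\<^bsub>?G\<^esub> \<iota> s"
          using c o'(2) by (simp add: m_assoc)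
        finally show ?thesis using e1 e2 comm(2,3) o'(1) by (auto simp: F)
      qed
    qed
  qed blast
  define N where "N g = {p \<in> carrier ?G. snd (\<alpha> g (p, False))}" for g
  have \<alpha>_form: "\<alpha> g (p, e) = (inv\<^bsub>?G\<^esub> g \<otimes>\<^bsub>?G\<^esub> p \<otimes>\<^bsub>?G\<^esub> g, e \<noteq> (p \<in> N g))"
    if g: "g \<in> carrier ?G" and p: "p \<in> carrier ?G" for g p e
  proof -
    obtain w where w: "w \<in> lists (\<iota> ` V)" "word_prod w = g"
      using generate_involutions_word[of "\<iota> ` V" g] \<iota>c \<iota>2 simps(2) gens g by auto
    have "\<forall>e. \<alpha> (word_prod w) (p, e) = (inv\<^bsub>?G\<^esub> word_prod w \<otimes>\<^bsub>?G\<^esub> p \<otimes>\<^bsub>?G\<^esub> word_prod w,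
        e \<noteq> snd (\<alpha> (word_prod w) (p, False)))" if "w \<in> lists (\<iota> ` V)" for w
      using that
    proof (induction w rule: rev_induct)
      case Nil
      then show ?case using \<alpha>1 p by simp
    next
      case (snoc b w)
      then obtain x where x: "x \<in> V" "b = \<iota> x" by auto
      have "set w \<subseteq> carrier ?G" using snoc.prems \<iota>c by auto
      then have wc: "word_prod w \<in> carrier ?G" "word_prod (w @ [b]) = word_prod w \<otimes>\<^bsub>?G\<^esub> \<iota> x"
        using x \<iota>c by auto
      have step: "\<alpha> (word_prod (w @ [b])) (p, e) = F (x, True) (\<alpha> (word_prod w) (p, e))" for e
        unfolding wc(2) using \<alpha>m[OF wc(1) \<iota>c[OF x(1)], of "(p, e)"] \<alpha>g[OF x(1)] \<alpha>c[OF wc(1)] p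
        by (simp add: \<iota>_def)
      have IH: "\<alpha> (word_prod w) (p, e) = (inv\<^bsub>?G\<^esub> word_prod w \<otimes>\<^bsub>?G\<^esub> p \<otimes>\<^bsub>?G\<^esub> word_prod w,
          e \<noteq> snd (\<alpha> (word_prod w) (p, False)))" for e
      proof -
        have "w \<in> lists (\<iota> ` V)" using snoc.prems by simp
        from snoc.IH[OF this] show ?thesis by blast
      qed
      have "inv\<^bsub>?G\<^esub> word_prod (w @ [b]) \<otimes>\<^bsub>?G\<^esub> p \<otimes>\<^bsub>?G\<^esub> word_prod (w @ [b]) =
          \<iota> x \<otimes>\<^bsub>?G\<^esub> (inv\<^bsub>?G\<^esub> word_prod w \<otimes>\<^bsub>?G\<^esub> p \<otimes>\<^bsub>?G\<^esub> word_prod w) \<otimes>\<^bsub>?G\<^esub> \<iota> x"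
        unfolding wc(2) using wc(1) \<iota>c[OF x(1)] p \<iota>inv[OF x(1)] by (simp add: group_word_simps)
      then show ?case unfolding step by (subst (1 2) IH) (auto simp: F)
    qed
    from this[OF w(1)] have "\<alpha> (word_prod w) (p, e) =
        (inv\<^bsub>?G\<^esub> word_prod w \<otimes>\<^bsub>?G\<^esub> p \<otimes>\<^bsub>?G\<^esub> word_prod w,
        e \<noteq> snd (\<alpha> (word_prod w) (p, False)))" by blast
    then show ?thesis using p unfolding w(2) by (simp add: N_def)
  qed
  have "reflection_system ?G (racg_gens V E) N"
  proof
    show "N g \<subseteq> carrier ?G" for g by (auto simp: N_def)
    show "N a = {a}" if "a \<in> racg_gens V E" for a
    proof -
      obtain x where x: "x \<in> V" "a = \<iota> x" using \<open>a \<in> racg_gens V E\<close> gens by auto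
      have "\<alpha> a (p, False) = F (x, True) (p, False)" if "p \<in> carrier ?G" for p
        using \<alpha>g[OF x(1), of "(p, False)" True] that x(2) by (simp add: \<iota>_def)
      then show ?thesis using x \<iota>c by (auto simp: N_def F)
    qed
    show "p \<in> N (g \<otimes>\<^bsub>?G\<^esub> h) \<longleftrightarrow> (p \<in> N g) \<noteq> (inv\<^bsub>?G\<^esub> g \<otimes>\<^bsub>?G\<^esub> p \<otimes>\<^bsub>?G\<^esub> g \<in> N h)"
      if "g \<in> carrier ?G" "h \<in> carrier ?G" "p \<in> carrier ?G" for g h p
    proof -
      have "snd (\<alpha> (g \<otimes>\<^bsub>?G\<^esub> h) (p, False)) = (False \<noteq> (p \<in> N (g \<otimes>\<^bsub>?G\<^esub> h)))"
        using \<alpha>_form[of "g \<otimes>\<^bsub>?G\<^esub> h" p False] that by simp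
      moreover have "snd (\<alpha> (g \<otimes>\<^bsub>?G\<^esub> h) (p, False)) =
          ((p \<in> N g) \<noteq> (inv\<^bsub>?G\<^esub> g \<otimes>\<^bsub>?G\<^esub> p \<otimes>\<^bsub>?G\<^esub> g \<in> N h))"
        using \<alpha>m[OF that(1,2), of "(p, False)"] \<alpha>_form that by simp
      ultimately show ?thesis by simp
    qed
  qed (use simps in auto)
  then show thesis using that by blast
qed

text \<open>For nonadjacent \<open>s\<close> and \<open>t\<close>, killing the other vertices gives a map onto the infinite dihedral
  group. It shows that \<open>s\<close> and \<open>t\<close> do not commute, so commuting generators come from adjacent
  vertices.\<close>

lemma racg_right_angled_2d:
  assumes tf: "triangle_free E"
  obtains N where "right_angled_2d (racg V E) (racg_gens V E) N"
proof -
  let ?G = "racg V E"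
  obtain N where "reflection_system ?G (racg_gens V E) N" by (rule racg_reflection_system)
  then interpret reflection_system ?G "racg_gens V E" N .
  define \<iota> where "\<iota> x = word_class V (racg_relations V E) [(x, True)]" for x
  have gens: "racg_gens V E = \<iota> ` V" by (simp add: racg_gens_def \<iota>_def)
  have dihedral: "\<exists>\<delta>. (\<forall>g\<in>carrier ?G. \<forall>h\<in>carrier ?G. \<forall>n. \<delta> (g \<otimes>\<^bsub>?G\<^esub> h) n = \<delta> h (\<delta> g n)) \<and>
      (\<forall>n. \<delta> (\<iota> s) n = - n) \<and> (\<forall>n. \<delta> (\<iota> t) n = (4::int) - n)"
    if st: "s \<in> V" "t \<in> V" "s \<noteq> t" "{s, t} \<notin> E" for s t
  proof -
    define f where "f x n = (if x = s then - n else if x = t then 4 - n else n)" for x and n :: int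
    obtain \<delta> where "\<And>g h n. g \<in> carrier ?G \<Longrightarrow> h \<in> carrier ?G \<Longrightarrow>
      \<delta> (g \<otimes>\<^bsub>?G\<^esub> h) n = \<delta> h (\<delta> g n)" "\<And>x n. x \<in> V \<Longrightarrow> \<delta> (\<iota> x) n = f x n"
    proof (rule racg_int_action[of V f E])
      show "f x (f y n) = f y (f x n)" if "{x, y} \<in> E" for x y n
        using that st(4) by (auto simp: f_def insert_commute)
    qed (auto simp: f_def \<iota>_def)
    then show ?thesis using st by (intro exI[of _ \<delta>]) (auto simp: f_def)
  qed
  have noncomm: "{s, t} \<in> E" if st: "s \<in> V" "t \<in> V" "s \<noteq> t" "\<iota> s \<otimes>\<^bsub>?G\<^esub> \<iota> t = \<iota> t \<otimes>\<^bsub>?G\<^esub> \<iota> s" for s t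
  proof (rule ccontr)
    assume "{s, t} \<notin> E"
    then obtain \<delta> :: "_ \<Rightarrow> int \<Rightarrow> int" where \<delta>: "\<forall>g\<in>carrier ?G. \<forall>h\<in>carrier ?G. \<forall>n. \<delta> (g \<otimes>\<^bsub>?G\<^esub> h) n = \<delta> h (\<delta> g n)"
      "\<forall>n. \<delta> (\<iota> s) n = - n" "\<forall>n. \<delta> (\<iota> t) n = 4 - n"
      using dihedral[OF st(1-3)] by blast
    have "\<iota> s \<in> carrier ?G" "\<iota> t \<in> carrier ?G" using st gens by auto
    then have "\<delta> (\<iota> s \<otimes>\<^bsub>?G\<^esub> \<iota> t) 0 = 4" "\<delta> (\<iota> t \<otimes>\<^bsub>?G\<^esub> \<iota> s) 0 = - 4" using \<delta> by simp_all
    then show False using st(4) by simp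
  qed
  have "right_angled_system ?G (racg_gens V E) N"
  proof
    fix g a b assume *: "g \<in> carrier ?G" "a \<in> racg_gens V E" "b \<in> racg_gens V E" "a \<in> N g" "b \<in> N g"
    obtain s t where st: "s \<in> V" "t \<in> V" "a = \<iota> s" "b = \<iota> t" using * gens by auto
    show "a \<otimes>\<^bsub>?G\<^esub> b = b \<otimes>\<^bsub>?G\<^esub> a"
    proof (cases "s = t \<or> {s, t} \<in> E")
      case True
      then show ?thesis using racg_gens_simps(4)[OF st(1,2), where E = E] st by (auto simp: \<iota>_def)
    next
      case False
      then obtain \<delta> :: "_ \<Rightarrow> int \<Rightarrow> int" where \<delta>: "\<forall>g\<in>carrier ?G. \<forall>h\<in>carrier ?G. \<forall>n. \<delta> (g \<otimes>\<^bsub>?G\<^esub> h) n = \<delta> h (\<delta> g n)"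
        "\<forall>n. \<delta> (\<iota> s) n = - n" "\<forall>n. \<delta> (\<iota> t) n = 4 - n"
        using dihedral st by blast
      then show ?thesis using dihedral_descents[of a b \<delta> g] * st by blast
    qed
  qed
  then interpret right_angled_system ?G "racg_gens V E" N .
  have "right_angled_2d ?G (racg_gens V E) N"
  proof
    fix a b c assume *: "a \<in> racg_gens V E" "b \<in> racg_gens V E" "c \<in> racg_gens V E" "adj a b" "adj b c"
    show "\<not> adj a c"
    proof
      assume "adj a c"
      obtain s t u where st: "s \<in> V" "t \<in> V" "u \<in> V" "a = \<iota> s" "b = \<iota> t" "c = \<iota> u"
        using * gens by auto
      have "{s, t} \<in> E" "{t, u} \<in> E" "{s, u} \<in> E"
        using noncomm[OF st(1,2)] noncomm[OF st(2,3)] noncomm[OF st(1,3)] * \<open>adj a c\<close> st(4-6)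
        by (auto simp: adj_def)
      then show False using tf by (auto simp: triangle_free_def)
    qed
  qed
  then show thesis using that by blast
qed

section \<open>One-ended Coxeter subgroups\<close>

theorem theorem3:
  fixes V :: "'v set" and E :: "'v set set" and H :: "'v word set set"
  assumes "finite_simplicial_graph V E"
    and "triangle_free E"
    and "coxeter_subgroup H (racg V E)"
    and "one_ended ((racg V E)\<lparr>carrier := H\<rparr>)"
  shows "reflection_subgroup H V E \<and> quasiconvex (racg V E) (racg_gens V E) H"
proof -
  let ?G = "racg V E" let ?H = "?G\<lparr>carrier := H\<rparr>"
  obtain N where "right_angled_2d ?G (racg_gens V E) N"
    using racg_right_angled_2d assms(2) by blast
  then interpret W: right_angled_2d ?G "racg_gens V E" N .
  obtain S :: "nat set" and m where H: "subgroup H ?G"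
    and S: "finite S" "coxeter_matrix S m" "?H \<cong> coxeter_group S m"
    using assms(3) unfolding coxeter_subgroup_def by blast
  interpret H: group ?H using H by (rule W.subgroup_imp_group)
  have Hc: "h \<in> carrier ?G" if "h \<in> H" for h using subgroup.mem_carrier[OF H that] .
  have pow: "h [^]\<^bsub>?H\<^esub> n = h [^]\<^bsub>?G\<^esub> n" for h and n :: nat by (simp add: nat_pow_def)
  have tor: "h \<otimes>\<^bsub>?H\<^esub> h = \<one>\<^bsub>?H\<^esub>" if "h \<in> carrier ?H" "n > 0" "h [^]\<^bsub>?H\<^esub> (n::nat) = \<one>\<^bsub>?H\<^esub>" for h n
    using W.torsion_square[of h n] that Hc pow by simp
  obtain g where g: "g ` S \<subseteq> carrier ?H" "generate ?H (g ` S) = carrier ?H"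
    and sq: "\<And>b. b \<in> g ` S \<Longrightarrow> b \<otimes>\<^bsub>?H\<^esub> b = \<one>\<^bsub>?H\<^esub>"
    and split: "\<And>a. a \<in> g ` S \<Longrightarrow> H.splits_along (g ` S) a"
  proof (rule H.coxeter_generators[OF S(2,3) tor], goal_cases)
    case (4 g)
    show ?case using 4(1)[OF 4(2-5)] .
  qed
  \<comment> \<open>A Coxeter generator might a priori be trivial in the group, and \<open>\<one>\<close> is not a reflection.\<close>
  define T where "T = g ` S - {\<one>\<^bsub>?G\<^esub>}"
  have refl: "\<exists>z\<in>carrier ?G. \<exists>a\<in>racg_gens V E. t = z \<otimes>\<^bsub>?G\<^esub> a \<otimes>\<^bsub>?G\<^esub> inv\<^bsub>?G\<^esub> z" if t: "t \<in> T" for t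
  proof -
    have tH: "t \<in> H" "t \<in> g ` S" "t \<noteq> \<one>\<^bsub>?G\<^esub>" using t g(1) by (auto simp: T_def)
    have "t [^]\<^bsub>?G\<^esub> (2::nat) = \<one>\<^bsub>?G\<^esub>" using sq[OF tH(2)] Hc[OF tH(1)] by (simp add: numeral_2_eq_2)
    then obtain y w where y: "y \<in> carrier ?G" "t = y \<otimes>\<^bsub>?G\<^esub> w \<otimes>\<^bsub>?G\<^esub> inv\<^bsub>?G\<^esub> y"
      and w: "w = \<one>\<^bsub>?G\<^esub> \<or> w \<in> racg_gens V E \<or>
        (\<exists>a\<in>racg_gens V E. \<exists>b\<in>racg_gens V E. W.adj a b \<and> w = a \<otimes>\<^bsub>?G\<^esub> b)"
      using W.torsion_conj_clique[of t 2] Hc[OF tH(1)] by auto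
    have "w \<noteq> \<one>\<^bsub>?G\<^esub>" using y tH(3) by auto
    moreover have "\<not> (\<exists>a\<in>racg_gens V E. \<exists>b\<in>racg_gens V E. W.adj a b \<and> w = a \<otimes>\<^bsub>?G\<^esub> b)"
    proof
      assume "\<exists>a\<in>racg_gens V E. \<exists>b\<in>racg_gens V E. W.adj a b \<and> w = a \<otimes>\<^bsub>?G\<^esub> b"
      then have "finite {c \<in> carrier ?G. c \<otimes>\<^bsub>?G\<^esub> t = t \<otimes>\<^bsub>?G\<^esub> c}"
        using W.finite_centralizer_rotation y by blast
      then have "finite {c \<in> carrier ?H. c \<otimes>\<^bsub>?H\<^esub> t = t \<otimes>\<^bsub>?H\<^esub> c}"
        by (rule finite_subset[rotated]) (use Hc in auto)
      moreover have "b \<otimes>\<^bsub>?H\<^esub> c = c \<otimes>\<^bsub>?H\<^esub> b"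
        if bc: "b \<in> g ` S" "c \<in> g ` S" "n > 0" "(b \<otimes>\<^bsub>?H\<^esub> c) [^]\<^bsub>?H\<^esub> (n::nat) = \<one>\<^bsub>?H\<^esub>" for b c n
      proof -
        have c: "b \<in> carrier ?H" "c \<in> carrier ?H" using bc g(1) by auto
        then have "(b \<otimes>\<^bsub>?H\<^esub> c) \<otimes>\<^bsub>?H\<^esub> (b \<otimes>\<^bsub>?H\<^esub> c) = \<one>\<^bsub>?H\<^esub>" using tor[OF _ bc(3,4)] H.m_closed by blast
        then show ?thesis using H.involutions_commute[OF c] sq bc(1,2) by blast
      qed
      ultimately show False
        using H.one_ended_not_splits[OF assms(4) g sq _ tH(2) split[OF tH(2)]] by blast
    qed
    ultimately show ?thesis using w y by blast
  qed
  have TH: "T \<subseteq> H" using g(1) by (auto simp: T_def)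
  have "generate ?G (g ` S) = H"
    using W.generate_consistent[of "g ` S" H] g H by simp
  moreover have "generate ?G (g ` S) \<subseteq> generate ?G T"
  proof -
    have "g ` S \<subseteq> generate ?G T"
    proof
      fix b assume "b \<in> g ` S"
      then show "b \<in> generate ?G T"
        using generate.incl[of b T ?G] generate.one[of ?G T] by (cases "b = \<one>\<^bsub>?G\<^esub>") (auto simp: T_def)
    qed
    moreover have "subgroup (generate ?G T) ?G" using TH Hc by (intro W.generate_is_subgroup) auto
    ultimately show ?thesis by (rule W.generate_subgroup_incl)
  qed
  moreover have "generate ?G T \<subseteq> H" using W.generate_subgroup_incl[OF TH H] .
  ultimately have HT: "H = generate ?G T" by simp
  have "T \<subseteq> reflections V E" using refl unfolding reflections_def by fastforce
  then have "reflection_subgroup H V E" using HT unfolding reflection_subgroup_def by blast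
  moreover have "finite T" using S(1) by (simp add: T_def)
  then have "quasiconvex ?G (racg_gens V E) H"
    unfolding HT using W.reflection_subgroup_quasiconvex refl by blast
  ultimately show ?thesis ..
qed

end
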